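(* Let $p(\cdot)\in\mathcal{P}^{\log}([0,+\infty[)$ with $2<p^-\le p^+<+\infty$, and let $q>3$ be a (finite, constant) index such that $\frac{2}{p(\cdot)}+\frac{3}{q}<1$ (pointwise on $[0,+\infty[$). Let $\vec f\in L^{p(\cdot)}\big([0,+\infty[,L^q(\mathbb{R}^3)\big)$ be an exterior force with $\mathrm{div}(\vec f)=0$, and let $\vec u_0\in L^q(\mathbb{R}^3)$ be an initial data with $\mathrm{div}(\vec u_0)=0$. Then there exist a time $0<T<+\infty$ and a unique mild solution $\vec u$ on $[0,T]$ of the Navier-Stokes equations $$\partial_t\vec{u}=\Delta\vec{u}-(\vec{u}\cdot\vec{\nabla})\vec{u}-\vec{\nabla}P+\vec{f},\qquad \mathrm{div}(\vec{u})=0,\qquad \vec{u}(0,\cdot)=\vec{u}_0,\qquad x\in\mathbb{R}^3,$$ in the space $L^{p(\cdot)}\big([0,T],L^q(\mathbb{R}^3)\big)$.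
   Context: **Variable exponents.** For a measurable function $p(\cdot):[0,+\infty[\to[1,+\infty[$ put $p^-=\operatorname{ess\,inf}p$ and $p^+=\operatorname{ess\,sup}p$. Throughout, variable exponents are assumed to satisfy $1<p^-\le p^+<+\infty$. One says $p(\cdot)\in\mathcal{P}^{\log}([0,+\infty[)$ if there is a constant $C$ such that $$\left|\tfrac{1}{p(t)}-\tfrac{1}{p(s)}\right|\le\frac{C}{\log(e+1/|t-s|)}\ \text{ for all }t,s\ge0,\qquad \left|\tfrac{1}{p(t)}-\tfrac{1}{p_\infty}\right|\le\frac{C}{\log(e+t)}\ \text{ for all }t\ge0,$$ where $\frac1{p_\infty}=\lim_{t\to+\infty}\frac1{p(t)}$. **Spaces.** For $I=[0,T]$ or $I=[0,+\infty[$, the space $L^{p(\cdot)}(I,L^q(\mathbb{R}^3))$ consists of the measurable vector fields $\vec\varphi:I\times\mathbb{R}^3\to\mathbb{R}^3$ for which the Luxemburg norm $$\|\vec\varphi\|_{L^{p(\cdot)}(I,L^q)}=\inf\Big\{\lambda>0:\ \int_I\Big|\frac{\|\vec\varphi(t,\cdot)\|_{L^q(\mathbb{R}^3)}}{\lambda}\Big|^{p(t)}dt\le1\Big\}$$ is finite (the space norm is taken first, then the time norm). **Mild solutions.** Let $\mathfrak{g}_t$ be the heat kernel on $\mathbb{R}^3$ and $\mathbb{P}(\vec\varphi)=\vec\varphi+\vec\nabla\frac{1}{(-\Delta)}(\vec\nabla\cdot\vec\varphi)$ the Leray projector onto divergence free fields. A mild solution on $[0,T]$ is a solution of the integral equation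 $$\vec u(t,x)=\mathfrak{g}_t\ast\vec u_0(x)+\int_0^t\mathfrak{g}_{t-s}\ast\vec f(s,x)\,ds-\int_0^t\mathfrak{g}_{t-s}\ast\mathbb{P}(\mathrm{div}(\vec u\otimes\vec u))(s,x)\,ds,$$ where $\mathrm{div}(\vec u\otimes\vec u)$ is understood in the sense of distributions and the derivative is transferred to the kernel $\mathfrak{g}_{t-s}$ in the convolution. *)

theory Defs
  imports "HOL-Analysis.Analysis" "HOL-Probability.Essential_Supremum"
begin

section \<open>Variable exponents on the half line\<close>

definition essinf :: "'a measure \<Rightarrow> ('a \<Rightarrow> ereal) \<Rightarrow> ereal" where
  "essinf M f = - esssup M (\<lambda>x. - f x)"

definition exponent_minus :: "(real \<Rightarrow> real) \<Rightarrow> ereal" where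
  "exponent_minus p = essinf (restrict_space lborel {0..}) (\<lambda>t. ereal (p t))"

definition exponent_plus :: "(real \<Rightarrow> real) \<Rightarrow> ereal" where
  "exponent_plus p = esssup (restrict_space lborel {0..}) (\<lambda>t. ereal (p t))"

definition variable_exponent :: "(real \<Rightarrow> real) \<Rightarrow> bool" where
  "variable_exponent p \<longleftrightarrow>
     p \<in> borel_measurable (restrict_space lborel {0..}) \<and>
     (\<forall>t\<ge>0. 1 \<le> p t) \<and>
     1 < exponent_minus p \<and> exponent_minus p \<le> exponent_plus p \<and> exponent_plus p < \<infinity>"

text \<open>In the local condition the case \<open>t = s\<close> is left out: both sides are then \<open>0\<close> under the
  convention \<open>1 / log \<infinity> = 0\<close>, whereas \<open>1 / 0 = 0\<close> in HOL. The limit \<open>l\<close> is \<open>1 / p\<^sub>\<infinity>\<close>.\<close>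

definition log_Hoelder_exponent :: "(real \<Rightarrow> real) \<Rightarrow> bool" where
  "log_Hoelder_exponent p \<longleftrightarrow>
     variable_exponent p \<and>
     (\<exists>C l. ((\<lambda>t. 1 / p t) \<longlongrightarrow> l) at_top \<and>
        (\<forall>t\<ge>0. \<forall>s\<ge>0. t \<noteq> s \<longrightarrow> \<bar>1 / p t - 1 / p s\<bar> \<le> C / ln (exp 1 + 1 / \<bar>t - s\<bar>)) \<and>
        (\<forall>t\<ge>0. \<bar>1 / p t - l\<bar> \<le> C / ln (exp 1 + t)))"


section \<open>Lebesgue spaces\<close>

text \<open>Elements of these spaces are represented by Borel functions; every class modulo null sets
  of Lebesgue measurable functions has such a representative. Equality in the spaces is
  equality almost everywhere. Norms take values in \<^typ>\<open>ennreal\<close>, so that an infinite norm is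
  not confused with a finite one.\<close>

text \<open>Only used for exponents \<open>r > 0\<close>.\<close>

definition ennpowr :: "ennreal \<Rightarrow> real \<Rightarrow> ennreal" where
  "ennpowr a r = (if a = top then top else ennreal (enn2real a powr r))"

definition Lq_norm :: "real \<Rightarrow> (real^3 \<Rightarrow> real^3) \<Rightarrow> ennreal" where
  "Lq_norm q \<phi> = ennpowr (\<integral>\<^sup>+x. ennreal (norm (\<phi> x) powr q) \<partial>lborel) (1 / q)"

definition Lq_space :: "real \<Rightarrow> (real^3 \<Rightarrow> real^3) set" where
  "Lq_space q = {\<phi>. \<phi> \<in> borel_measurable lborel \<and> Lq_norm q \<phi> < top}"

definition Luxemburg_norm ::
  "(real \<Rightarrow> real) \<Rightarrow> real set \<Rightarrow> real \<Rightarrow> (real \<Rightarrow> real^3 \<Rightarrow> real^3) \<Rightarrow> ennreal" where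
  "Luxemburg_norm p I q \<phi> =
     Inf {ennreal \<kappa> | \<kappa>. \<kappa> > 0 \<and>
            (\<integral>\<^sup>+t\<in>I. ennpowr (Lq_norm q (\<phi> t) / ennreal \<kappa>) (p t) \<partial>lborel) \<le> 1}"

definition mixed_space ::
  "(real \<Rightarrow> real) \<Rightarrow> real set \<Rightarrow> real \<Rightarrow> (real \<Rightarrow> real^3 \<Rightarrow> real^3) set" where
  "mixed_space p I q =
     {\<phi>. (\<lambda>(t, x). \<phi> t x) \<in> borel_measurable (restrict_space lborel (I \<times> UNIV)) \<and>
          Luxemburg_norm p I q \<phi> < top}"


section \<open>Differential operators and test functions\<close>

definition partial :: "3 \<Rightarrow> (real^3 \<Rightarrow> real) \<Rightarrow> real^3 \<Rightarrow> real" where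
  "partial k f x = frechet_derivative f (at x) (axis k 1)"

definition gradient :: "(real^3 \<Rightarrow> real) \<Rightarrow> real^3 \<Rightarrow> real^3" where
  "gradient f x = (\<chi> k. partial k f x)"

definition divergence :: "(real^3 \<Rightarrow> real^3) \<Rightarrow> real^3 \<Rightarrow> real" where
  "divergence \<psi> x = (\<Sum>k\<in>UNIV. partial k (\<lambda>y. \<psi> y $ k) x)"

definition jacobian_field :: "(real^3 \<Rightarrow> real^3) \<Rightarrow> real^3 \<Rightarrow> real^3^3" where
  "jacobian_field \<psi> x = (\<chi> j k. partial k (\<lambda>y. \<psi> y $ j) x)"

primrec C_k :: "nat \<Rightarrow> (real^3 \<Rightarrow> real) \<Rightarrow> bool" where
  "C_k 0 f = continuous_on UNIV f"
| "C_k (Suc n) f = ((\<forall>x. f differentiable (at x)) \<and> (\<forall>k. C_k n (partial k f)))"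

definition test_function :: "(real^3 \<Rightarrow> real) \<Rightarrow> bool" where
  "test_function \<eta> \<longleftrightarrow> (\<forall>n. C_k n \<eta>) \<and> compact (closure {x. \<eta> x \<noteq> 0})"

text \<open>Vanishing divergence of a locally integrable field, in the sense of distributions.\<close>

definition div_free :: "(real^3 \<Rightarrow> real^3) \<Rightarrow> bool" where
  "div_free \<phi> \<longleftrightarrow> (\<forall>\<eta>. test_function \<eta> \<longrightarrow> (\<integral>x. \<phi> x \<bullet> gradient \<eta> x \<partial>lborel) = 0)"


section \<open>Heat kernel and Leray projector\<close>

definition convol ::
  "(real^3 \<Rightarrow> real) \<Rightarrow> (real^3 \<Rightarrow> 'a::{banach, second_countable_topology}) \<Rightarrow> real^3 \<Rightarrow> 'a" where
  "convol k \<phi> x = (\<integral>y. k (x - y) *\<^sub>R \<phi> y \<partial>lborel)"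

definition heat_kernel :: "real \<Rightarrow> real^3 \<Rightarrow> real" where
  "heat_kernel t x = exp (- (norm x)\<^sup>2 / (4 * t)) / (4 * pi * t) powr (3 / 2)"

text \<open>The fundamental solution of \<open>-\<Delta>\<close> on three-dimensional space; convolution with it is the
  operator \<open>1 / (-\<Delta>)\<close>.\<close>

definition Newton_kernel :: "real^3 \<Rightarrow> real" where
  "Newton_kernel x = 1 / (4 * pi * norm x)"

definition Leray :: "(real^3 \<Rightarrow> real^3) \<Rightarrow> real^3 \<Rightarrow> real^3" where
  "Leray \<psi> x = \<psi> x + gradient (convol Newton_kernel (divergence \<psi>)) x"

text \<open>Vector-valued distributions are functionals on vector test fields, with the pairing
  \<open>\<langle>T, \<psi>\<rangle> = \<Sum>\<^sub>j \<langle>T\<^sub>j, \<psi>\<^sub>j\<rangle>\<close>. The operations below are the usual ones by duality: derivatives go to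
  the test field with a sign, the Leray projector is symmetric, and
  \<open>(g * T\<^sub>i)(x) = \<langle>T\<^sub>i, g(x - \<cdot>)\<rangle>\<close>. They are applied to test fields that are Gaussian, or Leray
  projections of such fields; the latter are smooth with gradient decaying like \<open>|y|\<^sup>-\<^sup>4\<close>, so that
  the pairing of \<open>div F\<close> with them converges absolutely for \<open>F\<close> in any Lebesgue space.\<close>

type_synonym field_distr = "(real^3 \<Rightarrow> real^3) \<Rightarrow> real"

definition div_tensor :: "(real^3 \<Rightarrow> real^3^3) \<Rightarrow> field_distr" where
  "div_tensor F \<psi> = - (\<integral>y. F y \<bullet> jacobian_field \<psi> y \<partial>lborel)"

definition Leray_distr :: "field_distr \<Rightarrow> field_distr" where
  "Leray_distr T \<psi> = T (Leray \<psi>)"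

definition heat_convol_distr :: "real \<Rightarrow> field_distr \<Rightarrow> real^3 \<Rightarrow> real^3" where
  "heat_convol_distr t T x = (\<chi> i. T (\<lambda>y. heat_kernel t (x - y) *\<^sub>R axis i 1))"

definition tensor_prod :: "(real^3 \<Rightarrow> real^3) \<Rightarrow> (real^3 \<Rightarrow> real^3) \<Rightarrow> real^3 \<Rightarrow> real^3^3" where
  "tensor_prod u v x = (\<chi> j k. u x $ j * v x $ k)"


section \<open>Mild solutions of the Navier-Stokes equations\<close>

text \<open>The integral equation is an identity in \<open>L\<^sup>q\<close> for almost every \<open>t\<close>. For \<open>f\<close>, \<open>u\<close> in
  \<open>L\<^sup>p\<^sup>(\<^sup>\<cdot>\<^sup>)(L\<^sup>q)\<close> with \<open>p\<^sup>- > 2\<close> and \<open>q > 3\<close>, all the integrals converge absolutely for almost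
  every \<open>(t, x)\<close>.\<close>

definition mild_solution ::
  "real \<Rightarrow> (real^3 \<Rightarrow> real^3) \<Rightarrow> (real \<Rightarrow> real^3 \<Rightarrow> real^3) \<Rightarrow> (real \<Rightarrow> real^3 \<Rightarrow> real^3) \<Rightarrow> bool" where
  "mild_solution T u0 f u \<longleftrightarrow>
     (AE t in lborel. t \<in> {0..T} \<longrightarrow>
       (AE x in lborel.
          u t x = convol (heat_kernel t) u0 x
            + (LINT s:{0..t}|lborel. convol (heat_kernel (t - s)) (f s) x)
            - (LINT s:{0..t}|lborel.
                 heat_convol_distr (t - s) (Leray_distr (div_tensor (tensor_prod (u s) (u s)))) x)))"

end

theory Submission
  imports Defs "HOL-Probability.Probability" "HOL-Real_Asymp.Real_Asymp"
begin

text \<open>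
  Near \<open>t = 0\<close> the exponent \<open>p\<close> stays above a constant \<open>r\<close> with \<open>2 / r + 3 / q < 1\<close>, so on a short
  interval \<open>L\<^sup>\<infinity>(L\<^sup>q) \<subseteq> L\<^sup>p\<^sup>(\<^sup>\<cdot>\<^sup>)(L\<^sup>q) \<subseteq> L\<^sup>r(L\<^sup>q)\<close>: existence is shown in the first space and uniqueness
  in the last. The kernel of the heat semigroup composed with the Leray projector and the divergence
  is an explicit combination of the moments \<open>\<integral>\<^sub>0\<^sup>1 s\<^sup>n exp (- s\<^sup>2 v / 4) ds\<close>, which gives
  \<open>|K(\<tau>, z)| \<le> C (\<tau> + |z|\<^sup>2)\<^sup>-\<^sup>2\<close>. Young's inequality then bounds the bilinear term at time \<open>t\<close> in \<open>L\<^sup>q\<close> by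
  \<open>\<integral>\<^sub>0\<^sup>t (t - s)\<^sup>-\<^sup>\<alpha> \<parallel>u(s)\<parallel> \<parallel>v(s)\<parallel> ds\<close> with \<open>\<alpha> = 1/2 + 3/(2q) < 1\<close>. Existence follows by successive
  approximation. For the difference \<open>\<phi>\<close> of two solutions, Hoelder's inequality with exponents \<open>r\<close>, \<open>r'\<close>
  gives a linear Volterra inequality for \<open>\<phi>\<^sup>r\<^sup>'\<close> with the integrable kernel \<open>(t - s)\<^sup>-\<^sup>\<alpha>\<^sup>r\<^sup>'\<close>, hence \<open>\<phi> = 0\<close>
  on the whole interval.
\<close>

section \<open>Powers and norms of extended nonnegative functions\<close>

text \<open>The integrals in \<open>mild_solution\<close> are HOL integrals, with value 0 when they
  diverge. Estimates are therefore made first for nonnegative extended majorants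
  (\<open>Lnorm\<close>, \<open>bilin_maj\<close>), where Minkowski, Young and Tonelli need no
  finiteness; the actual integrals are identified only where the majorant is finite. The moments
  arise because 1 / |z| is a superposition of Gaussians exp (- \<rho>^2 |z|^2 / 4): the Newton
  potential of a Gaussian moment becomes a one-dimensional integral over b = \<rho> / sqrt (1 +
  \<tau> \<rho>^2), which runs up to 1 / sqrt \<tau>. The recurrence between the moments yields both
  the decay of the kernel and its vanishing divergence. Two spaces occur because a competitor in the
  uniqueness claim has no bound uniform in time. The requirement \<alpha> r' < 1 of the Volterra
  inequality is 2/r + 3/q < 1 in other words. The fixed point argument does not carry the constraint
  div u = 0; it is recovered afterwards by writing each of the three terms as a superposition of
  divergence-free fields.\<close>

abbreviation joint_borel :: "('a::topological_space \<Rightarrow> 'b::topological_space \<Rightarrow> 'c::topological_space) \<Rightarrow> bool" where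
  "joint_borel u \<equiv> case_prod u \<in> borel_measurable (borel \<Otimes>\<^sub>M borel)"

lemma ennpowr_ennreal [simp]: "0 \<le> x \<Longrightarrow> ennpowr (ennreal x) r = ennreal (x powr r)"
  by (simp add: ennpowr_def)

lemma ennpowr_top [simp]: "ennpowr top r = top"
  by (simp add: ennpowr_def)

lemma ennpowr_zero [simp]: "ennpowr 0 r = 0"
  by (simp add: ennpowr_def)

lemma ennpowr_eq_0_iff [simp]: "ennpowr a r = 0 \<longleftrightarrow> a = 0"
  by (cases a) (auto simp: ennreal_eq_0_iff)

lemma ennpowr_eq_top_iff [simp]: "ennpowr a r = top \<longleftrightarrow> a = top"
  by (cases a) auto

lemma ennpowr_1 [simp]: "ennpowr a 1 = a"
  by (cases a) auto

lemma measurable_ennpowr [measurable (raw)]: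
  assumes [measurable]: "f \<in> borel_measurable M" "g \<in> borel_measurable M"
  shows "(\<lambda>x. ennpowr (f x) (g x)) \<in> borel_measurable M"
  unfolding ennpowr_def by measurable

lemma ennpowr_mono: "a \<le> b \<Longrightarrow> 0 \<le> r \<Longrightarrow> ennpowr a r \<le> ennpowr b r"
  by (cases a; cases b) (auto simp: top_unique powr_mono2 intro!: ennreal_leI)

lemma ennpowr_mult: "ennpowr (a * b) r = ennpowr a r * ennpowr b r"
proof (cases "a = 0 \<or> b = 0 \<or> a = top \<or> b = top")
  case True
  then show ?thesis by (auto simp: ennreal_mult_top ennreal_top_mult)
next
  case False
  then obtain x y where "a = ennreal x" "b = ennreal y" "0 \<le> x" "0 \<le> y"
    by (cases a; cases b) auto
  then show ?thesis by (simp add: powr_mult flip: ennreal_mult)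
qed

lemma ennpowr_ennpowr [simp]: "ennpowr (ennpowr a r) s = ennpowr a (r * s)"
  by (cases a) (auto simp: powr_powr)

lemma ennpowr_add: "ennpowr a (r + s) = ennpowr a r * ennpowr a s"
  by (cases a) (auto simp: powr_add ennreal_mult ennreal_mult_top)

lemma ennpowr_le_iff: "0 < r \<Longrightarrow> ennpowr a r \<le> ennpowr b r \<longleftrightarrow> a \<le> b"
  using ennpowr_mono[of a b r] ennpowr_mono[of "ennpowr a r" "ennpowr b r" "1/r"] by auto

text \<open>Total on extended nonnegative functions and of the same shape as \<open>Lq_norm\<close>,
  so that norms of majorants can be compared before anything is known to be finite.\<close>

definition Lnorm :: "'a measure \<Rightarrow> real \<Rightarrow> ('a \<Rightarrow> ennreal) \<Rightarrow> ennreal" where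
  "Lnorm M q h = ennpowr (\<integral>\<^sup>+x. ennpowr (h x) q \<partial>M) (1 / q)"

lemma ennpowr_Lnorm: "0 < q \<Longrightarrow> ennpowr (Lnorm M q h) q = (\<integral>\<^sup>+x. ennpowr (h x) q \<partial>M)"
  by (simp add: Lnorm_def)

lemma Lnorm_le_iff:
  assumes "0 < q"
  shows "Lnorm M q h \<le> a \<longleftrightarrow> (\<integral>\<^sup>+x. ennpowr (h x) q \<partial>M) \<le> ennpowr a q"
  using assms ennpowr_le_iff[of q "Lnorm M q h" a] by (simp add: ennpowr_Lnorm)

lemma Lnorm_mono_AE:
  assumes "0 < q" "AE x in M. f x \<le> g x"
  shows "Lnorm M q f \<le> Lnorm M q g"
  unfolding Lnorm_def using assms
  by (intro ennpowr_mono nn_integral_mono_AE) (auto elim!: eventually_mono simp: ennpowr_le_iff)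

lemma Lnorm_mono: "0 < q \<Longrightarrow> (\<And>x. f x \<le> g x) \<Longrightarrow> Lnorm M q f \<le> Lnorm M q g"
  by (rule Lnorm_mono_AE) auto

lemma Lnorm_cong_AE:
  assumes "0 < q" "AE x in M. f x = g x"
  shows "Lnorm M q f = Lnorm M q g"
  using assms by (intro antisym Lnorm_mono_AE) auto

lemma Lnorm_eq_0_iff:
  assumes "0 < q" and [measurable]: "f \<in> borel_measurable M"
  shows "Lnorm M q f = 0 \<longleftrightarrow> (AE x in M. f x = 0)"
  by (simp add: Lnorm_def nn_integral_0_iff_AE)

lemma Lnorm_zero [simp]: "0 < q \<Longrightarrow> Lnorm M q (\<lambda>x. 0) = 0"
  by (simp add: Lnorm_eq_0_iff)

lemma Lnorm_cmult:
  assumes "0 < q" and [measurable]: "f \<in> borel_measurable M"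
  shows "Lnorm M q (\<lambda>x. c * f x) = c * Lnorm M q f"
  using assms by (simp add: Lnorm_def ennpowr_mult nn_integral_cmult)

lemma Lnorm_finite_AE:
  assumes "0 < q" "Lnorm M q f < top" and [measurable]: "f \<in> borel_measurable M"
  shows "AE x in M. f x < top"
proof -
  have "(\<integral>\<^sup>+x. ennpowr (f x) q \<partial>M) \<noteq> \<infinity>"
    using assms by (auto simp: Lnorm_def less_top[symmetric])
  from nn_integral_PInf_AE[OF _ this] show ?thesis by (auto simp: less_top)
qed

text \<open>The weights \<alpha>, \<beta> normalise the pointwise inequality: taking for them the
  integrals of f^p and g^q makes the bracket integrate to 1/p + 1/q = 1, which leaves exactly the
  product of the two norms.\<close>

lemma ennreal_Young:
  assumes "p > 1" "q > 1" "1 / p + 1 / q = 1" "0 < \<alpha>" "0 < \<beta>"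
  shows "a * b \<le> ennreal (\<alpha> powr (1/p) * \<beta> powr (1/q)) *
           (ennreal (1 / (p * \<alpha>)) * ennpowr a p + ennreal (1 / (q * \<beta>)) * ennpowr b q)"
proof (cases "a = 0 \<or> b = 0 \<or> a = top \<or> b = top")
  case True
  then show ?thesis using assms by (auto simp: ennreal_mult_top ennreal_top_mult ennreal_mult_eq_top_iff)
next
  case False
  then obtain x y where xy: "a = ennreal x" "b = ennreal y" "0 < x" "0 < y"
    by (cases a; cases b) (auto simp: order_less_le)
  let ?A = "\<alpha> powr (1/p)" and ?B = "\<beta> powr (1/q)"
  have "x * y = ?A * ?B * ((x / ?A) * (y / ?B))"
    using assms by simp
  also have "\<dots> \<le> ?A * ?B * ((x / ?A) powr p / p + (y / ?B) powr q / q)"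
    using assms xy by (intro mult_left_mono Youngs_inequality) auto
  also have "(x / ?A) powr p / p = 1 / (p * \<alpha>) * x powr p"
    using assms xy by (simp add: powr_divide powr_powr)
  also have "(y / ?B) powr q / q = 1 / (q * \<beta>) * y powr q"
    using assms xy by (simp add: powr_divide powr_powr)
  finally have "x * y \<le> ?A * ?B * (1 / (p * \<alpha>) * x powr p + 1 / (q * \<beta>) * y powr q)" .
  then show ?thesis using assms xy
    by (simp flip: ennreal_mult ennreal_plus)
qed

lemma nn_integral_Hoelder:
  assumes pq: "p > 1" "q > 1" "1 / p + 1 / q = 1"
    and [measurable]: "f \<in> borel_measurable M" "g \<in> borel_measurable M"
  shows "(\<integral>\<^sup>+x. f x * g x \<partial>M) \<le> Lnorm M p f * Lnorm M q g"
proof -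
  let ?A = "\<integral>\<^sup>+x. ennpowr (f x) p \<partial>M" and ?B = "\<integral>\<^sup>+x. ennpowr (g x) q \<partial>M"
  consider "?A = 0" | "?B = 0" | "?A \<noteq> 0" "?B \<noteq> 0" "?A = top \<or> ?B = top"
    | "?A \<noteq> 0" "?B \<noteq> 0" "?A \<noteq> top" "?B \<noteq> top" by blast
  then show ?thesis
  proof cases
    case 1
    then have "AE x in M. f x * g x = 0" by (auto simp: nn_integral_0_iff_AE)
    then show ?thesis by (subst nn_integral_cong_AE[where v="\<lambda>_. 0"]) auto
  next
    case 2
    then have "AE x in M. f x * g x = 0" by (auto simp: nn_integral_0_iff_AE)
    then show ?thesis by (subst nn_integral_cong_AE[where v="\<lambda>_. 0"]) auto
  next
    case 3
    then have "Lnorm M p f * Lnorm M q g = top"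
      unfolding Lnorm_def by (auto simp: ennreal_mult_eq_top_iff)
    then show ?thesis by simp
  next
    case 4
    then obtain \<alpha> \<beta> where ab: "?A = ennreal \<alpha>" "?B = ennreal \<beta>" "0 < \<alpha>" "0 < \<beta>"
      by (cases ?A; cases ?B) (auto simp: order_less_le)
    let ?K = "ennreal (\<alpha> powr (1/p) * \<beta> powr (1/q))"
    have "(\<integral>\<^sup>+x. f x * g x \<partial>M) \<le> (\<integral>\<^sup>+x. ?K *
           (ennreal (1 / (p * \<alpha>)) * ennpowr (f x) p + ennreal (1 / (q * \<beta>)) * ennpowr (g x) q) \<partial>M)"
      using pq ab by (intro nn_integral_mono ennreal_Young) auto
    also have "\<dots> = ?K * (ennreal (1 / (p * \<alpha>)) * ?A + ennreal (1 / (q * \<beta>)) * ?B)"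
      by (simp add: nn_integral_cmult nn_integral_add)
    also have "ennreal (1 / (p * \<alpha>)) * ?A + ennreal (1 / (q * \<beta>)) * ?B = ennreal (1/p + 1/q)"
      using pq ab by (simp flip: ennreal_mult ennreal_plus)
    also have "?K * ennreal (1/p + 1/q) = Lnorm M p f * Lnorm M q g"
      unfolding Lnorm_def using pq ab by (simp add: ennreal_mult)
    finally show ?thesis .
  qed
qed

text \<open>Jensen's inequality for the weight \<open>w\<close>: split w as w^(1/p) w^(1/q) with p
  conjugate to q and apply Hoelder. Both Minkowski's and Young's inequality are drawn from
  it.\<close>

lemma nn_integral_weighted_power_le:
  assumes "q \<ge> 1" and [measurable]: "w \<in> borel_measurable M" "h \<in> borel_measurable M"
  shows "ennpowr (\<integral>\<^sup>+x. w x * h x \<partial>M) q \<le>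
           ennpowr (\<integral>\<^sup>+x. w x \<partial>M) (q - 1) * (\<integral>\<^sup>+x. w x * ennpowr (h x) q \<partial>M)"
proof (cases "q = 1")
  case True
  show ?thesis
  \<comment> \<open>Here the exponent q - 1 is 0, and \<open>ennpowr 0 0 = 0\<close> as for
    \<open>powr\<close>; the factor is at least 1 only when the total weight is nonzero.\<close>
  proof (cases "(\<integral>\<^sup>+x. w x \<partial>M) = 0")
    case 0: True
    then have "AE x in M. w x * h x = 0" by (auto simp: nn_integral_0_iff_AE)
    then have "(\<integral>\<^sup>+x. w x * h x \<partial>M) = 0"
      by (subst nn_integral_cong_AE[where v="\<lambda>_. 0"]) auto
    then show ?thesis by simp
  next
    case False
    then have "1 \<le> ennpowr (\<integral>\<^sup>+x. w x \<partial>M) (q - 1)"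
      using True by (cases "\<integral>\<^sup>+x. w x \<partial>M") auto
    from mult_right_mono[OF this, of "\<integral>\<^sup>+x. w x * h x \<partial>M"] show ?thesis using True by auto
  qed
next
  case False
  define p where "p = q / (q - 1)"
  have q: "q > 1" "p > 1" "1 / p + 1 / q = 1" "q / p = q - 1"
    using False assms by (auto simp: p_def field_simps)
  have w: "w x * h x = ennpowr (w x) (1/p) * (ennpowr (w x) (1/q) * h x)" for x
    using ennpowr_add[of "w x" "1/p" "1/q"] q by (simp flip: mult.assoc)
  have "(\<integral>\<^sup>+x. w x * h x \<partial>M) \<le>
      Lnorm M p (\<lambda>x. ennpowr (w x) (1/p)) * Lnorm M q (\<lambda>x. ennpowr (w x) (1/q) * h x)"
    unfolding w by (rule nn_integral_Hoelder) (use q in auto)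
  from ennpowr_mono[OF this, of q] show ?thesis
    using q by (simp add: Lnorm_def ennpowr_mult)
qed

text \<open>Minkowski's integral inequality. Writing A s x = n s * (A s x / n s) with n s the norm
  of the slice, Jensen with weight n and Tonelli reduce it to slices of norm at most 1, and the
  powers of the total weight recombine. No duality is involved.\<close>

lemma Lnorm_integral_le:
  assumes M: "sigma_finite_measure M" and N: "sigma_finite_measure N" and q: "q > 1"
    and [measurable]: "case_prod A \<in> borel_measurable (M \<Otimes>\<^sub>M N)"
  shows "Lnorm N q (\<lambda>x. \<integral>\<^sup>+s. A s x \<partial>M) \<le> (\<integral>\<^sup>+s. Lnorm N q (A s) \<partial>M)"
proof -
  interpret M: sigma_finite_measure M by fact
  interpret N: sigma_finite_measure N by fact
  interpret P: pair_sigma_finite M N ..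
  let ?n = "\<lambda>s. Lnorm N q (A s)" and ?S = "\<integral>\<^sup>+s. Lnorm N q (A s) \<partial>M"
  have n[measurable]: "?n \<in> borel_measurable M" unfolding Lnorm_def by measurable
  show ?thesis
  proof (cases "?S = top")
    case False
    have "AE s in M. ?n s < top"
      using nn_integral_PInf_AE[OF n] False by (auto simp: less_top)
    \<comment> \<open>The factorisation fails for n s = 0 at points with A s x > 0, but these form a
      null set of the slice; exchanging the two quantifiers moves the exceptional set to x.\<close>
    then have "AE s in M. AE x in N. A s x \<le> ?n s * (A s x / ?n s)"
      using AE_space
    proof eventually_elim
      case (elim s)
      show ?case
      proof (cases "?n s = 0")
        case True
        then have "AE x in N. A s x = 0"
          using q elim by (subst (asm) Lnorm_eq_0_iff) auto
        then show ?thesis by eventually_elim simp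
      qed (use elim in \<open>auto simp: ennreal_times_divide mult_divide_eq_ennreal mult.commute[of "?n s"]\<close>)
    qed
    then have "AE x in N. AE s in M. A s x \<le> ?n s * (A s x / ?n s)"
      by (subst (asm) P.AE_commute) auto
    then have "Lnorm N q (\<lambda>x. \<integral>\<^sup>+s. A s x \<partial>M) \<le> Lnorm N q (\<lambda>x. \<integral>\<^sup>+s. ?n s * (A s x / ?n s) \<partial>M)"
      using q by (intro Lnorm_mono_AE) (auto elim!: eventually_mono intro!: nn_integral_mono_AE)
    also have "\<dots> \<le> ?S"
    proof (subst Lnorm_le_iff)
      have "(\<integral>\<^sup>+x. ennpowr (\<integral>\<^sup>+s. ?n s * (A s x / ?n s) \<partial>M) q \<partial>N) \<le>
          (\<integral>\<^sup>+x. ennpowr ?S (q - 1) * (\<integral>\<^sup>+s. ?n s * ennpowr (A s x / ?n s) q \<partial>M) \<partial>N)"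
        using q by (intro nn_integral_mono nn_integral_weighted_power_le) auto
      also have "\<dots> = ennpowr ?S (q - 1) * (\<integral>\<^sup>+x. (\<integral>\<^sup>+s. ?n s * ennpowr (A s x / ?n s) q \<partial>M) \<partial>N)"
        by (intro nn_integral_cmult) auto
      also have "(\<integral>\<^sup>+x. (\<integral>\<^sup>+s. ?n s * ennpowr (A s x / ?n s) q \<partial>M) \<partial>N) =
          (\<integral>\<^sup>+s. (\<integral>\<^sup>+x. ?n s * ennpowr (A s x / ?n s) q \<partial>N) \<partial>M)"
        by (rule P.Fubini') auto
      also have "\<dots> \<le> (\<integral>\<^sup>+s. ?n s * 1 \<partial>M)"
      proof (intro nn_integral_mono)
        fix s
        have "(\<integral>\<^sup>+x. ennpowr (A s x / ?n s) q \<partial>N) = (\<integral>\<^sup>+x. ennpowr (A s x) q * ennpowr (inverse (?n s)) q \<partial>N)" if "s \<in> space M"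
          by (simp add: divide_ennreal_def ennpowr_mult)
        also have "\<dots> = ennpowr (?n s) q * ennpowr (inverse (?n s)) q" if "s \<in> space M"
          using q that by (subst nn_integral_multc) (auto simp: ennpowr_Lnorm)
        also have "\<dots> = ennpowr (?n s / ?n s) q"
          by (simp add: ennpowr_mult divide_ennreal_def)
        also have "\<dots> \<le> 1"
          using q by (cases "?n s = 0 \<or> ?n s = top") (auto simp: ennreal_divide_self less_top[symmetric] simp flip: ennreal_1)
        finally have *: "(\<integral>\<^sup>+x. ennpowr (A s x / ?n s) q \<partial>N) \<le> 1" if "s \<in> space M" using that by auto
        assume s: "s \<in> space M"
        have "(\<integral>\<^sup>+x. ?n s * ennpowr (A s x / ?n s) q \<partial>N) = ?n s * (\<integral>\<^sup>+x. ennpowr (A s x / ?n s) q \<partial>N)"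
          using s by (intro nn_integral_cmult) auto
        also have "\<dots> \<le> ?n s * 1" using *[OF s] by (intro mult_left_mono) auto
        finally show "(\<integral>\<^sup>+x. ?n s * ennpowr (A s x / ?n s) q \<partial>N) \<le> ?n s * 1" .
      qed
      finally have "(\<integral>\<^sup>+x. ennpowr (\<integral>\<^sup>+s. ?n s * (A s x / ?n s) \<partial>M) q \<partial>N) \<le> ennpowr ?S (q - 1) * ?S"
        by (simp add: mult_left_mono)
      also have "ennpowr ?S (q - 1) * ?S = ennpowr ?S q"
        using ennpowr_add[of ?S "q - 1" 1] by simp
      finally show "(\<integral>\<^sup>+x. ennpowr (\<integral>\<^sup>+s. ?n s * (A s x / ?n s) \<partial>M) q \<partial>N) \<le> ennpowr ?S q" .
    qed (use q in auto)
    finally show ?thesis .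
  qed auto
qed

text \<open>Minkowski's integral inequality with counting measure on the indices.\<close>

lemma Lnorm_suminf_le:
  fixes h :: "nat \<Rightarrow> 'a \<Rightarrow> ennreal"
  assumes N: "sigma_finite_measure N" and q: "q > 1"
    and [measurable]: "\<And>n. h n \<in> borel_measurable N"
  shows "Lnorm N q (\<lambda>x. \<Sum>n. h n x) \<le> (\<Sum>n. Lnorm N q (h n))"
proof -
  have "case_prod h \<in> borel_measurable (count_space UNIV \<Otimes>\<^sub>M N)"
    by (rule measurable_pair_measure_countable1) auto
  from Lnorm_integral_le[OF sigma_finite_measure_count_space_countable N q this] show ?thesis
    by (simp add: nn_integral_count_space_nat)
qed

lemma Lnorm_add_le:
  assumes N: "sigma_finite_measure N" and q: "q > 1"
    and [measurable]: "f \<in> borel_measurable N" "g \<in> borel_measurable N"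
  shows "Lnorm N q (\<lambda>x. f x + g x) \<le> Lnorm N q f + Lnorm N q g"
proof -
  let ?h = "\<lambda>n::nat. if n = 0 then f else if n = 1 then g else (\<lambda>_. 0)"
  have "(\<Sum>n. ?h n x) = f x + g x" for x
    by (subst suminf_finite[of "{0,1}"]) auto
  moreover have "(\<Sum>n. Lnorm N q (?h n)) = Lnorm N q f + Lnorm N q g"
    using q by (subst suminf_finite[of "{0,1}"]) auto
  ultimately show ?thesis
    using Lnorm_suminf_le[OF N q, of ?h] by simp
qed

section \<open>Translation invariance and Young's inequality for convolutions\<close>

lemma nn_integral_lborel_shift:
  fixes f :: "'a::euclidean_space \<Rightarrow> ennreal"
  assumes [measurable]: "f \<in> borel_measurable borel"
  shows "(\<integral>\<^sup>+y. f (x + y) \<partial>lborel) = (\<integral>\<^sup>+y. f y \<partial>lborel)"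
  by (subst (2) lborel_distr_plus[of x, symmetric]) (simp add: nn_integral_distr)

lemma lborel_distr_uminus': "distr lborel borel uminus = (lborel :: 'a::euclidean_space measure)"
  using lborel_affine_euclidean[of "\<lambda>_. -1" "0::'a"]
  by (simp add: density_1 sum_negf euclidean_representation scaleR_sum_right[symmetric])

lemma nn_integral_lborel_reflect:
  fixes f :: "'a::euclidean_space \<Rightarrow> ennreal"
  assumes [measurable]: "f \<in> borel_measurable borel"
  shows "(\<integral>\<^sup>+y. f (x - y) \<partial>lborel) = (\<integral>\<^sup>+y. f y \<partial>lborel)"
proof -
  have "(\<integral>\<^sup>+y. f (x - y) \<partial>lborel) = (\<integral>\<^sup>+y. f (x + - y) \<partial>lborel)" by simp
  also have "\<dots> = (\<integral>\<^sup>+y. f (x + y) \<partial>lborel)"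
    by (subst (2) lborel_distr_uminus'[symmetric]) (simp add: nn_integral_distr)
  also have "\<dots> = (\<integral>\<^sup>+y. f y \<partial>lborel)" by (rule nn_integral_lborel_shift) auto
  finally show ?thesis .
qed

text \<open>Young's inequality for L^1 and L^q: Jensen with weight k (x - y) dy, then Tonelli and
  the translation invariance of the integral of k.\<close>

lemma Lnorm_convolution_le:
  fixes k h :: "'a::euclidean_space \<Rightarrow> ennreal"
  assumes q: "q \<ge> 1" and [measurable]: "k \<in> borel_measurable borel" "h \<in> borel_measurable borel"
  shows "Lnorm lborel q (\<lambda>x. \<integral>\<^sup>+y. k (x - y) * h y \<partial>lborel) \<le> (\<integral>\<^sup>+y. k y \<partial>lborel) * Lnorm lborel q h"
proof (subst Lnorm_le_iff)
  let ?K = "\<integral>\<^sup>+y. k y \<partial>lborel"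
  have "(\<integral>\<^sup>+x. ennpowr (\<integral>\<^sup>+y. k (x - y) * h y \<partial>lborel) q \<partial>lborel) \<le>
     (\<integral>\<^sup>+x. ennpowr ?K (q - 1) * (\<integral>\<^sup>+y. k (x - y) * ennpowr (h y) q \<partial>lborel) \<partial>lborel)"
    using q by (intro nn_integral_mono order_trans[OF nn_integral_weighted_power_le])
      (auto simp: nn_integral_lborel_reflect)
  also have "\<dots> = ennpowr ?K (q - 1) * (\<integral>\<^sup>+x. (\<integral>\<^sup>+y. k (x - y) * ennpowr (h y) q \<partial>lborel) \<partial>lborel)"
    by (intro nn_integral_cmult) auto
  also have "(\<integral>\<^sup>+x. (\<integral>\<^sup>+y. k (x - y) * ennpowr (h y) q \<partial>lborel) \<partial>lborel) =
      (\<integral>\<^sup>+y. (\<integral>\<^sup>+x. k (x - y) * ennpowr (h y) q \<partial>lborel) \<partial>lborel)"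
    by (rule lborel_pair.Fubini') auto
  also have "\<dots> = (\<integral>\<^sup>+y. ?K * ennpowr (h y) q \<partial>lborel)"
  proof (intro nn_integral_cong)
    fix y :: 'a
    have "(\<integral>\<^sup>+x. k (x - y) \<partial>lborel) = ?K"
      using nn_integral_lborel_shift[of k "-y"] by simp
    then show "(\<integral>\<^sup>+x. k (x - y) * ennpowr (h y) q \<partial>lborel) = ?K * ennpowr (h y) q"
      by (simp add: nn_integral_multc)
  qed
  also have "\<dots> = ?K * ennpowr (Lnorm lborel q h) q"
    using q by (simp add: nn_integral_cmult ennpowr_Lnorm)
  also have "ennpowr ?K (q - 1) * (?K * ennpowr (Lnorm lborel q h) q) = ennpowr (?K * Lnorm lborel q h) q"
    using ennpowr_add[of ?K "q - 1" 1] by (simp add: ennpowr_mult mult.assoc)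
  finally show "(\<integral>\<^sup>+x. ennpowr (\<integral>\<^sup>+y. k (x - y) * h y \<partial>lborel) q \<partial>lborel) \<le> ennpowr (?K * Lnorm lborel q h) q" .
qed (use q in auto)

text \<open>Instead of passing through f g in L^(q/2), Hoelder in y separates f, and the p-th power
  of what remains, p conjugate to q, is the convolution of k^p and g^p. Young with exponent q / p
  finishes, and q / p >= 1 is where q >= 2 enters.\<close>

lemma Lnorm_convolution_mult_le:
  fixes k f g :: "'a::euclidean_space \<Rightarrow> ennreal"
  assumes q: "q \<ge> 2"
    and [measurable]: "k \<in> borel_measurable borel" "f \<in> borel_measurable borel" "g \<in> borel_measurable borel"
  shows "Lnorm lborel q (\<lambda>x. \<integral>\<^sup>+y. k (x - y) * f y * g y \<partial>lborel) \<le>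
           Lnorm lborel (q / (q - 1)) k * Lnorm lborel q f * Lnorm lborel q g"
proof -
  define p where "p = q / (q - 1)"
  have p: "1 < p" "p \<le> q" "1 / p + 1 / q = 1" "1 / q + 1 / p = 1"
  proof -
    show "1 < p" using q by (simp add: p_def field_simps)
    have "q * 1 \<le> q * (q - 1)" using q by (intro mult_left_mono) auto
    then show "p \<le> q" using q by (simp add: p_def field_simps)
    show "1 / p + 1 / q = 1" using q by (simp add: p_def field_simps)
    then show "1 / q + 1 / p = 1" by simp
  qed
  let ?h = "\<lambda>x. \<integral>\<^sup>+y. ennpowr (k (x - y)) p * ennpowr (g y) p \<partial>lborel"
  have "(\<integral>\<^sup>+y. k (x - y) * f y * g y \<partial>lborel) \<le> Lnorm lborel q f * ennpowr (?h x) (1 / p)" for x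
  proof -
    have "(\<integral>\<^sup>+y. k (x - y) * f y * g y \<partial>lborel) = (\<integral>\<^sup>+y. f y * (k (x - y) * g y) \<partial>lborel)"
      by (simp add: ac_simps)
    also have "\<dots> \<le> Lnorm lborel q f * Lnorm lborel p (\<lambda>y. k (x - y) * g y)"
      using p q by (intro nn_integral_Hoelder) auto
    finally show ?thesis by (simp add: Lnorm_def ennpowr_mult)
  qed
  then have "Lnorm lborel q (\<lambda>x. \<integral>\<^sup>+y. k (x - y) * f y * g y \<partial>lborel) \<le>
      Lnorm lborel q (\<lambda>x. Lnorm lborel q f * ennpowr (?h x) (1 / p))"
    using q by (intro Lnorm_mono) auto
  also have "\<dots> = Lnorm lborel q f * Lnorm lborel q (\<lambda>x. ennpowr (?h x) (1 / p))"
    using q by (intro Lnorm_cmult) auto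
  also have "Lnorm lborel q (\<lambda>x. ennpowr (?h x) (1 / p)) = ennpowr (Lnorm lborel (q / p) ?h) (1 / p)"
    using p q by (simp add: Lnorm_def)
  also have "\<dots> \<le> ennpowr ((\<integral>\<^sup>+y. ennpowr (k y) p \<partial>lborel) * Lnorm lborel (q / p) (\<lambda>y. ennpowr (g y) p)) (1 / p)"
    using p by (intro ennpowr_mono Lnorm_convolution_le) auto
  also have "\<dots> = Lnorm lborel p k * Lnorm lborel q g"
    using p q by (simp add: Lnorm_def ennpowr_mult)
  finally have "Lnorm lborel q (\<lambda>x. \<integral>\<^sup>+y. k (x - y) * f y * g y \<partial>lborel) \<le>
      Lnorm lborel q f * (Lnorm lborel p k * Lnorm lborel q g)"
    by (simp add: mult_left_mono)
  then show ?thesis by (simp only: p_def ac_simps)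
qed

section \<open>Gaussian integrals and a power-decay majorant\<close>

lemma nn_integral_power_decay_finite:
  assumes s: "s > 1/2"
  shows "(\<integral>\<^sup>+x. ennreal ((1 + (x::real)\<^sup>2) powr (- s)) \<partial>lborel) < top"
proof -
  let ?f = "\<lambda>x::real. indicator {1..} x * ennreal (x powr (- 2 * s))"
  have "((\<lambda>x::real. x powr (-2 * s)) has_integral (- (1 powr (-2 * s + 1)) / (-2 * s + 1))) {1..}"
    using s by (intro has_integral_powr_to_inf) auto
  then have "((\<lambda>x::real. indicator {1..} x * x powr (-2 * s)) has_integral (- (1 powr (-2 * s + 1)) / (-2 * s + 1))) UNIV"
    by (subst (asm) has_integral_restrict_UNIV[symmetric])
      (rule has_integral_cong[THEN iffD1, rotated], assumption, auto)
  from nn_integral_has_integral_lborel[OF _ _ this]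
  have f: "(\<integral>\<^sup>+x. ?f x \<partial>lborel) = ennreal (- (1 powr (-2 * s + 1)) / (-2 * s + 1))"
    by (simp add: ennreal_mult' ennreal_indicator)
  have f': "(\<integral>\<^sup>+x. ?f (- x) \<partial>lborel) = (\<integral>\<^sup>+x. ?f x \<partial>lborel)"
    using nn_integral_lborel_reflect[of ?f 0] by simp
  have le: "ennreal ((1 + x\<^sup>2) powr (- s)) \<le> indicator {-1..1} x + (?f x + ?f (- x))" for x :: real
  proof -
    consider "x \<in> {-1..1}" | "x > 1" | "x < -1" by fastforce
    then show ?thesis
    proof cases
      case 1
      have "(1 + x\<^sup>2) powr (- s) \<le> 1 powr (- s)"
        using s by (intro powr_mono2') auto
      then have "ennreal ((1 + x\<^sup>2) powr (- s)) \<le> ennreal 1" by (intro ennreal_leI) auto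
      then show ?thesis using 1 by (simp add: add_increasing2)
    next
      case 2
      have "(1 + x\<^sup>2) powr (- s) \<le> (x\<^sup>2) powr (- s)"
        using s 2 by (intro powr_mono2') auto
      also have "(x\<^sup>2) powr (- s) = x powr (- 2 * s)"
        using 2 powr_powr[of x 2 "-s"] by (simp)
      finally show ?thesis using 2 by (auto simp: ennreal_leI)
    next
      case 3
      have "(1 + x\<^sup>2) powr (- s) \<le> ((-x)\<^sup>2) powr (- s)"
        using s 3 by (intro powr_mono2') auto
      also have "((-x)\<^sup>2) powr (- s) = (-x) powr (- 2 * s)"
        using 3 powr_powr[of "-x" 2 "-s"] by (simp)
      finally show ?thesis using 3 by (auto simp: ennreal_leI)
    qed
  qed
  have "(\<integral>\<^sup>+x. ennreal ((1 + (x::real)\<^sup>2) powr (- s)) \<partial>lborel)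
      \<le> (\<integral>\<^sup>+x. indicator {-1..1} x + (?f x + ?f (- x)) \<partial>lborel)"
    by (intro nn_integral_mono le)
  also have "\<dots> = (\<integral>\<^sup>+x. indicator {-1..1::real} x \<partial>lborel) + ((\<integral>\<^sup>+x. ?f x \<partial>lborel) + (\<integral>\<^sup>+x. ?f (- x) \<partial>lborel))"
    by (simp add: nn_integral_add del: nn_integral_indicator)
  also have "\<dots> = 2 + ((\<integral>\<^sup>+x. ?f x \<partial>lborel) + (\<integral>\<^sup>+x. ?f x \<partial>lborel))"
    unfolding f' by simp
  also have "\<dots> < top" unfolding f by (simp add: ennreal_add_less_top)
  finally show ?thesis .
qed

lemma nn_integral_power_decay_scale:
  assumes "\<tau> > 0"
  shows "(\<integral>\<^sup>+x. ennreal ((\<tau> + x\<^sup>2) powr (- s)) \<partial>lborel) =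
           ennreal (\<tau> powr (1/2 - s)) * (\<integral>\<^sup>+x. ennreal ((1 + (x::real)\<^sup>2) powr (- s)) \<partial>lborel)"
proof -
  have "(\<integral>\<^sup>+x. ennreal ((\<tau> + x\<^sup>2) powr (- s)) \<partial>lborel) =
      ennreal (sqrt \<tau>) * (\<integral>\<^sup>+x. ennreal ((\<tau> + (sqrt \<tau> * x)\<^sup>2) powr (- s)) \<partial>lborel)"
    using assms by (subst nn_integral_real_affine[where c="sqrt \<tau>" and t=0]) auto
  also have "(\<lambda>x. ennreal ((\<tau> + (sqrt \<tau> * x)\<^sup>2) powr (- s))) = (\<lambda>x. ennreal (\<tau> powr (- s)) * ennreal ((1 + x\<^sup>2) powr (- s)))"
  proof
    fix x
    have "\<tau> + (sqrt \<tau> * x)\<^sup>2 = \<tau> * (1 + x\<^sup>2)"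
      using assms by (simp add: power_mult_distrib algebra_simps)
    then show "ennreal ((\<tau> + (sqrt \<tau> * x)\<^sup>2) powr (- s)) = ennreal (\<tau> powr (- s)) * ennreal ((1 + x\<^sup>2) powr (- s))"
      using assms by (simp add: powr_mult ennreal_mult)
  qed
  also have "ennreal (sqrt \<tau>) * (\<integral>\<^sup>+x. ennreal (\<tau> powr (- s)) * ennreal ((1 + (x::real)\<^sup>2) powr (- s)) \<partial>lborel) =
      ennreal (sqrt \<tau> * \<tau> powr (- s)) * (\<integral>\<^sup>+x. ennreal ((1 + (x::real)\<^sup>2) powr (- s)) \<partial>lborel)"
    using assms by (simp add: nn_integral_cmult ennreal_mult mult.assoc)
  also have "sqrt \<tau> * \<tau> powr (- s) = \<tau> powr (1/2 - s)"
    using assms by (simp add: powr_half_sqrt[symmetric] powr_add[symmetric])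
  finally show ?thesis .
qed

definition decay_kernel :: "real \<Rightarrow> real^3 \<Rightarrow> real" where
  "decay_kernel \<tau> z = 1 / (\<tau> + (norm z)\<^sup>2)\<^sup>2"

lemma decay_kernel_nonneg [simp]: "0 \<le> decay_kernel \<tau> z"
  by (simp add: decay_kernel_def)

lemma measurable_decay_kernel [measurable (raw)]:
  assumes [measurable]: "f \<in> borel_measurable M" "g \<in> borel_measurable M"
  shows "(\<lambda>x. decay_kernel (f x) (g x)) \<in> borel_measurable M"
  unfolding decay_kernel_def by measurable

lemma norm_sq_Basis: "(norm (z::'a::euclidean_space))\<^sup>2 = (\<Sum>b\<in>Basis. (z \<bullet> b)\<^sup>2)"
  unfolding power2_norm_eq_inner
  by (subst euclidean_inner) (simp add: power2_eq_square)

text \<open>Since |z|^2 dominates each squared coordinate, one third of the power can be given to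
  each of the three coordinates; the integral then factors into one-dimensional ones. They converge
  because 2 r / 3 > 1/2, and scaling gives the power of \<tau>.\<close>

lemma Lnorm_decay_kernel:
  assumes r: "r \<ge> 1"
  shows "\<exists>C>0. \<forall>\<tau>>0. Lnorm lborel r (\<lambda>z. ennreal (decay_kernel \<tau> z)) \<le> ennreal (C * \<tau> powr (3 / (2 * r) - 2))"
proof -
  let ?c = "\<integral>\<^sup>+x. ennreal ((1 + x\<^sup>2) powr (- (2 * r / 3))) \<partial>lborel"
  have "?c < top" using r by (intro nn_integral_power_decay_finite) auto
  then obtain c where c: "?c = ennreal c" "0 \<le> c" by (cases ?c) auto
  let ?C = "(c ^ 3) powr (1 / r)"
  have "Lnorm lborel r (\<lambda>z. ennreal (decay_kernel \<tau> z)) \<le> ennreal ((?C + 1) * \<tau> powr (3 / (2 * r) - 2))"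
    if \<tau>: "\<tau> > 0" for \<tau>
  proof -
    have card: "card (Basis :: (real^3) set) = 3" by simp
    have "(\<integral>\<^sup>+z. ennpowr (ennreal (decay_kernel \<tau> z)) r \<partial>lborel) \<le>
        (\<integral>\<^sup>+z. (\<Prod>b\<in>Basis. ennreal ((\<tau> + ((z::real^3) \<bullet> b)\<^sup>2) powr (- (2 * r / 3)))) \<partial>lborel)"
    proof (intro nn_integral_mono)
      fix z :: "real^3"
      have "decay_kernel \<tau> z powr r = (\<tau> + (norm z)\<^sup>2) powr (- 2 * r)"
      proof -
        have "0 < \<tau> + (norm z)\<^sup>2" using \<tau> by (simp add: add_pos_nonneg)
        then have "decay_kernel \<tau> z = (\<tau> + (norm z)\<^sup>2) powr (- 2)"
          by (simp add: decay_kernel_def powr_minus_divide)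
        then show ?thesis using \<tau> by (simp add: powr_powr)
      qed
      also have "\<dots> = (\<Prod>b\<in>(Basis::(real^3) set). (\<tau> + (norm z)\<^sup>2) powr (- (2 * r / 3)))"
        using \<tau> by (simp add: card powr_power add_pos_nonneg add_nonneg_eq_0_iff)
      also have "\<dots> \<le> (\<Prod>b\<in>(Basis::(real^3) set). (\<tau> + (z \<bullet> b)\<^sup>2) powr (- (2 * r / 3)))"
      proof (intro prod_mono conjI powr_mono2')
        fix b :: "real^3" assume "b \<in> Basis"
        then show "\<tau> + (z \<bullet> b)\<^sup>2 \<le> \<tau> + (norm z)\<^sup>2"
          unfolding norm_sq_Basis by (auto intro: member_le_sum)
      qed (use \<tau> r in \<open>auto simp: add_pos_nonneg\<close>)
      finally show "ennpowr (ennreal (decay_kernel \<tau> z)) r \<le>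
          (\<Prod>b\<in>(Basis::(real^3) set). ennreal ((\<tau> + (z \<bullet> b)\<^sup>2) powr (- (2 * r / 3))))"
        by (simp add: prod_ennreal ennreal_leI)
    qed
    also have "\<dots> = (\<Prod>b\<in>(Basis::(real^3) set). (\<integral>\<^sup>+x. ennreal ((\<tau> + x\<^sup>2) powr (- (2 * r / 3))) \<partial>lborel))"
      by (intro nn_integral_lborel_prod) auto
    also have "\<dots> = (ennreal (\<tau> powr (1/2 - 2 * r / 3)) * ?c) ^ 3"
      unfolding nn_integral_power_decay_scale[OF \<tau>] by (simp only: prod_constant card)
    also have "\<dots> = ennreal ((\<tau> powr (1/2 - 2 * r / 3) * c) ^ 3)"
      using c by (simp add: ennreal_power flip: ennreal_mult)
    finally have "Lnorm lborel r (\<lambda>z. ennreal (decay_kernel \<tau> z)) \<le>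
        ennpowr (ennreal ((\<tau> powr (1/2 - 2 * r / 3) * c) ^ 3)) (1 / r)"
      unfolding Lnorm_def using r by (intro ennpowr_mono) auto
    also have "\<dots> = ennreal (\<tau> powr (3 / (2 * r) - 2) * ?C)"
    proof -
      have "(\<tau> powr (1/2 - 2 * r / 3)) ^ 3 = \<tau> powr (3 / 2 - 2 * r)"
        using \<tau> by (simp add: powr_power algebra_simps)
      moreover have "(3 / 2 - 2 * r) * (1 / r) = 3 / (2 * r) - 2"
        using r by (simp add: field_simps)
      ultimately show ?thesis
        using c \<tau> by (simp only: power_mult_distrib powr_mult powr_powr ennpowr_ennreal zero_le_power
          mult_nonneg_nonneg powr_ge_zero)
    qed
    \<comment> \<open>Adding 1 provides a strictly positive constant without showing that
      \<open>?C\<close> is nonzero.\<close>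
    also have "\<dots> \<le> ennreal ((?C + 1) * \<tau> powr (3 / (2 * r) - 2))"
      by (intro ennreal_leI) (simp add: algebra_simps)
    finally show ?thesis .
  qed
  moreover have "?C + 1 > 0" by (simp add: add_nonneg_pos)
  ultimately show ?thesis by blast
qed

section \<open>Gaussian integrals and the mass of the heat kernel\<close>

lemma nn_integral_exp_square:
  assumes P: "P > 0"
  shows "(\<integral>\<^sup>+x. ennreal (exp (- P * x\<^sup>2 / 4)) \<partial>lborel) = ennreal (sqrt (4 * pi / P))"
proof -
  have e: "exp (- P * x\<^sup>2 / 4) = sqrt (4 * pi / P) * normal_density 0 (sqrt (2 / P)) x" for x
    using P by (simp add: normal_density_def field_simps)
  have "(\<integral>\<^sup>+x. ennreal (normal_density 0 (sqrt (2 / P)) x) \<partial>lborel) = ennreal 1"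
    using P integrable_normal_density[of "sqrt (2/P)" 0] integral_normal_density[of "sqrt (2/P)" 0]
    by (subst nn_integral_eq_integral) auto
  then show ?thesis
    using P unfolding e by (simp add: ennreal_mult' nn_integral_cmult)
qed

lemma nn_integral_gaussian:
  assumes P: "P > 0"
  shows "(\<integral>\<^sup>+v. ennreal (exp (- P * (norm (v::real^3))\<^sup>2 / 4)) \<partial>lborel) = ennreal ((4 * pi / P) powr (3/2))"
proof -
  have card: "card (Basis :: (real^3) set) = 3" by simp
  have "ennreal (exp (- P * (norm v)\<^sup>2 / 4)) = (\<Prod>b\<in>Basis. ennreal (exp (- P * (v \<bullet> b)\<^sup>2 / 4)))" for v :: "real^3"
    by (simp add: prod_ennreal norm_sq_Basis sum_distrib_left sum_divide_distrib flip: exp_sum sum_negf)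
  then have "(\<integral>\<^sup>+v. ennreal (exp (- P * (norm (v::real^3))\<^sup>2 / 4)) \<partial>lborel) =
     (\<Prod>b\<in>(Basis::(real^3) set). (\<integral>\<^sup>+x. ennreal (exp (- P * x\<^sup>2 / 4)) \<partial>lborel))"
    by (simp only:) (intro nn_integral_lborel_prod; auto)
  also have "\<dots> = ennreal (sqrt (4 * pi / P)) ^ 3"
    unfolding nn_integral_exp_square[OF P] by (simp only: prod_constant card)
  also have "\<dots> = ennreal ((4 * pi / P) powr (3/2))"
    using P by (simp add: ennreal_power powr_half_sqrt[symmetric] powr_power del: powr_half_sqrt)
  finally show ?thesis .
qed

lemma heat_kernel_nonneg [simp]: "0 \<le> heat_kernel t x"
  by (simp add: heat_kernel_def)

lemma measurable_heat_kernel [measurable (raw)]: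
  assumes [measurable]: "f \<in> borel_measurable M" "g \<in> borel_measurable M"
  shows "(\<lambda>x. heat_kernel (f x) (g x)) \<in> borel_measurable M"
  unfolding heat_kernel_def by measurable

lemma nn_integral_heat_kernel:
  assumes t: "t > 0"
  shows "(\<integral>\<^sup>+x. ennreal (heat_kernel t x) \<partial>lborel) = 1"
proof -
  have "heat_kernel t x = 1 / (4 * pi * t) powr (3/2) * exp (- (1/t) * (norm x)\<^sup>2 / 4)" for x
    by (simp add: heat_kernel_def)
  then have "(\<integral>\<^sup>+x. ennreal (heat_kernel t x) \<partial>lborel) =
      ennreal (1 / (4 * pi * t) powr (3/2)) * (\<integral>\<^sup>+x. ennreal (exp (- (1/t) * (norm (x::real^3))\<^sup>2 / 4)) \<partial>lborel)"
    by (simp only: ennreal_mult' powr_ge_zero divide_nonneg_nonneg zero_le_one) (intro nn_integral_cmult; measurable)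
  then show ?thesis
    using t nn_integral_gaussian[of "1/t"] by (simp flip: ennreal_mult)
qed

text \<open>Division by zero makes \<open>heat_kernel 0\<close> the zero function, so the mass drops
  from 1 to 0 at t = 0. The inequality covers this value, which occurs at the endpoint s = t of the
  Duhamel integral.\<close>

lemma nn_integral_heat_kernel_le: "(\<integral>\<^sup>+x. ennreal (heat_kernel t x) \<partial>lborel) \<le> 1" if "t \<ge> 0"
proof (cases "t = 0")
  case True
  then show ?thesis by (simp add: heat_kernel_def)
qed (use that in \<open>auto simp: nn_integral_heat_kernel\<close>)

lemma nn_integral_half_gaussian:
  assumes r: "r > 0"
  shows "(\<integral>\<^sup>+\<rho>\<in>{0<..}. ennreal (exp (- r\<^sup>2 * \<rho>\<^sup>2 / 4)) \<partial>lborel) = ennreal (sqrt pi / r)"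
proof -
  let ?f = "\<lambda>x::real. ennreal (exp (- r\<^sup>2 * x\<^sup>2 / 4)) * indicator {0<..} x"
  have m: "?f (- x) + ?f x = ennreal (exp (- r\<^sup>2 * x\<^sup>2 / 4))" if "x \<noteq> 0" for x
    using that by (auto split: split_indicator)
  have "(\<integral>\<^sup>+x. ennreal (exp (- r\<^sup>2 * x\<^sup>2 / 4)) \<partial>lborel) = (\<integral>\<^sup>+x. ?f (- x) + ?f x \<partial>lborel)"
    using m by (intro nn_integral_cong_AE eventually_mono[OF AE_lborel_singleton[of 0]]) auto
  also have "\<dots> = 2 * (\<integral>\<^sup>+x. ?f x \<partial>lborel)"
    using nn_integral_lborel_reflect[of ?f 0] by (simp add: nn_integral_add mult_2)
  finally have "2 * (\<integral>\<^sup>+x. ?f x \<partial>lborel) = ennreal (sqrt (4 * pi / r\<^sup>2))"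
    using nn_integral_exp_square[of "r\<^sup>2"] r by simp
  also have "\<dots> = 2 * ennreal (sqrt pi / r)"
    using r by (simp add: real_sqrt_divide real_sqrt_mult flip: ennreal_numeral ennreal_mult)
  finally show ?thesis by (simp add: ennreal_mult_cancel_left)
qed

section \<open>The kernel of the projected heat semigroup\<close>

text \<open>An incomplete gamma function up to a power of v; for n = 0 it is the error function in
  disguise. The integral form stays smooth through v = 0, where the closed forms have removable
  singularities.\<close>

definition gauss_mom :: "nat \<Rightarrow> real \<Rightarrow> real" where
  "gauss_mom n v = integral {0..1} (\<lambda>s. s ^ n * exp (- s\<^sup>2 * v / 4))"

lemma gauss_mom_integrable: "(\<lambda>s::real. s ^ n * exp (- s\<^sup>2 * v / 4)) integrable_on {0..1}"
  by (intro integrable_continuous_real continuous_intros) auto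

lemma DERIV_gauss_mom: "(gauss_mom n has_real_derivative - gauss_mom (n + 2) v / 4) (at v)"
proof -
  have "((\<lambda>v. integral (cbox 0 1) (\<lambda>s::real. s ^ n * exp (- s\<^sup>2 * v / 4))) has_real_derivative
      integral (cbox 0 1) (\<lambda>s. - 1/4 * (s ^ (n + 2) * exp (- s\<^sup>2 * v / 4)))) (at v within UNIV)"
  proof (rule leibniz_rule_field_derivative)
    show "((\<lambda>v. s ^ n * exp (- s\<^sup>2 * v / 4)) has_real_derivative - 1/4 * (s ^ (n + 2) * exp (- s\<^sup>2 * v / 4)))
        (at v within UNIV)" for v s :: real
      by (auto intro!: derivative_eq_intros simp: power_add power2_eq_square)
    show "continuous_on (UNIV \<times> cbox 0 1) (\<lambda>(x, t::real). - 1/4 * (t ^ (n + 2) * exp (- t\<^sup>2 * x / 4)))"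
      by (auto simp: split_beta intro!: continuous_intros)
  qed (use gauss_mom_integrable in auto)
  then show ?thesis
    by (simp add: gauss_mom_def[abs_def] integral_mult_right del: power_add)
qed

text \<open>Integrate the derivative of s^(n+1) exp (- s^2 v / 4) over [0, 1]; the term at s = 0
  vanishes. This single identity supplies the decay of the moments, the vanishing divergence of the
  kernel and the antiderivative for the Newton potential.\<close>

lemma gauss_mom_recurrence:
  "v / 2 * gauss_mom (n + 2) v = (n + 1) * gauss_mom n v - exp (- v / 4)"
proof -
  let ?f = "\<lambda>s::real. s ^ n * exp (- s\<^sup>2 * v / 4)"
  let ?f2 = "\<lambda>s::real. s ^ (n + 2) * exp (- s\<^sup>2 * v / 4)"
  have "((\<lambda>s. (n + 1) * ?f s - v / 2 * ?f2 s) has_integral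
      (1 ^ (n + 1) * exp (- 1\<^sup>2 * v / 4) - 0 ^ (n + 1) * exp (- 0\<^sup>2 * v / 4))) {0..1}"
    by (intro fundamental_theorem_of_calculus)
      (auto intro!: derivative_eq_intros simp flip: has_real_derivative_iff_has_vector_derivative
        simp: algebra_simps power2_eq_square simp del: power_Suc, simp add: algebra_simps power2_eq_square)
  moreover have "((\<lambda>s. (n + 1) * ?f s - v / 2 * ?f2 s) has_integral
      (n + 1) * gauss_mom n v - v / 2 * gauss_mom (n + 2) v) {0..1}"
    unfolding gauss_mom_def
    by (intro has_integral_diff has_integral_mult_right integrable_integral gauss_mom_integrable)
  ultimately have "(1 ^ (n + 1) * exp (- 1\<^sup>2 * v / 4) - 0 ^ (n + 1) * exp (- 0\<^sup>2 * v / 4)) =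
      (n + 1) * gauss_mom n v - v / 2 * gauss_mom (n + 2) v"
    by (rule has_integral_unique)
  then show ?thesis by simp
qed

lemma gauss_mom_nonneg: "0 \<le> gauss_mom n v"
  unfolding gauss_mom_def by (intro integral_nonneg gauss_mom_integrable) auto

lemma gauss_mom_0_decay:
  assumes "v > 0"
  shows "sqrt v * gauss_mom 0 v \<le> sqrt pi"
proof -
  let ?f = "\<lambda>s::real. exp (- s\<^sup>2 * v / 4)"
  have i: "set_integrable lborel {0..1} ?f"
    by (intro borel_integrable_atLeastAtMost' continuous_intros) auto
  then have "gauss_mom 0 v = (LINT s:{0..1}|lborel. ?f s)"
    using set_borel_integral_eq_integral(2)[OF i] by (simp add: gauss_mom_def)
  then have "ennreal (gauss_mom 0 v) = (\<integral>\<^sup>+s. ennreal (indicator {0..1} s * ?f s) \<partial>lborel)"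
    using i unfolding set_lebesgue_integral_def set_integrable_def
    by (subst nn_integral_eq_integral) auto
  also have "\<dots> \<le> (\<integral>\<^sup>+s\<in>{0<..}. ennreal (exp (- (sqrt v)\<^sup>2 * s\<^sup>2 / 4)) \<partial>lborel)"
    using assms
    by (intro nn_integral_mono_AE eventually_mono[OF AE_lborel_singleton[of 0]])
       (auto split: split_indicator simp: mult.commute)
  also have "\<dots> = ennreal (sqrt pi / sqrt v)"
    using assms by (intro nn_integral_half_gaussian) auto
  finally have "gauss_mom 0 v \<le> sqrt pi / sqrt v"
    using assms by (simp add: gauss_mom_nonneg)
  then show ?thesis using assms by (simp add: field_simps)
qed

text \<open>Dropping the exponential in the recurrence gives v m_{n+2} <= 2 (n + 1) m_n, where m_n
  is \<open>gauss_mom n v\<close>. Two such steps from m_0 <= 2 / sqrt v give m_4 of order v^(-5/2),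
  and m_4 <= 1 covers small v. One more step bounds m_6, and m_6 >= 0 in the recurrence bounds the
  exponential by 5 m_4. The numerical constants are generous.\<close>

lemma gauss_mom_bounds:
  assumes "v \<ge> 0"
  shows "sqrt v * gauss_mom 4 v * (1 + v)\<^sup>2 \<le> 1000"
    and "v * sqrt v * gauss_mom 6 v * (1 + v)\<^sup>2 \<le> 10000"
    and "sqrt v * exp (- v / 4) * (1 + v)\<^sup>2 \<le> 10000"
proof -
  have 1: "gauss_mom 4 v \<le> 1"
    using integral_le[OF gauss_mom_integrable[of 4 v] integrable_const_ivl[of 1 0 1]] assms
    by (simp add: gauss_mom_def mult_le_one power_le_one)
  have r: "v * gauss_mom 2 v \<le> 2 * gauss_mom 0 v" "v * gauss_mom 4 v \<le> 6 * gauss_mom 2 v"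
      "v * gauss_mom 6 v \<le> 10 * gauss_mom 4 v" "exp (- v / 4) \<le> 5 * gauss_mom 4 v"
    using gauss_mom_recurrence[of v 0] gauss_mom_recurrence[of v 2] gauss_mom_recurrence[of v 4]
      assms mult_nonneg_nonneg[OF assms gauss_mom_nonneg[of 6 v]]
    by (simp_all add: numeral_2_eq_2[symmetric])
  have s0: "sqrt v * gauss_mom 0 v \<le> 2"
  proof (cases "v = 0")
    case False
    have "sqrt pi \<le> sqrt 4" using pi_less_4 by (intro real_sqrt_le_mono) auto
    then show ?thesis using gauss_mom_0_decay[of v] False assms by simp
  qed auto
  have "v * (v * gauss_mom 4 v) \<le> v * (6 * gauss_mom 2 v)"
    using r assms by (intro mult_left_mono) auto
  then have "v * v * gauss_mom 4 v \<le> 12 * gauss_mom 0 v"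
    using r by (simp add: algebra_simps)
  from mult_left_mono[OF this, of "sqrt v"] s0 assms
  have s4: "sqrt v * (v * v * gauss_mom 4 v) \<le> 24" by simp
  have "sqrt v \<le> 1 + sqrt v * (v * v)"
  proof (cases "v \<le> 1")
    case True
    then show ?thesis using assms by (intro add_increasing2) auto
  next
    case False
    then have "sqrt v * 1 \<le> sqrt v * (v * v)"
      by (intro mult_left_mono) (auto intro: mult_ge1_I)
    then show ?thesis by simp
  qed
  from mult_right_mono[OF this gauss_mom_nonneg[of 4 v]] s4 1
  have s4': "sqrt v * gauss_mom 4 v \<le> 25" by (simp add: algebra_simps)
  have "(1 + v)\<^sup>2 \<le> 2 * (1 + v * v)"
    using sum_squares_ge_zero[of "v - 1" 0] by (simp add: power2_eq_square algebra_simps)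
  from mult_left_mono[OF this, of "sqrt v * gauss_mom 4 v"] s4 s4' assms
  have a: "sqrt v * gauss_mom 4 v * (1 + v)\<^sup>2 \<le> 98"
    by (simp add: algebra_simps gauss_mom_nonneg)
  then show "sqrt v * gauss_mom 4 v * (1 + v)\<^sup>2 \<le> 1000" by simp
  have nn: "0 \<le> sqrt v * (1 + v)\<^sup>2" using assms by simp
  from mult_left_mono[OF r(3) nn] a
  show "v * sqrt v * gauss_mom 6 v * (1 + v)\<^sup>2 \<le> 10000" by (simp add: algebra_simps)
  from mult_left_mono[OF r(4) nn] a
  show "sqrt v * exp (- v / 4) * (1 + v)\<^sup>2 \<le> 10000" by (simp add: algebra_simps)
qed

text \<open>This is \<open>- \<partial>\<^sub>k (\<delta>\<^sub>i\<^sub>j + \<partial>\<^sub>i \<partial>\<^sub>j (-\<Delta>)\<^sup>-\<^sup>1) g\<^sub>\<tau>\<close> for the heat kernel \<open>g\<close>, computed from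
  \<open>((-\<Delta>)\<^sup>-\<^sup>1 (a\<^sub>i g\<^sub>\<tau> / (2 \<tau>))) (a) = (8 \<pi>\<^sup>3\<^sup>/\<^sup>2 \<tau>\<^sup>3\<^sup>/\<^sup>2)\<^sup>-\<^sup>1 a\<^sub>i gauss_mom 2 (|a|\<^sup>2 / \<tau>)\<close>.\<close>

definition nse_kernel :: "3 \<Rightarrow> 3 \<Rightarrow> 3 \<Rightarrow> real \<Rightarrow> real^3 \<Rightarrow> real" where
  "nse_kernel i j k \<tau> a =
     1 / (16 * pi powr (3/2) * \<tau> powr (5/2)) *
     (let v = (a \<bullet> a) / \<tau> in
       of_bool (i = j) * a $ k * (exp (- v / 4) - gauss_mom 4 v)
       - (of_bool (i = k) * a $ j + of_bool (j = k) * a $ i) * gauss_mom 4 v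
       + a $ i * a $ j * a $ k / (2 * \<tau>) * gauss_mom 6 v)"

lemma DERIV_gauss_mom' [derivative_intros]:
  assumes "(f has_derivative f') (at x within s)"
  shows "((\<lambda>x. gauss_mom n (f x)) has_derivative (\<lambda>h. f' h * (- gauss_mom (n + 2) (f x) / 4))) (at x within s)"
proof -
  have "(gauss_mom n has_derivative (\<lambda>h. h * (- gauss_mom (n + 2) (f x) / 4))) (at (f x))"
    using DERIV_gauss_mom[of n "f x"] unfolding has_field_derivative_def
    by (rule has_derivative_eq_rhs) (simp add: fun_eq_iff)
  from has_derivative_compose[OF assms this] show ?thesis .
qed

definition nse_kernel_deriv :: "3 \<Rightarrow> 3 \<Rightarrow> 3 \<Rightarrow> real \<Rightarrow> real^3 \<Rightarrow> real^3 \<Rightarrow> real" where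
  "nse_kernel_deriv i j k \<tau> a h =
     1 / (16 * pi powr (3/2) * \<tau> powr (5/2)) *
     (let v = (a \<bullet> a) / \<tau> in
       of_bool (i = j) * (h $ k * (exp (- v / 4) - gauss_mom 4 v)
          + a $ k * (a \<bullet> h) / (2 * \<tau>) * (gauss_mom 6 v - exp (- v / 4)))
       - (of_bool (i = k) * h $ j + of_bool (j = k) * h $ i) * gauss_mom 4 v
       + (of_bool (i = k) * a $ j + of_bool (j = k) * a $ i) * (a \<bullet> h) / (2 * \<tau>) * gauss_mom 6 v
       + (h $ i * a $ j * a $ k + a $ i * h $ j * a $ k + a $ i * a $ j * h $ k) / (2 * \<tau>) * gauss_mom 6 v
       - a $ i * a $ j * a $ k * (a \<bullet> h) / (4 * \<tau>\<^sup>2) * gauss_mom 8 v)"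

lemma has_derivative_gauss_mom_radial:
  fixes a :: "real^3"
  assumes "\<tau> > 0"
  shows "((\<lambda>a. gauss_mom n (a \<bullet> a / \<tau>)) has_derivative
    (\<lambda>h. - ((a \<bullet> h) / (2 * \<tau>)) * gauss_mom (n + 2) (a \<bullet> a / \<tau>))) (at a)"
proof -
  have gv: "((\<lambda>a. a \<bullet> a / \<tau>) has_derivative (\<lambda>h. 2 * (a \<bullet> h) / \<tau>)) (at a)"
    using assms by (auto intro!: derivative_eq_intros ext simp: inner_commute)
  show ?thesis
    by (rule has_derivative_eq_rhs[OF DERIV_gauss_mom'[OF gv]]) auto
qed

lemma has_derivative_exp_radial:
  fixes a :: "real^3"
  assumes "\<tau> > 0"
  shows "((\<lambda>a. exp (- (a \<bullet> a / \<tau>) / 4)) has_derivative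
    (\<lambda>h. - ((a \<bullet> h) / (2 * \<tau>)) * exp (- (a \<bullet> a / \<tau>) / 4))) (at a)"
proof -
  have gv: "((\<lambda>a. a \<bullet> a / \<tau>) has_derivative (\<lambda>h. 2 * (a \<bullet> h) / \<tau>)) (at a)"
    using assms by (auto intro!: derivative_eq_intros ext simp: inner_commute)
  show ?thesis
    using has_derivative_exp[OF has_derivative_mult_right[OF gv, of "- 1 / 4"]]
    by (simp add: mult.commute[of "exp _"] mult.commute[of \<tau>])
qed

lemma nse_kernel_has_derivative:
  assumes "\<tau> > 0"
  shows "(nse_kernel i j k \<tau> has_derivative nse_kernel_deriv i j k \<tau> a) (at a)"
proof -
  define c where "c = 1 / (16 * pi powr (3/2) * \<tau> powr (5/2))"
  note gm = has_derivative_gauss_mom_radial[OF assms, of _ a] and ge = has_derivative_exp_radial[OF assms, of a]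
  have gk: "((\<lambda>a. a $ k) has_derivative (\<lambda>h. h $ k)) (at a)" for k :: 3
    by (rule bounded_linear_imp_has_derivative) auto
  \<comment> \<open>With these values abbreviated, comparing the derivative found by the product
    rule with the claimed one is an identity between polynomials in them, the coordinates and 1 /
    \<tau>.\<close>
  define E where "E = exp (- (a \<bullet> a / \<tau>) / 4)"
  define g4 where "g4 = gauss_mom 4 (a \<bullet> a / \<tau>)"
  define g6 where "g6 = gauss_mom 6 (a \<bullet> a / \<tau>)"
  define g8 where "g8 = gauss_mom 8 (a \<bullet> a / \<tau>)"
  have 46: "4 + 2 = (6::nat)" "6 + 2 = (8::nat)" by auto
  show ?thesis
    unfolding nse_kernel_def nse_kernel_deriv_def Let_def c_def[symmetric] times_divide_eq_right[symmetric] divide_inverse[of _ "2 * \<tau>"]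
    apply (rule has_derivative_eq_rhs)
     apply (rule gm ge gk has_derivative_const has_derivative_add has_derivative_diff has_derivative_mult)+
    apply (rule ext)
    apply (simp only: 46 mult_zero_left add_0 add_0_right E_def[symmetric] g4_def[symmetric] g6_def[symmetric] g8_def[symmetric])
    apply (simp only: divide_inverse inverse_mult_distrib power2_eq_square)
    apply (simp add: algebra_simps add_divide_distrib diff_divide_distrib)
    done
qed

text \<open>The kernel analogue of div P = 0, where i is the index of the output component. The
  trace splits into a multiple of \<delta>_jk and one of a_j a_k, and their coefficients vanish by
  the recurrences for n = 4 and n = 6.\<close>

lemma nse_kernel_div_free:
  assumes "\<tau> > 0"
  shows "(\<Sum>i\<in>UNIV. nse_kernel_deriv i j k \<tau> a (axis i 1)) = 0"
proof -
  define v where "v = (a \<bullet> a) / \<tau>"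
  define e where "e = exp (- v / 4)"
  have r4: "v / 2 * gauss_mom 6 v = 5 * gauss_mom 4 v - e"
    using gauss_mom_recurrence[of v 4] by (simp add: e_def)
  have r6: "v / 2 * gauss_mom 8 v = 7 * gauss_mom 6 v - e"
    using gauss_mom_recurrence[of v 6] by (simp add: e_def)
  have v3: "v = (a $ 1 * a $ 1 + a $ 2 * a $ 2 + a $ 3 * a $ 3) * inverse \<tau>"
    by (simp add: v_def inner_vec_def sum_3 divide_inverse)
  have ai: "a \<bullet> axis i 1 = a $ i" for i by (simp add: inner_axis)
  have ax: "axis i (1::real) $ j = of_bool (i = j)" for i j :: 3 by (simp add: axis_def)
  \<comment> \<open>Stated for arbitrary g4, g6, g8, so that only |a|^2 = v \<tau> is used; the
    recurrences enter afterwards.\<close>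
  have *: "(\<Sum>i\<in>UNIV.
       of_bool (i = j) * (axis i 1 $ k * (e - g4)
          + a $ k * (a \<bullet> axis i 1) / (2 * \<tau>) * (g6 - e))
       - (of_bool (i = k) * axis i 1 $ j + of_bool (j = k) * axis i 1 $ i) * g4
       + (of_bool (i = k) * a $ j + of_bool (j = k) * a $ i) * (a \<bullet> axis i 1) / (2 * \<tau>) * g6
       + (axis i 1 $ i * a $ j * a $ k + a $ i * axis i 1 $ j * a $ k + a $ i * a $ j * axis i 1 $ k) / (2 * \<tau>) * g6
       - a $ i * a $ j * a $ k * (a \<bullet> axis i 1) / (4 * \<tau>\<^sup>2) * g8) =
     of_bool (j = k) * (e - 5 * g4 + v / 2 * g6) + a $ j * a $ k / (2 * \<tau>) * (7 * g6 - e - v / 2 * g8)"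
    for g4 g6 g8
    unfolding ai ax v3 sum_3 divide_inverse inverse_mult_distrib power2_eq_square
    using exhaust_3[of j] exhaust_3[of k]
    by (elim disjE; simp; simp add: algebra_simps add_divide_distrib diff_divide_distrib)
  show ?thesis
    unfolding nse_kernel_deriv_def Let_def v_def[symmetric] e_def[symmetric] sum_distrib_left[symmetric] *
    unfolding r4 r6 by simp
qed

text \<open>Parabolic scaling: |a| = sqrt (v \<tau>) makes the bracket sqrt \<tau> times a quantity
  that decays like (1 + v)^(-2), and \<tau>^(-5/2) sqrt \<tau> (1 + v)^(-2) = (\<tau> +
  |a|^2)^(-2).\<close>

lemma nse_kernel_bound: "\<exists>C>0. \<forall>\<tau>>0. \<forall>i j k a. \<bar>nse_kernel i j k \<tau> a\<bar> \<le> C * decay_kernel \<tau> a"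
proof (intro exI conjI allI impI)
  define c where "c = 1 / (16 * pi powr (3/2))"
  have c: "c > 0" by (simp add: c_def)
  show "c * 20000 > 0" using c by simp
  fix \<tau> :: real and i j k :: 3 and a :: "real^3" assume \<tau>: "\<tau> > 0"
  define v where "v = (a \<bullet> a) / \<tau>"
  define r where "r = norm a"
  have v: "v \<ge> 0" "a \<bullet> a = v * \<tau>" using \<tau> by (auto simp: v_def)
  have r: "r = sqrt v * sqrt \<tau>" "0 \<le> r" using v \<tau> by (auto simp: r_def norm_eq_sqrt_inner real_sqrt_mult)
  have an: "\<bar>a $ l\<bar> \<le> r" for l unfolding r_def by (rule component_le_norm_cart)
  have "\<bar>of_bool (i = j) * a $ k * (exp (- v / 4) - gauss_mom 4 v)\<bar> \<le> r * (exp (- v / 4) + gauss_mom 4 v)"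
    using an[of k] r gauss_mom_nonneg[of 4 v] exp_ge_zero[of "- v / 4"]
    by (cases "i = j") (auto simp: abs_mult abs_le_iff simp del: exp_ge_zero intro!: mult_mono add_nonneg_nonneg)
  moreover have "\<bar>(of_bool (i = k) * a $ j + of_bool (j = k) * a $ i) * gauss_mom 4 v\<bar> \<le> (r + r) * gauss_mom 4 v"
  proof -
    have "\<bar>of_bool (i = k) * a $ j + of_bool (j = k) * a $ i\<bar> \<le> r + r"
      using an[of j] an[of i] r(2) by (cases "i = k"; cases "j = k") auto
    then show ?thesis
      using gauss_mom_nonneg[of 4 v] r(2) by (simp add: abs_mult mult_right_mono)
  qed
  moreover have "\<bar>a $ i * a $ j * a $ k / (2 * \<tau>) * gauss_mom 6 v\<bar> \<le> r * r * r / (2 * \<tau>) * gauss_mom 6 v"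
    using an[of j] an[of i] an[of k] r(2) \<tau> gauss_mom_nonneg[of 6 v]
    by (auto simp: abs_mult intro!: mult_mono divide_right_mono)
  ultimately have "\<bar>of_bool (i = j) * a $ k * (exp (- v / 4) - gauss_mom 4 v)
       - (of_bool (i = k) * a $ j + of_bool (j = k) * a $ i) * gauss_mom 4 v
       + a $ i * a $ j * a $ k / (2 * \<tau>) * gauss_mom 6 v\<bar>
     \<le> r * (exp (- v / 4) + gauss_mom 4 v) + (r + r) * gauss_mom 4 v + r * r * r / (2 * \<tau>) * gauss_mom 6 v"
    by linarith
  also have "\<dots> = sqrt \<tau> * (sqrt v * exp (- v / 4) + 3 * (sqrt v * gauss_mom 4 v) + v * sqrt v * gauss_mom 6 v / 2)"
    using v \<tau> by (simp add: r(1) field_simps)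
  \<comment> \<open>The three bounds add up to 10000 + 3 * 1000 + 10000 / 2 = 18000.\<close>
  also have "\<dots> \<le> sqrt \<tau> * (20000 / (1 + v)\<^sup>2)"
    using gauss_mom_bounds[OF v(1)] v \<tau> by (intro mult_left_mono) (auto simp: pos_le_divide_eq algebra_simps)
  finally have *: "\<bar>of_bool (i = j) * a $ k * (exp (- v / 4) - gauss_mom 4 v)
       - (of_bool (i = k) * a $ j + of_bool (j = k) * a $ i) * gauss_mom 4 v
       + a $ i * a $ j * a $ k / (2 * \<tau>) * gauss_mom 6 v\<bar> \<le> sqrt \<tau> * (20000 / (1 + v)\<^sup>2)" .
  have p: "\<tau> powr (5/2) = \<tau>\<^sup>2 * sqrt \<tau>"
    using \<tau> powr_add[of \<tau> 2 "1/2"] by (simp add: powr_half_sqrt)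
  have d: "decay_kernel \<tau> a = 1 / (\<tau>\<^sup>2 * (1 + v)\<^sup>2)"
    using v by (simp add: decay_kernel_def power2_norm_eq_inner algebra_simps flip: power_mult_distrib)
  have "\<bar>nse_kernel i j k \<tau> a\<bar> \<le> c / (\<tau>\<^sup>2 * sqrt \<tau>) * (sqrt \<tau> * (20000 / (1 + v)\<^sup>2))"
    unfolding nse_kernel_def Let_def v_def[symmetric] abs_mult p
    using * \<tau> c by (intro mult_mono) (auto simp: c_def)
  also have "\<dots> = c * 20000 * decay_kernel \<tau> a"
    unfolding d using \<tau> by (simp add: field_simps)
  finally show "\<bar>nse_kernel i j k \<tau> a\<bar> \<le> c * 20000 * decay_kernel \<tau> a" .
qed

section \<open>The Newton potential of a Gaussian moment\<close>

lemma lborel_integral_reflect: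
  fixes f :: "'a::euclidean_space \<Rightarrow> 'b::{banach, second_countable_topology}"
  assumes [measurable]: "f \<in> borel_measurable borel"
  shows "(\<integral>w. f (x - w) \<partial>lborel) = (\<integral>w. f w \<partial>lborel)"
proof -
  have "distr (lborel :: 'a measure) borel (\<lambda>w. x - w) = distr (distr lborel borel uminus) borel ((+) x)"
    by (subst distr_distr) (auto simp: comp_def)
  then have "lborel = distr (lborel :: 'a measure) borel (\<lambda>w. x - w)"
    by (simp add: lborel_distr_uminus' lborel_distr_plus)
  then have "(\<integral>w. f w \<partial>lborel) = (\<integral>w. f w \<partial>distr (lborel :: 'a measure) borel (\<lambda>w. x - w))" by simp
  also have "\<dots> = (\<integral>w. f (x - w) \<partial>lborel)"
    by (rule integral_distr) auto
  finally show ?thesis by simp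
qed

lemma lborel_integral_shift:
  fixes f :: "'a::euclidean_space \<Rightarrow> 'b::{banach, second_countable_topology}"
  assumes [measurable]: "f \<in> borel_measurable borel"
  shows "(\<integral>w. f (x + w) \<partial>lborel) = (\<integral>w. f w \<partial>lborel)"
proof -
  have "(\<integral>w. f w \<partial>lborel) = (\<integral>w. f w \<partial>distr (lborel :: 'a measure) borel ((+) x))"
    by (simp add: lborel_distr_plus)
  also have "\<dots> = (\<integral>w. f (x + w) \<partial>lborel)"
    by (rule integral_distr) auto
  finally show ?thesis by simp
qed

lemma measurable_vec_nth' [measurable (raw)]:
  fixes f :: "'a \<Rightarrow> real ^ 'n"
  assumes "f \<in> borel_measurable M"
  shows "(\<lambda>x. f x $ i) \<in> borel_measurable M"
  using assms by (rule measurable_compose) (intro borel_measurable_continuous_onI continuous_intros)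

lemma complete_square:
  fixes w a :: "'a::real_inner"
  assumes "A + B \<noteq> 0"
  shows "A * (norm (w - a))\<^sup>2 + B * (norm w)\<^sup>2 =
    (A + B) * (norm (w - (A / (A + B)) *\<^sub>R a))\<^sup>2 + A * B / (A + B) * (norm a)\<^sup>2"
proof -
  define c where "c = A / (A + B)"
  have c: "(A + B) * c = A" "A * B / (A + B) = A - A * c"
    using assms by (auto simp: c_def field_simps)
  have eq: "(A + B) * (norm (w - c *\<^sub>R a))\<^sup>2 = (A + B) * (w \<bullet> w) - 2 * ((A + B) * c) * (w \<bullet> a) + (A + B) * c * c * (a \<bullet> a)"
    unfolding power2_norm_eq_inner by (simp add: inner_diff inner_commute[of a w]) algebra
  show ?thesis
    unfolding c_def[symmetric] c(2) eq c(1)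
    by (simp add: power2_norm_eq_inner inner_diff inner_commute[of a w] algebra_simps)
qed

lemma exp_complete_square:
  fixes w a :: "'a::real_inner"
  assumes "A + B \<noteq> 0"
  shows "exp (- A * (norm (w - a))\<^sup>2 / 4) * exp (- B * (norm w)\<^sup>2 / 4) =
    exp (- (A * B / (A + B)) * (norm a)\<^sup>2 / 4) * exp (- (A + B) * (norm (w - (A / (A + B)) *\<^sub>R a))\<^sup>2 / 4)"
proof -
  have "- A * (norm (w - a))\<^sup>2 / 4 + - B * (norm w)\<^sup>2 / 4 =
      - (A * B / (A + B)) * (norm a)\<^sup>2 / 4 + - (A + B) * (norm (w - (A / (A + B)) *\<^sub>R a))\<^sup>2 / 4"
  proof -
    have "X + Y = U + V \<Longrightarrow> - X / 4 + - Y / 4 = - V / 4 + - U / 4" for X Y U V :: real by simp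
    from this[OF complete_square[OF assms, of w a]] show ?thesis unfolding mult_minus_left .
  qed
  then show ?thesis by (simp only: exp_add[symmetric])
qed

text \<open>Half of the Gaussian is spent on the linear factor: with s^2 = B |w|^2 / 8 the whole
  exponent is - 2 s^2, and s <= 1 + s^2 <= exp (s^2).\<close>

lemma component_times_gaussian_le:
  fixes w :: "real^3"
  assumes "B > 0"
  shows "\<bar>w $ i\<bar> * exp (- B * (norm w)\<^sup>2 / 4) \<le> sqrt (8 / B) * exp (- (B / 2) * (norm w)\<^sup>2 / 4)"
proof -
  define s where "s = sqrt (B / 8) * norm w"
  have s: "0 \<le> s" "s\<^sup>2 = B * (norm w)\<^sup>2 / 8" using assms by (auto simp: s_def power_mult_distrib)
  have "s \<le> 1 + s\<^sup>2"
    using zero_le_power2[of "s - 1/2"] by (simp add: power2_eq_square algebra_simps)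
  also have "\<dots> \<le> exp (s\<^sup>2)" by (rule exp_ge_add_one_self)
  finally have "s * exp (- 2 * s\<^sup>2) \<le> exp (s\<^sup>2) * exp (- 2 * s\<^sup>2)" by (intro mult_right_mono) auto
  also have "\<dots> = exp (- s\<^sup>2)" by (simp flip: exp_add)
  finally have *: "s * exp (- 2 * s\<^sup>2) \<le> exp (- s\<^sup>2)" .
  have "\<bar>w $ i\<bar> \<le> norm w" by (rule component_le_norm_cart)
  also have "norm w = sqrt (8 / B) * s" using assms by (simp add: s_def real_sqrt_divide)
  finally have "\<bar>w $ i\<bar> * exp (- 2 * s\<^sup>2) \<le> sqrt (8 / B) * s * exp (- 2 * s\<^sup>2)" by (intro mult_right_mono) auto
  also have "\<dots> \<le> sqrt (8 / B) * exp (- s\<^sup>2)" using * assms by (simp add: mult.assoc mult_left_mono)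
  finally show ?thesis by (simp add: s)
qed

lemma integrable_gaussian:
  assumes "P > 0"
  shows "integrable lborel (\<lambda>v::real^3. exp (- P * (norm v)\<^sup>2 / 4))"
  using nn_integral_gaussian[OF assms] by (intro integrableI_nonneg) auto

lemma integral_gaussian:
  assumes "P > 0"
  shows "(\<integral>v. exp (- P * (norm (v::real^3))\<^sup>2 / 4) \<partial>lborel) = (4 * pi / P) powr (3/2)"
  using nn_integral_gaussian[OF assms] by (subst integral_eq_nn_integral) auto

lemma integrable_gaussian_moment:
  assumes "P > 0"
  shows "integrable lborel (\<lambda>v::real^3. v $ i * exp (- P * (norm v)\<^sup>2 / 4))"
  using component_times_gaussian_le[OF assms] assms
  by (intro Bochner_Integration.integrable_bound[OF integrable_mult_right[OF integrable_gaussian[of "P/2"], of "sqrt (8 / P)"]])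
     (auto simp: abs_mult intro!: AE_I2)

lemma integral_gaussian_moment:
  "(\<integral>v. v $ i * exp (- P * (norm (v::real^3))\<^sup>2 / 4) \<partial>lborel) = 0"
  using lborel_integral_reflect[of "\<lambda>v::real^3. v $ i * exp (- P * (norm v)\<^sup>2 / 4)" 0] by simp

text \<open>Completing the square recentres the product at (A / (A + B)) a; about that centre the
  first moment is odd and integrates to 0, so only the mean survives.\<close>

lemma integral_two_gaussians_moment:
  fixes a :: "real^3"
  assumes "A > 0" "B > 0"
  shows "(\<integral>w. exp (- A * (norm (w - a))\<^sup>2 / 4) * (w $ i * exp (- B * (norm w)\<^sup>2 / 4)) \<partial>lborel) =
    exp (- (A * B / (A + B)) * (norm a)\<^sup>2 / 4) * (A / (A + B) * a $ i) * (4 * pi / (A + B)) powr (3/2)"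
proof -
  let ?m = "(A / (A + B)) *\<^sub>R a" and ?E = "exp (- (A * B / (A + B)) * (norm a)\<^sup>2 / 4)"
  have "exp (- A * (norm (w - a))\<^sup>2 / 4) * (w $ i * exp (- B * (norm w)\<^sup>2 / 4)) =
      ?E * (w $ i * exp (- (A + B) * (norm (w - ?m))\<^sup>2 / 4))" for w
  proof -
    have "A + B \<noteq> 0" using assms by simp
    from arg_cong[OF exp_complete_square[OF this, of w a], of "\<lambda>x. w $ i * x"] show ?thesis
      by (simp only: ac_simps)
  qed
  then have "(\<integral>w. exp (- A * (norm (w - a))\<^sup>2 / 4) * (w $ i * exp (- B * (norm w)\<^sup>2 / 4)) \<partial>lborel) =
      ?E * (\<integral>w. w $ i * exp (- (A + B) * (norm (w - ?m))\<^sup>2 / 4) \<partial>lborel)"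
    by (simp only: integral_mult_right_zero)
  also have "(\<integral>w. w $ i * exp (- (A + B) * (norm (w - ?m))\<^sup>2 / 4) \<partial>lborel) =
      (\<integral>v. (?m + v) $ i * exp (- (A + B) * (norm (?m + v - ?m))\<^sup>2 / 4) \<partial>lborel)"
    by (rule lborel_integral_shift[symmetric]) measurable
  also have "\<dots> = (\<integral>v. ?m $ i * exp (- (A + B) * (norm v)\<^sup>2 / 4) + v $ i * exp (- (A + B) * (norm v)\<^sup>2 / 4) \<partial>lborel)"
    by (simp only: add_diff_cancel_left' vector_add_component distrib_right)
  also have "\<dots> = ?m $ i * (4 * pi / (A + B)) powr (3/2)"
  proof -
    have AB: "A + B > 0" using assms by simp
    show ?thesis
      by (subst Bochner_Integration.integral_add)
         (intro integrable_mult_right integrable_gaussian integrable_gaussian_moment AB |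
          simp only: integral_mult_right_zero integral_gaussian[OF AB] integral_gaussian_moment add_0_right)+
  qed
  finally show ?thesis by simp
qed

lemma nn_integral_two_gaussians_le:
  fixes a :: "real^3"
  assumes "A > 0" "B > 0"
  shows "(\<integral>\<^sup>+w. ennreal (exp (- A * (norm (w - a))\<^sup>2 / 4) * exp (- B * (norm w)\<^sup>2 / 4)) \<partial>lborel)
    \<le> ennreal ((4 * pi / (A + B)) powr (3/2))"
proof -
  let ?m = "(A / (A + B)) *\<^sub>R a"
  have "(\<integral>\<^sup>+w. ennreal (exp (- A * (norm (w - a))\<^sup>2 / 4) * exp (- B * (norm w)\<^sup>2 / 4)) \<partial>lborel)
      \<le> (\<integral>\<^sup>+w. ennreal (exp (- (A + B) * (norm (- ?m + w))\<^sup>2 / 4)) \<partial>lborel)"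
  proof (intro nn_integral_mono ennreal_leI)
    fix w
    have "exp (- (A * B / (A + B)) * (norm a)\<^sup>2 / 4) \<le> 1" using assms by simp
    from mult_right_mono[OF this, of "exp (- (A + B) * (norm (w - ?m))\<^sup>2 / 4)"]
    show "exp (- A * (norm (w - a))\<^sup>2 / 4) * exp (- B * (norm w)\<^sup>2 / 4) \<le> exp (- (A + B) * (norm (- ?m + w))\<^sup>2 / 4)"
      using exp_complete_square[of A B w a] assms by simp
  qed
  also have "\<dots> = (\<integral>\<^sup>+w. ennreal (exp (- (A + B) * (norm (w::real^3))\<^sup>2 / 4)) \<partial>lborel)"
    by (rule nn_integral_lborel_shift) measurable
  also have "\<dots> = ennreal ((4 * pi / (A + B)) powr (3/2))"
    using assms by (intro nn_integral_gaussian) auto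
  finally show ?thesis .
qed

text \<open>The antiderivative of the integrand is \<open>b\<^sup>3 gauss_mom 2 (b\<^sup>2 w)\<close> at \<open>b = \<rho> / sqrt (1 + \<tau> \<rho>\<^sup>2)\<close>.\<close>

lemma nn_integral_heat_superposition:
  assumes \<tau>: "\<tau> > 0" and w: "w \<ge> 0"
  shows "(\<integral>\<^sup>+\<rho>. ennreal (\<rho>\<^sup>2 / (1 + \<tau> * \<rho>\<^sup>2) * exp (- (\<rho>\<^sup>2 / (1 + \<tau> * \<rho>\<^sup>2)) * w / 4) / sqrt (1 + \<tau> * \<rho>\<^sup>2) ^ 3) *
      indicator {0..} \<rho> \<partial>lborel) = ennreal (1 / sqrt \<tau> ^ 3 * gauss_mom 2 (w / \<tau>))"
proof -
  define M where "M b = b ^ 3 * gauss_mom 2 (b\<^sup>2 * w)" for b :: real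
  define g where "g \<rho> = \<rho> / sqrt (1 + \<tau> * \<rho>\<^sup>2)" for \<rho> :: real
  have pos: "1 + \<tau> * \<rho>\<^sup>2 > 0" for \<rho> :: real using \<tau> by (intro add_pos_nonneg) auto
  have M: "(M has_real_derivative b\<^sup>2 * exp (- b\<^sup>2 * w / 4)) (at b)" for b
  proof -
    have "((\<lambda>b. gauss_mom 2 (b\<^sup>2 * w)) has_real_derivative - gauss_mom 4 (b\<^sup>2 * w) / 4 * (2 * b * w)) (at b)"
      using DERIV_gauss_mom[of 2 "b\<^sup>2 * w"]
      by (intro DERIV_chain2[where f="gauss_mom 2"]) (auto intro!: derivative_eq_intros)
    then have "(M has_real_derivative 3 * b\<^sup>2 * gauss_mom 2 (b\<^sup>2 * w) + b ^ 3 * (- gauss_mom 4 (b\<^sup>2 * w) / 4 * (2 * b * w))) (at b)"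
      unfolding M_def by (auto intro!: derivative_eq_intros simp: eval_nat_numeral)
    \<comment> \<open>By the recurrence with n = 2 the bracket collapses to the exponential, so
      \<open>M\<close> is an antiderivative of b^2 exp (- b^2 w / 4).\<close>
    also have "3 * b\<^sup>2 * gauss_mom 2 (b\<^sup>2 * w) + b ^ 3 * (- gauss_mom 4 (b\<^sup>2 * w) / 4 * (2 * b * w)) =
        b\<^sup>2 * (3 * gauss_mom 2 (b\<^sup>2 * w) - b\<^sup>2 * w / 2 * gauss_mom 4 (b\<^sup>2 * w))"
      by (simp add: algebra_simps eval_nat_numeral)
    also have "b\<^sup>2 * w / 2 * gauss_mom 4 (b\<^sup>2 * w) = 3 * gauss_mom 2 (b\<^sup>2 * w) - exp (- (b\<^sup>2 * w) / 4)"
      using gauss_mom_recurrence[of "b\<^sup>2 * w" 2] by simp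
    finally show ?thesis by simp
  qed
  have g: "(g has_real_derivative 1 / sqrt (1 + \<tau> * \<rho>\<^sup>2) ^ 3) (at \<rho>)" for \<rho>
  proof -
    have s: "sqrt (1 + \<tau> * \<rho>\<^sup>2) > 0" using pos by simp
    have s': "((\<lambda>\<rho>. sqrt (1 + \<tau> * \<rho>\<^sup>2)) has_real_derivative \<tau> * (2 * \<rho>) / (2 * sqrt (1 + \<tau> * \<rho>\<^sup>2))) (at \<rho>)"
    proof -
      have "((\<lambda>\<rho>. 1 + \<tau> * \<rho>\<^sup>2) has_real_derivative \<tau> * (2 * \<rho>)) (at \<rho>)"
        by (auto intro!: derivative_eq_intros)
      from DERIV_chain2[where f=sqrt, OF DERIV_real_sqrt[OF pos] this] show ?thesis
        by (rule DERIV_cong) (use s in \<open>simp add: field_simps\<close>)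
    qed
    have "(g has_real_derivative (1 * sqrt (1 + \<tau> * \<rho>\<^sup>2) - \<rho> * (\<tau> * (2 * \<rho>) / (2 * sqrt (1 + \<tau> * \<rho>\<^sup>2)))) /
        (sqrt (1 + \<tau> * \<rho>\<^sup>2) * sqrt (1 + \<tau> * \<rho>\<^sup>2))) (at \<rho>)"
      unfolding g_def using s by (intro DERIV_divide DERIV_ident s') auto
    also have "(1 * sqrt (1 + \<tau> * \<rho>\<^sup>2) - \<rho> * (\<tau> * (2 * \<rho>) / (2 * sqrt (1 + \<tau> * \<rho>\<^sup>2)))) =
        (sqrt (1 + \<tau> * \<rho>\<^sup>2) ^ 2 - \<tau> * \<rho>\<^sup>2) / sqrt (1 + \<tau> * \<rho>\<^sup>2)"
      using s by (simp add: field_simps power2_eq_square)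
    also have "(sqrt (1 + \<tau> * \<rho>\<^sup>2) ^ 2 - \<tau> * \<rho>\<^sup>2) = 1" using pos[of \<rho>] by simp
    finally show ?thesis by (simp add: power3_eq_cube mult.assoc mult.commute)
  qed
  have g2: "(g \<rho>)\<^sup>2 = \<rho>\<^sup>2 / (1 + \<tau> * \<rho>\<^sup>2)" for \<rho>
    using pos[of \<rho>] by (simp add: g_def power_divide)
  have "(\<integral>\<^sup>+\<rho>. ennreal (\<rho>\<^sup>2 / (1 + \<tau> * \<rho>\<^sup>2) * exp (- (\<rho>\<^sup>2 / (1 + \<tau> * \<rho>\<^sup>2)) * w / 4) / sqrt (1 + \<tau> * \<rho>\<^sup>2) ^ 3) *
      indicator {0..} \<rho> \<partial>lborel) = ennreal (M (1 / sqrt \<tau>) - M (g 0))"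
  proof (rule nn_integral_FTC_atLeast)
    show "((\<lambda>x. M (g x)) has_real_derivative
        \<rho>\<^sup>2 / (1 + \<tau> * \<rho>\<^sup>2) * exp (- (\<rho>\<^sup>2 / (1 + \<tau> * \<rho>\<^sup>2)) * w / 4) / sqrt (1 + \<tau> * \<rho>\<^sup>2) ^ 3) (at \<rho>)" for \<rho>
      using DERIV_chain2[OF M[of "g \<rho>"] g] by (simp add: g2)
    show "0 \<le> \<rho>\<^sup>2 / (1 + \<tau> * \<rho>\<^sup>2) * exp (- (\<rho>\<^sup>2 / (1 + \<tau> * \<rho>\<^sup>2)) * w / 4) / sqrt (1 + \<tau> * \<rho>\<^sup>2) ^ 3" for \<rho>
      using pos[of \<rho>] by simp
    \<comment> \<open>The substitution maps the half line onto a bounded range ending at 1 / sqrt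
      \<tau>; this limit turns the improper integral into a value of
      \<open>gauss_mom 2\<close>.\<close>
    have "(g \<longlongrightarrow> inverse (\<tau> powr (1/2))) at_top"
      unfolding g_def using \<tau> by real_asymp
    then have "(g \<longlongrightarrow> 1 / sqrt \<tau>) at_top"
      using \<tau> by (simp add: powr_half_sqrt inverse_eq_divide)
    moreover have "isCont M (1 / sqrt \<tau>)" using M by (rule DERIV_isCont)
    ultimately show "((\<lambda>x. M (g x)) \<longlongrightarrow> M (1 / sqrt \<tau>)) at_top"
      by (rule isCont_tendsto_compose[rotated])
  qed measurable
  also have "M (1 / sqrt \<tau>) - M (g 0) = 1 / sqrt \<tau> ^ 3 * gauss_mom 2 (w / \<tau>)"
    using \<tau> by (simp add: M_def g_def power_divide)
  finally show ?thesis .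
qed

text \<open>This is (4 * pi) powr (- 3/2), the normalisation of the heat kernel without its power of
  \<tau>.\<close>

definition nse_const :: real where "nse_const = 1 / (8 * pi powr (3/2))"

lemma heat_kernel_eq:
  assumes "\<tau> > 0"
  shows "heat_kernel \<tau> a = nse_const / \<tau> powr (3/2) * exp (- (a \<bullet> a / \<tau>) / 4)"
proof -
  have "(4::real) powr (3/2) = 8"
    using powr_powr[of 2 2 "3/2::real"] by simp
  then show ?thesis
    using assms by (simp add: heat_kernel_def nse_const_def powr_mult power2_norm_eq_inner mult.commute[of 4])
qed

text \<open>The integral of exp (- \<rho>^2 |z|^2 / 4) over \<rho> > 0 is sqrt pi / |z|. In this
  form, convolving a Gaussian moment with the Newton kernel means integrating a product of two
  Gaussians for each \<rho>.\<close>

lemma Newton_kernel_superposition: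
  fixes z :: "real^3"
  assumes "z \<noteq> 0"
  shows "Newton_kernel z = 1 / (4 * pi powr (3/2)) * (\<integral>\<rho>. indicator {0<..} \<rho> * exp (- \<rho>\<^sup>2 * (norm z)\<^sup>2 / 4) \<partial>lborel)"
proof -
  have "(\<integral>\<^sup>+\<rho>. ennreal (indicator {0<..} \<rho> * exp (- \<rho>\<^sup>2 * (norm z)\<^sup>2 / 4)) \<partial>lborel) =
      (\<integral>\<^sup>+\<rho>\<in>{0<..}. ennreal (exp (- (norm z)\<^sup>2 * \<rho>\<^sup>2 / 4)) \<partial>lborel)"
    by (intro nn_integral_cong) (auto split: split_indicator simp: mult.commute)
  also have "\<dots> = ennreal (sqrt pi / norm z)"
    using assms by (intro nn_integral_half_gaussian) auto
  finally have "(\<integral>\<rho>. indicator {0<..} \<rho> * exp (- \<rho>\<^sup>2 * (norm z)\<^sup>2 / 4) \<partial>lborel) = sqrt pi / norm z"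
    by (subst integral_eq_nn_integral) auto
  moreover have "pi powr (3/2) = pi * sqrt pi"
    using powr_add[of pi 1 "1/2"] by (simp add: powr_half_sqrt)
  ultimately show ?thesis by (simp add: Newton_kernel_def)
qed

text \<open>Absolute integrability, needed to exchange \<rho> and w. After the linear factor is
  absorbed, the w-integral is at most a multiple of (B/2 + \<rho>^2)^(-3/2), uniformly in a, and
  this is integrable in \<rho>.\<close>

lemma integrable_superposition:
  fixes a :: "real^3"
  assumes "B > 0"
  shows "integrable (lborel \<Otimes>\<^sub>M lborel)
    (\<lambda>(\<rho>, w). indicator {0<..} \<rho> * (exp (- \<rho>\<^sup>2 * (norm (w - a))\<^sup>2 / 4) * (w $ i * exp (- B * (norm w)\<^sup>2 / 4))))"
    (is "integrable _ (case_prod ?H)")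
proof (rule integrableI_bounded)
  have "(\<integral>\<^sup>+z. ennreal (norm (case_prod ?H z)) \<partial>(lborel \<Otimes>\<^sub>M lborel)) = (\<integral>\<^sup>+\<rho>. \<integral>\<^sup>+w. ennreal (norm (?H \<rho> w)) \<partial>lborel \<partial>lborel)"
    by (subst lborel.nn_integral_fst[symmetric]) auto
  also have "\<dots> \<le> (\<integral>\<^sup>+\<rho>. ennreal (sqrt (8 / B) * (4 * pi) powr (3/2)) * ennreal ((B / 2 + \<rho>\<^sup>2) powr (- (3/2))) \<partial>lborel)"
  proof (intro nn_integral_mono_AE eventually_mono[OF AE_lborel_singleton[of 0]])
    fix \<rho> :: real assume "\<rho> \<noteq> 0"
    then have \<rho>: "\<rho>\<^sup>2 > 0" by simp
    have "(\<integral>\<^sup>+w. ennreal (norm (?H \<rho> w)) \<partial>lborel) \<le>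
        (\<integral>\<^sup>+w. ennreal (sqrt (8 / B)) * ennreal (exp (- \<rho>\<^sup>2 * (norm (w - a))\<^sup>2 / 4) * exp (- (B / 2) * (norm w)\<^sup>2 / 4)) \<partial>lborel)"
    proof (intro nn_integral_mono)
      fix w :: "real^3"
      have "norm (?H \<rho> w) \<le> exp (- \<rho>\<^sup>2 * (norm (w - a))\<^sup>2 / 4) * (\<bar>w $ i\<bar> * exp (- B * (norm w)\<^sup>2 / 4))"
        by (auto simp: abs_mult split: split_indicator)
      also have "\<dots> \<le> exp (- \<rho>\<^sup>2 * (norm (w - a))\<^sup>2 / 4) * (sqrt (8 / B) * exp (- (B / 2) * (norm w)\<^sup>2 / 4))"
        by (intro mult_left_mono component_times_gaussian_le assms) auto
      finally show "ennreal (norm (?H \<rho> w)) \<le> ennreal (sqrt (8 / B)) * ennreal (exp (- \<rho>\<^sup>2 * (norm (w - a))\<^sup>2 / 4) * exp (- (B / 2) * (norm w)\<^sup>2 / 4))"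
        using assms by (simp add: ac_simps flip: ennreal_mult)
    qed
    also have "\<dots> = ennreal (sqrt (8 / B)) * (\<integral>\<^sup>+w. ennreal (exp (- \<rho>\<^sup>2 * (norm (w - a))\<^sup>2 / 4) * exp (- (B / 2) * (norm w)\<^sup>2 / 4)) \<partial>lborel)"
      by (intro nn_integral_cmult) auto
    also have "\<dots> \<le> ennreal (sqrt (8 / B)) * ennreal ((4 * pi / (\<rho>\<^sup>2 + B / 2)) powr (3/2))"
      using \<rho> assms by (intro mult_left_mono nn_integral_two_gaussians_le) auto
    also have "(4 * pi / (\<rho>\<^sup>2 + B / 2)) powr (3/2) = (4 * pi) powr (3/2) * (B / 2 + \<rho>\<^sup>2) powr (- (3/2))"
      using assms \<rho> by (simp add: powr_divide powr_minus_divide add.commute)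
    finally show "(\<integral>\<^sup>+w. ennreal (norm (?H \<rho> w)) \<partial>lborel) \<le>
        ennreal (sqrt (8 / B) * (4 * pi) powr (3/2)) * ennreal ((B / 2 + \<rho>\<^sup>2) powr (- (3/2)))"
      using assms by (simp add: ennreal_mult mult.assoc)
  qed
  also have "\<dots> < top"
    using assms nn_integral_power_decay_finite[of "3/2"]
    by (subst nn_integral_cmult, measurable, subst nn_integral_power_decay_scale) (auto simp: ennreal_mult_less_top)
  finally show "(\<integral>\<^sup>+z. ennreal (norm (case_prod ?H z)) \<partial>(lborel \<Otimes>\<^sub>M lborel)) < \<infinity>" by simp
qed measurable

text \<open>The function w_i / (2 \<tau>) times the heat kernel is minus its i-th derivative, that
  is, the divergence to which \<open>Leray\<close> applies the Newton potential. The potential is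
  computed by superposing Gaussians in \<rho>: the w-integral is a two-Gaussian moment, the
  \<rho>-integral is \<open>nn_integral_heat_superposition\<close>.\<close>

lemma Newton_kernel_convolution:
  fixes a :: "real^3"
  assumes \<tau>: "\<tau> > 0"
  shows "(\<integral>w. Newton_kernel (w - a) * (w $ i / (2 * \<tau>) * heat_kernel \<tau> w) \<partial>lborel) =
    nse_const / \<tau> powr (3/2) * (a $ i * gauss_mom 2 (a \<bullet> a / \<tau>))"
proof -
  define c where "c = 1 / (4 * pi powr (3/2)) * (1 / (2 * \<tau>) * (nse_const / \<tau> powr (3/2)))"
  define H where "H \<rho> w = indicator {0<..} \<rho> * (exp (- \<rho>\<^sup>2 * (norm (w - a))\<^sup>2 / 4) * (w $ i * exp (- (1/\<tau>) * (norm w)\<^sup>2 / 4)))"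
    for \<rho> and w :: "real^3"
  have H: "integrable (lborel \<Otimes>\<^sub>M lborel) (case_prod H)"
    unfolding H_def using \<tau> by (intro integrable_superposition) auto
  have [measurable]: "Newton_kernel \<in> borel_measurable borel" unfolding Newton_kernel_def[abs_def] by measurable
  have 1: "AE w in lborel. Newton_kernel (w - a) * (w $ i / (2 * \<tau>) * heat_kernel \<tau> w) = c * (\<integral>\<rho>. H \<rho> w \<partial>lborel)"
  proof (rule eventually_mono[OF AE_lborel_singleton[of a]])
    fix w assume "w \<noteq> a"
    have "(\<integral>\<rho>. H \<rho> w \<partial>lborel) = (\<integral>\<rho>. indicator {0<..} \<rho> * exp (- \<rho>\<^sup>2 * (norm (w - a))\<^sup>2 / 4) \<partial>lborel) * (w $ i * exp (- (1/\<tau>) * (norm w)\<^sup>2 / 4))"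
      unfolding H_def by (simp only: integral_mult_left_zero mult.assoc[symmetric])
    then show "Newton_kernel (w - a) * (w $ i / (2 * \<tau>) * heat_kernel \<tau> w) = c * (\<integral>\<rho>. H \<rho> w \<partial>lborel)"
      using \<open>w \<noteq> a\<close> \<tau> Newton_kernel_superposition[of "w - a"]
      by (simp add: heat_kernel_eq c_def power2_norm_eq_inner)
  qed
  have 2: "AE \<rho> in lborel. (\<integral>w. H \<rho> w \<partial>lborel) =
     \<tau> * a $ i * (4 * pi * \<tau>) powr (3/2) *
     (indicator {0..} \<rho> * (\<rho>\<^sup>2 / (1 + \<tau> * \<rho>\<^sup>2) * exp (- (\<rho>\<^sup>2 / (1 + \<tau> * \<rho>\<^sup>2)) * (a \<bullet> a) / 4) / sqrt (1 + \<tau> * \<rho>\<^sup>2) ^ 3))"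
  proof (rule eventually_mono[OF AE_lborel_singleton[of 0]])
    fix \<rho> :: real assume \<rho>: "\<rho> \<noteq> 0"
    show "(\<integral>w. H \<rho> w \<partial>lborel) =
     \<tau> * a $ i * (4 * pi * \<tau>) powr (3/2) *
     (indicator {0..} \<rho> * (\<rho>\<^sup>2 / (1 + \<tau> * \<rho>\<^sup>2) * exp (- (\<rho>\<^sup>2 / (1 + \<tau> * \<rho>\<^sup>2)) * (a \<bullet> a) / 4) / sqrt (1 + \<tau> * \<rho>\<^sup>2) ^ 3))"
    proof (cases "\<rho> > 0")
      case True
      \<comment> \<open>Multiplying by \<tau> brings all three factors to the denominator 1 + \<tau>
        \<rho>^2, the form expected by the \<rho>-integral.\<close>
      have P: "\<rho>\<^sup>2 + 1 / \<tau> = (1 + \<tau> * \<rho>\<^sup>2) / \<tau>" using \<tau> by (simp add: field_simps)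
      have pos: "1 + \<tau> * \<rho>\<^sup>2 > 0" using \<tau> by (intro add_pos_nonneg) auto
      have s3: "(4 * pi / (\<rho>\<^sup>2 + 1 / \<tau>)) powr (3/2) = (4 * pi * \<tau>) powr (3/2) / sqrt (1 + \<tau> * \<rho>\<^sup>2) ^ 3"
        unfolding P using \<tau> pos
        by (simp add: powr_divide powr_half_sqrt[symmetric] powr_power del: powr_half_sqrt)
      have AB: "\<rho>\<^sup>2 * (1 / \<tau>) / (\<rho>\<^sup>2 + 1 / \<tau>) = \<rho>\<^sup>2 / (1 + \<tau> * \<rho>\<^sup>2)"
        "\<rho>\<^sup>2 / (\<rho>\<^sup>2 + 1 / \<tau>) = \<tau> * (\<rho>\<^sup>2 / (1 + \<tau> * \<rho>\<^sup>2))"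
        unfolding P using \<tau> pos by auto
      have "(\<integral>w. H \<rho> w \<partial>lborel) = (\<integral>w. exp (- \<rho>\<^sup>2 * (norm (w - a))\<^sup>2 / 4) * (w $ i * exp (- (1/\<tau>) * (norm w)\<^sup>2 / 4)) \<partial>lborel)"
        using True by (simp add: H_def)
      also have "\<dots> = exp (- (\<rho>\<^sup>2 * (1 / \<tau>) / (\<rho>\<^sup>2 + 1 / \<tau>)) * (norm a)\<^sup>2 / 4) * (\<rho>\<^sup>2 / (\<rho>\<^sup>2 + 1 / \<tau>) * a $ i) * (4 * pi / (\<rho>\<^sup>2 + 1 / \<tau>)) powr (3/2)"
        using \<rho> \<tau> by (intro integral_two_gaussians_moment) auto
      finally show ?thesis
        unfolding s3 AB using True by (simp add: power2_norm_eq_inner)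
    qed (use \<rho> in \<open>simp add: H_def\<close>)
  qed
  have 3: "(\<integral>\<rho>. indicator {0..} \<rho> * (\<rho>\<^sup>2 / (1 + \<tau> * \<rho>\<^sup>2) * exp (- (\<rho>\<^sup>2 / (1 + \<tau> * \<rho>\<^sup>2)) * (a \<bullet> a) / 4) / sqrt (1 + \<tau> * \<rho>\<^sup>2) ^ 3) \<partial>lborel)
      = 1 / sqrt \<tau> ^ 3 * gauss_mom 2 (a \<bullet> a / \<tau>)"
  proof (subst integral_eq_nn_integral)
    have pos: "1 + \<tau> * \<rho>\<^sup>2 > 0" for \<rho> :: real using \<tau> by (intro add_pos_nonneg) auto
    have "(\<integral>\<^sup>+\<rho>. ennreal (indicator {0..} \<rho> * (\<rho>\<^sup>2 / (1 + \<tau> * \<rho>\<^sup>2) * exp (- (\<rho>\<^sup>2 / (1 + \<tau> * \<rho>\<^sup>2)) * (a \<bullet> a) / 4) / sqrt (1 + \<tau> * \<rho>\<^sup>2) ^ 3)) \<partial>lborel)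
      = ennreal (1 / sqrt \<tau> ^ 3 * gauss_mom 2 (a \<bullet> a / \<tau>))"
      unfolding nn_integral_heat_superposition[OF \<tau> inner_ge_zero, symmetric]
      by (intro nn_integral_cong) (auto split: split_indicator)
    then show "enn2real (\<integral>\<^sup>+\<rho>. ennreal (indicator {0..} \<rho> * (\<rho>\<^sup>2 / (1 + \<tau> * \<rho>\<^sup>2) * exp (- (\<rho>\<^sup>2 / (1 + \<tau> * \<rho>\<^sup>2)) * (a \<bullet> a) / 4) / sqrt (1 + \<tau> * \<rho>\<^sup>2) ^ 3)) \<partial>lborel)
      = 1 / sqrt \<tau> ^ 3 * gauss_mom 2 (a \<bullet> a / \<tau>)"
      using \<tau> by (simp add: gauss_mom_nonneg)
    show "AE \<rho> in lborel. 0 \<le> indicator {0..} \<rho> * (\<rho>\<^sup>2 / (1 + \<tau> * \<rho>\<^sup>2) * exp (- (\<rho>\<^sup>2 / (1 + \<tau> * \<rho>\<^sup>2)) * (a \<bullet> a) / 4) / sqrt (1 + \<tau> * \<rho>\<^sup>2) ^ 3)"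
      using pos by (intro AE_I2 mult_nonneg_nonneg divide_nonneg_nonneg) (auto simp: less_imp_le)
  qed measurable
  have [measurable]: "case_prod H \<in> borel_measurable (lborel \<Otimes>\<^sub>M lborel)" using H by auto
  have "(\<integral>w. Newton_kernel (w - a) * (w $ i / (2 * \<tau>) * heat_kernel \<tau> w) \<partial>lborel) = (\<integral>w. c * (\<integral>\<rho>. H \<rho> w \<partial>lborel) \<partial>lborel)"
    using 1 unfolding H_def by (intro integral_cong_AE) measurable
  also have "\<dots> = c * (\<integral>w. (\<integral>\<rho>. H \<rho> w \<partial>lborel) \<partial>lborel)" by simp
  also have "(\<integral>w. (\<integral>\<rho>. H \<rho> w \<partial>lborel) \<partial>lborel) = (\<integral>\<rho>. (\<integral>w. H \<rho> w \<partial>lborel) \<partial>lborel)"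
    by (rule lborel_pair.Fubini_integral[OF H])
  also have "\<dots> = (\<integral>\<rho>. \<tau> * a $ i * (4 * pi * \<tau>) powr (3/2) *
     (indicator {0..} \<rho> * (\<rho>\<^sup>2 / (1 + \<tau> * \<rho>\<^sup>2) * exp (- (\<rho>\<^sup>2 / (1 + \<tau> * \<rho>\<^sup>2)) * (a \<bullet> a) / 4) / sqrt (1 + \<tau> * \<rho>\<^sup>2) ^ 3)) \<partial>lborel)"
    using 2 unfolding H_def by (intro integral_cong_AE) measurable
  also have "\<dots> = \<tau> * a $ i * (4 * pi * \<tau>) powr (3/2) * (1 / sqrt \<tau> ^ 3 * gauss_mom 2 (a \<bullet> a / \<tau>))"
    by (simp only: integral_mult_right_zero 3)
  \<comment> \<open>The factor 4^(3/2) = 8 cancels the 4 and the 2 contained in \<open>c\<close>,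
    and \<tau>^(3/2) from the Gaussian integral cancels \<open>1 / sqrt \<tau> ^ 3\<close>.\<close>
  also have "c * \<dots> = nse_const / \<tau> powr (3/2) * (a $ i * gauss_mom 2 (a \<bullet> a / \<tau>))"
  proof -
    have "(4::real) powr (3/2) = 8"
      using powr_powr[of 2 2 "3/2::real"] by simp
    moreover have "sqrt \<tau> ^ 3 = \<tau> powr (3/2)"
      using \<tau> by (simp add: powr_half_sqrt[symmetric] powr_power del: powr_half_sqrt)
    moreover have "\<tau> powr (3/2) > 0" "pi powr (3/2) > 0" using \<tau> by auto
    ultimately show ?thesis
      using \<tau> by (simp add: c_def nse_const_def powr_mult field_simps)
  qed
  finally show ?thesis .
qed

section \<open>From the Leray projection of a Gaussian to the explicit kernel\<close>

lemma partial_eqI: "(f has_derivative f') (at x) \<Longrightarrow> partial k f x = f' (axis k 1)"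
  by (simp add: partial_def frechet_derivative_at[symmetric])

lemma has_derivative_reflect:
  fixes F :: "'a::real_normed_vector \<Rightarrow> 'b::real_normed_vector"
  assumes "(F has_derivative F') (at (x - y))"
  shows "((\<lambda>y. F (x - y)) has_derivative (\<lambda>h. F' (- h))) (at y)"
proof -
  have "((\<lambda>y. x - y) has_derivative (\<lambda>h. - h)) (at y)"
    by (auto intro!: derivative_eq_intros)
  from has_derivative_compose[OF this assms] show ?thesis .
qed

lemma has_derivative_heat_kernel:
  assumes "\<tau> > 0"
  shows "(heat_kernel \<tau> has_derivative (\<lambda>h. - ((a \<bullet> h) / (2 * \<tau>)) * heat_kernel \<tau> a)) (at a)"
proof -
  have "heat_kernel \<tau> = (\<lambda>a. nse_const / \<tau> powr (3/2) * exp (- (a \<bullet> a / \<tau>) / 4))"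
    using heat_kernel_eq[OF assms] by auto
  then show ?thesis
    using has_derivative_mult_right[OF has_derivative_exp_radial[OF assms, of a], of "nse_const / \<tau> powr (3/2)"]
    by (simp add: ac_simps)
qed

lemma inner_minus_axis: "b \<bullet> (- axis j 1) = - (b :: real^3) $ j"
  by (simp add: inner_axis)

lemma minus_axis_nth: "(- axis j 1 :: real^3) $ i = - of_bool (i = j)"
  by (simp add: axis_def)

lemma divergence_heat_kernel:
  assumes "\<tau> > 0"
  shows "divergence (\<lambda>y. heat_kernel \<tau> (x - y) *\<^sub>R axis i 1) y = (x - y) $ i / (2 * \<tau>) * heat_kernel \<tau> (x - y)"
proof -
  have p: "partial k (\<lambda>y. (heat_kernel \<tau> (x - y) *\<^sub>R axis i 1) $ k) y =
      of_bool (k = i) * ((x - y) $ i / (2 * \<tau>) * heat_kernel \<tau> (x - y))" for k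
  proof -
    have "((\<lambda>y. of_bool (k = i) * heat_kernel \<tau> (x - y)) has_derivative
        (\<lambda>h. of_bool (k = i) * (- (((x - y) \<bullet> (- h)) / (2 * \<tau>)) * heat_kernel \<tau> (x - y)))) (at y)"
      by (intro has_derivative_mult_right has_derivative_reflect has_derivative_heat_kernel assms)
    from partial_eqI[OF this, of k]
    have "partial k (\<lambda>y. of_bool (k = i) * heat_kernel \<tau> (x - y)) y =
        of_bool (k = i) * ((x - y) $ i / (2 * \<tau>) * heat_kernel \<tau> (x - y))"
      by (simp only: inner_minus_axis) (auto simp del: vector_minus_component)
    moreover have "(\<lambda>y. (heat_kernel \<tau> (x - y) *\<^sub>R axis i 1) $ k) = (\<lambda>y. of_bool (k = i) * heat_kernel \<tau> (x - y))"
      by (auto simp: axis_def)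
    ultimately show ?thesis by simp
  qed
  show ?thesis unfolding divergence_def p sum_distrib_right[symmetric] by (simp add: of_bool_def)
qed

lemma convol_Newton_kernel_divergence:
  assumes "\<tau> > 0"
  shows "convol Newton_kernel (divergence (\<lambda>y. heat_kernel \<tau> (x - y) *\<^sub>R axis i 1)) y =
    nse_const / \<tau> powr (3/2) * ((x - y) $ i * gauss_mom 2 ((x - y) \<bullet> (x - y) / \<tau>))"
proof -
  have [measurable]: "Newton_kernel \<in> borel_measurable borel" unfolding Newton_kernel_def[abs_def] by measurable
  have "convol Newton_kernel (divergence (\<lambda>y. heat_kernel \<tau> (x - y) *\<^sub>R axis i 1)) y =
     (\<integral>z. Newton_kernel (y - z) * ((x - z) $ i / (2 * \<tau>) * heat_kernel \<tau> (x - z)) \<partial>lborel)"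
    unfolding convol_def by (simp only: divergence_heat_kernel[OF assms] real_scaleR_def)
  also have "\<dots> = (\<integral>w. Newton_kernel (y - (x - w)) * ((x - (x - w)) $ i / (2 * \<tau>) * heat_kernel \<tau> (x - (x - w))) \<partial>lborel)"
    by (rule lborel_integral_reflect[symmetric]) measurable
  also have "\<dots> = (\<integral>w. Newton_kernel (w - (x - y)) * (w $ i / (2 * \<tau>) * heat_kernel \<tau> w) \<partial>lborel)"
  proof -
    have "y - (x - w) = w - (x - y)" "x - (x - w) = w" for w by auto
    then show ?thesis by (simp only:)
  qed
  also have "\<dots> = nse_const / \<tau> powr (3/2) * ((x - y) $ i * gauss_mom 2 ((x - y) \<bullet> (x - y) / \<tau>))"
    by (rule Newton_kernel_convolution[OF assms])
  finally show ?thesis .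
qed

lemma has_derivative_component: "((\<lambda>a. a $ k) has_derivative (\<lambda>h. h $ k)) (at (a :: real^3))"
  by (rule bounded_linear_imp_has_derivative) auto

text \<open>The terms with moments are the gradient of the Newton potential. The right side is kept
  as a function of a applied to x - y, so that its y-derivative follows from
  \<open>has_derivative_reflect\<close>.\<close>

lemma Leray_heat_kernel:
  assumes "\<tau> > 0"
  shows "Leray (\<lambda>y. heat_kernel \<tau> (x - y) *\<^sub>R axis i 1) y $ j =
    (\<lambda>a. nse_const / \<tau> powr (3/2) * (of_bool (i = j) * (exp (- (a \<bullet> a / \<tau>) / 4) - gauss_mom 2 (a \<bullet> a / \<tau>))
        + a $ i * a $ j * (1 / (2 * \<tau>)) * gauss_mom 4 (a \<bullet> a / \<tau>))) (x - y)"
proof -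
  define c where "c = nse_const / \<tau> powr (3/2)"
  define a where "a = x - y"
  have "((\<lambda>a. c * (a $ i * gauss_mom 2 (a \<bullet> a / \<tau>))) has_derivative
      (\<lambda>h. c * (a $ i * (- ((a \<bullet> h) / (2 * \<tau>)) * gauss_mom (2 + 2) (a \<bullet> a / \<tau>)) + h $ i * gauss_mom 2 (a \<bullet> a / \<tau>)))) (at a)"
    by (intro has_derivative_mult_right has_derivative_mult has_derivative_component has_derivative_gauss_mom_radial assms)
  from partial_eqI[OF has_derivative_reflect[OF this[unfolded a_def]], of j]
  have "partial j (convol Newton_kernel (divergence (\<lambda>y. heat_kernel \<tau> (x - y) *\<^sub>R axis i 1))) y =
      c * (a $ i * (a $ j / (2 * \<tau>) * gauss_mom 4 (a \<bullet> a / \<tau>)) - of_bool (i = j) * gauss_mom 2 (a \<bullet> a / \<tau>))"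
    unfolding convol_Newton_kernel_divergence[OF assms, abs_def] inner_minus_axis minus_axis_nth a_def[symmetric] c_def[symmetric]
    by (simp only: minus_divide_left[symmetric] minus_minus mult_minus_left numeral_plus_numeral add_num_simps)
       (simp add: algebra_simps)
  then show ?thesis
    unfolding Leray_def gradient_def vector_add_component vector_scaleR_component vec_lambda_beta
      heat_kernel_eq[OF assms]
    by (simp only: a_def[symmetric] c_def[symmetric])
       (cases "i = j"; simp add: axis_def algebra_simps add_divide_distrib diff_divide_distrib)
qed

lemma jacobian_Leray_heat_kernel:
  assumes "\<tau> > 0"
  shows "jacobian_field (Leray (\<lambda>y. heat_kernel \<tau> (x - y) *\<^sub>R axis i 1)) y $ j $ k = nse_kernel i j k \<tau> (x - y)"
proof -
  define c where "c = nse_const / \<tau> powr (3/2)"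
  define a where "a = x - y"
  define E where "E = exp (- (a \<bullet> a / \<tau>) / 4)"
  define g4 where "g4 = gauss_mom 4 (a \<bullet> a / \<tau>)"
  define g6 where "g6 = gauss_mom 6 (a \<bullet> a / \<tau>)"
  \<comment> \<open>One derivative of a Gaussian or a moment yields the factor 1 / (2 \<tau>), which
    accounts for 16 = 2 * 8 and for the power 5/2.\<close>
  have c: "1 / (16 * pi powr (3/2) * \<tau> powr (5/2)) = c * (1 / (2 * \<tau>))"
    using assms powr_add[of \<tau> "3/2" 1] by (simp add: c_def nse_const_def)
  have 24: "2 + 2 = (4::nat)" "4 + 2 = (6::nat)" by auto
  have "((\<lambda>a. c * (of_bool (i = j) * (exp (- (a \<bullet> a / \<tau>) / 4) - gauss_mom 2 (a \<bullet> a / \<tau>))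
        + a $ i * a $ j * (1 / (2 * \<tau>)) * gauss_mom 4 (a \<bullet> a / \<tau>))) has_derivative
      (\<lambda>h. c * (of_bool (i = j) * (- ((a \<bullet> h) / (2 * \<tau>)) * exp (- (a \<bullet> a / \<tau>) / 4)
             - - ((a \<bullet> h) / (2 * \<tau>)) * gauss_mom (2 + 2) (a \<bullet> a / \<tau>))
        + (a $ i * a $ j * (1 / (2 * \<tau>)) * (- ((a \<bullet> h) / (2 * \<tau>)) * gauss_mom (4 + 2) (a \<bullet> a / \<tau>))
           + ((a $ i * h $ j + h $ i * a $ j) * (1 / (2 * \<tau>))) * gauss_mom 4 (a \<bullet> a / \<tau>))))) (at a)"
    by (intro has_derivative_mult_right has_derivative_mult_left has_derivative_mult has_derivative_component has_derivative_add has_derivative_diff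
       has_derivative_gauss_mom_radial has_derivative_exp_radial assms)
  from partial_eqI[OF has_derivative_reflect[OF this[unfolded a_def]], of k, unfolded inner_minus_axis minus_axis_nth, folded a_def]
  have p: "jacobian_field (Leray (\<lambda>y. heat_kernel \<tau> (x - y) *\<^sub>R axis i 1)) y $ j $ k =
      c * (of_bool (i = j) * (- (- a $ k / (2 * \<tau>)) * E - - (- a $ k / (2 * \<tau>)) * g4)
        + (a $ i * a $ j * (1 / (2 * \<tau>)) * (- (- a $ k / (2 * \<tau>)) * g6)
           + ((a $ i * - of_bool (j = k) + - of_bool (i = k) * a $ j) * (1 / (2 * \<tau>))) * g4))"
    unfolding jacobian_field_def vec_lambda_beta Leray_heat_kernel[OF assms] c_def[symmetric] E_def g4_def g6_def 24 .
  show ?thesis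
    unfolding p nse_kernel_def Let_def c c_def[symmetric] a_def[symmetric] E_def[symmetric] g4_def[symmetric] g6_def[symmetric]
    by (simp only: divide_inverse inverse_mult_distrib) (simp add: algebra_simps)
qed

text \<open>Turns the distributional expression into a convolution with the explicit kernel. Nothing
  is assumed about \<open>u\<close> and \<open>v\<close>: both sides are the same HOL integral,
  convergent or not.\<close>

lemma heat_convol_Leray_div_tensor:
  assumes "\<tau> > 0"
  shows "heat_convol_distr \<tau> (Leray_distr (div_tensor (tensor_prod u v))) x $ i =
    - (\<integral>y. (\<Sum>j\<in>UNIV. \<Sum>k\<in>UNIV. nse_kernel i j k \<tau> (x - y) * u y $ j * v y $ k) \<partial>lborel)"
  unfolding heat_convol_distr_def Leray_distr_def div_tensor_def vec_lambda_beta inner_vec_def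
    jacobian_Leray_heat_kernel[OF assms]
  by (simp add: tensor_prod_def ac_simps)

section \<open>Solenoidal fields in the sense of distributions\<close>

lemma test_function_differentiable: "test_function \<eta> \<Longrightarrow> \<eta> differentiable (at x)"
  unfolding test_function_def by (metis C_k.simps(2))

lemma test_function_has_derivative:
  "test_function \<eta> \<Longrightarrow> (\<eta> has_derivative frechet_derivative \<eta> (at x)) (at x)"
  by (rule iffD1[OF frechet_derivative_works test_function_differentiable])

lemma has_derivative_shift:
  fixes \<eta> :: "'a::real_normed_vector \<Rightarrow> 'b::real_normed_vector"
  assumes "(\<eta> has_derivative D) (at (h + x))"
  shows "((\<lambda>x. \<eta> (h + x)) has_derivative D) (at x)"
proof -
  have "((\<lambda>x. h + x) has_derivative (\<lambda>v. v)) (at x)" by (auto intro!: derivative_eq_intros)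
  from has_derivative_compose[OF this assms] show ?thesis .
qed

lemma test_function_continuous: "test_function \<eta> \<Longrightarrow> continuous_on UNIV \<eta>"
  unfolding test_function_def by (metis C_k.simps(1))

lemma test_function_partial_continuous: "test_function \<eta> \<Longrightarrow> continuous_on UNIV (partial k \<eta>)"
  unfolding test_function_def by (metis C_k.simps)

lemma partial_shift:
  assumes "\<And>x. \<eta> differentiable (at x)"
  shows "partial k (\<lambda>x. \<eta> (h + x)) = (\<lambda>x. partial k \<eta> (h + x))"
proof
  fix x
  have "((\<lambda>x. \<eta> (h + x)) has_derivative frechet_derivative \<eta> (at (h + x))) (at x)"
    by (rule has_derivative_shift[OF iffD1[OF frechet_derivative_works assms]])
  then show "partial k (\<lambda>x. \<eta> (h + x)) x = partial k \<eta> (h + x)"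
    by (simp add: partial_eqI partial_def[of k \<eta>])
qed

lemma C_k_shift: "C_k n \<eta> \<Longrightarrow> C_k n (\<lambda>x. \<eta> (h + x))"
proof (induction n arbitrary: \<eta>)
  case 0
  then show ?case by (auto intro!: continuous_intros continuous_on_compose2[of UNIV \<eta>])
next
  case (Suc n)
  have "(\<lambda>x. \<eta> (h + x)) differentiable (at x)" for x
    by (rule differentiableI[OF has_derivative_shift[OF iffD1[OF frechet_derivative_works]]]) (use Suc.prems in simp)
  then show ?case using Suc by (simp add: partial_shift)
qed

lemma test_function_shift:
  assumes "test_function \<eta>"
  shows "test_function (\<lambda>x. \<eta> (h + x))"
proof -
  have "{x. \<eta> (h + x) \<noteq> 0} = (\<lambda>x. - h + x) ` {x. \<eta> x \<noteq> 0}"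
  proof (intro set_eqI iffI)
    fix x assume "x \<in> {x. \<eta> (h + x) \<noteq> 0}"
    then show "x \<in> (\<lambda>x. - h + x) ` {x. \<eta> x \<noteq> 0}" by (intro image_eqI[of _ _ "h + x"]) auto
  qed auto
  then have "closure {x. \<eta> (h + x) \<noteq> 0} = (\<lambda>x. - h + x) ` closure {x. \<eta> x \<noteq> 0}"
    by (simp only: closure_translation)
  moreover have "compact ((\<lambda>x. - h + x) ` closure {x. \<eta> x \<noteq> 0})"
    using assms unfolding test_function_def by (intro compact_translation) simp
  ultimately show ?thesis
    using assms C_k_shift unfolding test_function_def by metis
qed

lemma gradient_shift: "test_function \<eta> \<Longrightarrow> gradient (\<lambda>x. \<eta> (h + x)) x = gradient \<eta> (h + x)"
  by (simp add: gradient_def partial_shift test_function_differentiable)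

lemma continuous_on_gradient: "test_function \<eta> \<Longrightarrow> continuous_on UNIV (gradient \<eta>)"
  unfolding gradient_def[abs_def]
  by (rule continuous_on_vec_lambda) (rule test_function_partial_continuous)

lemma measurable_gradient: "test_function \<eta> \<Longrightarrow> gradient \<eta> \<in> borel_measurable borel"
  using continuous_on_gradient by (rule borel_measurable_continuous_onI)

lemma test_function_outside:
  assumes "test_function \<eta>" "x \<notin> closure {x. \<eta> x \<noteq> 0}"
  shows "\<eta> x = 0" and "gradient \<eta> x = 0"
proof -
  have c: "y \<notin> closure {x. \<eta> x \<noteq> 0} \<Longrightarrow> \<eta> y = 0" for y
    using closure_subset[of "{x. \<eta> x \<noteq> 0}"] by blast
  show "\<eta> x = 0" by (rule c[OF assms(2)])
  have "eventually (\<lambda>y. y \<in> - closure {x. \<eta> x \<noteq> 0}) (nhds x)"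
    using assms(2) by (intro eventually_nhds_in_open) auto
  then have "eventually (\<lambda>y. 0 = \<eta> y) (nhds x)"
    by (rule eventually_mono) (rule c[symmetric], erule ComplD)
  then have "eventually (\<lambda>y. 0 = \<eta> y) (at x)"
    unfolding eventually_at_filter by (rule eventually_mono) simp
  then have "(\<eta> has_derivative (\<lambda>_. 0)) (at x)"
    by (rule has_derivative_transform_eventually[OF has_derivative_const]) (simp_all add: \<open>\<eta> x = 0\<close>)
  then have "partial k \<eta> x = 0" for k by (rule partial_eqI)
  then show "gradient \<eta> x = 0" by (simp add: gradient_def vec_eq_iff)
qed

lemma gradient_bounded:
  assumes "test_function \<eta>"
  shows "\<exists>B\<ge>0. \<forall>x. norm (gradient \<eta> x) \<le> B * indicator (closure {x. \<eta> x \<noteq> 0}) x"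
proof -
  let ?S = "closure {x. \<eta> x \<noteq> 0}"
  have "compact (gradient \<eta> ` ?S)"
    using assms continuous_on_subset[OF continuous_on_gradient[OF assms]]
    by (intro compact_continuous_image) (auto simp: test_function_def)
  then obtain B where B: "\<forall>v\<in>gradient \<eta> ` ?S. norm v \<le> B"
    using compact_imp_bounded bounded_iff by metis
  have "norm (gradient \<eta> x) \<le> max B 0 * indicator ?S x" for x
    using B test_function_outside[OF assms, of x] by (cases "x \<in> ?S") (auto simp: le_max_iff_disj)
  then show ?thesis by (intro exI[of _ "max B 0"]) auto
qed

text \<open>Hoelder against the indicator of \<open>S\<close>; a field in L^q can thus be paired
  with the bounded, compactly supported gradient of a test function.\<close>

lemma nn_integral_compact_finite:
  fixes h :: "real^3 \<Rightarrow> ennreal"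
  assumes q: "q > 1" and S: "compact S" and [measurable]: "h \<in> borel_measurable borel"
    and fin: "Lnorm lborel q h < top"
  shows "(\<integral>\<^sup>+x. h x * indicator S x \<partial>lborel) < top"
proof -
  define p where "p = q / (q - 1)"
  have p: "p > 1" "1 / q + 1 / p = 1" using q by (auto simp: p_def field_simps)
  have [measurable]: "S \<in> sets borel" using S by (simp add: borel_compact)
  have "ennpowr (indicator S x) p = indicator S x" for x
    using p by (auto simp: indicator_def ennpowr_def)
  then have "Lnorm lborel p (indicator S) = ennpowr (emeasure lborel S) (1 / p)"
    by (simp add: Lnorm_def)
  also have "\<dots> < top"
    using emeasure_compact_finite[OF S] by (simp add: less_top[symmetric])
  finally have "Lnorm lborel p (indicator S) < top" .
  then have "Lnorm lborel q h * Lnorm lborel p (indicator S) < top"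
    using fin by (simp add: ennreal_mult_less_top)
  moreover have "(\<integral>\<^sup>+x. h x * indicator S x \<partial>lborel) \<le> Lnorm lborel q h * Lnorm lborel p (indicator S)"
    using p q by (intro nn_integral_Hoelder) auto
  ultimately show ?thesis by (rule le_less_trans[rotated])
qed

lemma nn_integral_pairing_finite:
  fixes h :: "real^3 \<Rightarrow> ennreal"
  assumes q: "q > 1" and \<eta>: "test_function \<eta>" and [measurable]: "h \<in> borel_measurable borel"
    and fin: "Lnorm lborel q h < top"
  shows "(\<integral>\<^sup>+x. h x * ennreal (norm (gradient \<eta> x)) \<partial>lborel) < top"
proof -
  let ?S = "closure {x. \<eta> x \<noteq> 0}"
  have S: "compact ?S" using \<eta> by (simp add: test_function_def)
  then have [measurable]: "?S \<in> sets borel" by (simp add: borel_compact)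
  obtain B where B: "B \<ge> 0" "\<And>x. norm (gradient \<eta> x) \<le> B * indicator ?S x"
    using gradient_bounded[OF \<eta>] by auto
  have "(\<integral>\<^sup>+x. h x * ennreal (norm (gradient \<eta> x)) \<partial>lborel) \<le> (\<integral>\<^sup>+x. ennreal B * (h x * indicator ?S x) \<partial>lborel)"
  proof (intro nn_integral_mono)
    fix x
    have "ennreal (norm (gradient \<eta> x)) \<le> ennreal B * indicator ?S x"
      using B(2)[of x] ennreal_leI[OF B(2)[of x]] by (auto simp: indicator_def split: if_splits)
    from mult_left_mono[OF this, of "h x"]
    show "h x * ennreal (norm (gradient \<eta> x)) \<le> ennreal B * (h x * indicator ?S x)" by (simp add: ac_simps)
  qed
  also have "\<dots> = ennreal B * (\<integral>\<^sup>+x. h x * indicator ?S x \<partial>lborel)"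
    by (intro nn_integral_cmult) auto
  also have "\<dots> < top"
    using nn_integral_compact_finite[OF q S _ fin] by (simp add: ennreal_mult_less_top)
  finally show ?thesis .
qed

lemma integrable_pairing:
  fixes \<phi> :: "real^3 \<Rightarrow> real^3"
  assumes q: "q > 1" and \<eta>: "test_function \<eta>" and [measurable]: "\<phi> \<in> borel_measurable borel"
    and fin: "Lnorm lborel q (\<lambda>x. ennreal (norm (\<phi> x))) < top"
  shows "integrable lborel (\<lambda>x. \<phi> x \<bullet> gradient \<eta> x)"
proof (rule integrableI_bounded)
  have [measurable]: "gradient \<eta> \<in> borel_measurable borel" by (rule measurable_gradient[OF \<eta>])
  show "(\<lambda>x. \<phi> x \<bullet> gradient \<eta> x) \<in> borel_measurable lborel" by simp
  have "(\<integral>\<^sup>+x. ennreal (norm (\<phi> x \<bullet> gradient \<eta> x)) \<partial>lborel) \<le> (\<integral>\<^sup>+x. ennreal (norm (\<phi> x)) * ennreal (norm (gradient \<eta> x)) \<partial>lborel)"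
    by (intro nn_integral_mono) (auto simp: Cauchy_Schwarz_ineq2 ennreal_leI simp flip: ennreal_mult)
  also have "\<dots> < top" using q \<eta> fin by (intro nn_integral_pairing_finite) auto
  finally show "(\<integral>\<^sup>+x. ennreal (norm (\<phi> x \<bullet> gradient \<eta> x)) \<partial>lborel) < \<infinity>" by simp
qed

lemma div_free_cong_AE:
  assumes [measurable]: "\<phi> \<in> borel_measurable borel" "\<psi> \<in> borel_measurable borel"
    and eq: "AE x in lborel. \<phi> x = \<psi> x" and "div_free \<phi>"
  shows "div_free \<psi>"
  unfolding div_free_def
proof (intro allI impI)
  fix \<eta> assume \<eta>: "test_function \<eta>"
  have [measurable]: "gradient \<eta> \<in> borel_measurable borel" by (rule measurable_gradient[OF \<eta>])
  have "(\<integral>x. \<psi> x \<bullet> gradient \<eta> x \<partial>lborel) = (\<integral>x. \<phi> x \<bullet> gradient \<eta> x \<partial>lborel)"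
    using eq by (intro integral_cong_AE) auto
  then show "(\<integral>x. \<psi> x \<bullet> gradient \<eta> x \<partial>lborel) = 0"
    using \<open>div_free \<phi>\<close> \<eta> by (simp add: div_free_def)
qed

lemma div_free_zero [simp]: "div_free (\<lambda>_. 0)"
  by (simp add: div_free_def)

lemma div_free_add:
  assumes "q > 1" "\<phi> \<in> borel_measurable borel" "\<psi> \<in> borel_measurable borel"
    and "Lnorm lborel q (\<lambda>x. ennreal (norm (\<phi> x))) < top" "Lnorm lborel q (\<lambda>x. ennreal (norm (\<psi> x))) < top"
    and "div_free \<phi>" "div_free \<psi>"
  shows "div_free (\<lambda>x. \<phi> x + \<psi> x)"
  unfolding div_free_def
proof (intro allI impI)
  fix \<eta> assume \<eta>: "test_function \<eta>"
  have "(\<integral>x. (\<phi> x + \<psi> x) \<bullet> gradient \<eta> x \<partial>lborel) =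
      (\<integral>x. \<phi> x \<bullet> gradient \<eta> x \<partial>lborel) + (\<integral>x. \<psi> x \<bullet> gradient \<eta> x \<partial>lborel)"
    unfolding inner_add_left
    using assms \<eta> by (intro Bochner_Integration.integral_add integrable_pairing[of q]) auto
  then show "(\<integral>x. (\<phi> x + \<psi> x) \<bullet> gradient \<eta> x \<partial>lborel) = 0"
    using assms \<eta> by (simp add: div_free_def)
qed

lemma div_free_scaleR: "div_free \<phi> \<Longrightarrow> div_free (\<lambda>x. c *\<^sub>R \<phi> x)"
  by (auto simp: div_free_def)

lemma div_free_shift:
  assumes [measurable]: "\<phi> \<in> borel_measurable borel" and "div_free \<phi>"
  shows "div_free (\<lambda>x. \<phi> (x - h))"
  unfolding div_free_def
proof (intro allI impI)
  fix \<eta> assume \<eta>: "test_function \<eta>"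
  have [measurable]: "gradient \<eta> \<in> borel_measurable borel" by (rule measurable_gradient[OF \<eta>])
  have "(\<integral>x. \<phi> (x - h) \<bullet> gradient \<eta> x \<partial>lborel) = (\<integral>x. \<phi> (h + x - h) \<bullet> gradient \<eta> (h + x) \<partial>lborel)"
    by (rule lborel_integral_shift[symmetric]) measurable
  also have "\<dots> = (\<integral>x. \<phi> x \<bullet> gradient (\<lambda>x. \<eta> (h + x)) x \<partial>lborel)"
    using \<eta> by (simp add: gradient_shift)
  also have "\<dots> = 0"
    using \<open>div_free \<phi>\<close> test_function_shift[OF \<eta>] by (simp add: div_free_def)
  finally show "(\<integral>x. \<phi> (x - h) \<bullet> gradient \<eta> x \<partial>lborel) = 0" .
qed

text \<open>Superpositions of divergence-free fields are divergence free, by Fubini against the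
  gradient of a test function. The finiteness assumption is on the L^q norm of the integrated
  moduli, the quantity that the majorants control. The heat flow, the Duhamel term and the bilinear
  term are all handled this way.\<close>

lemma div_free_integral:
  fixes A :: "'a \<Rightarrow> real^3 \<Rightarrow> real^3"
  assumes M: "sigma_finite_measure M" and q: "q > 1"
    and [measurable]: "case_prod A \<in> borel_measurable (M \<Otimes>\<^sub>M lborel)"
    and df: "AE s in M. div_free (A s)"
    and fin: "Lnorm lborel q (\<lambda>x. \<integral>\<^sup>+s. ennreal (norm (A s x)) \<partial>M) < top"
  shows "div_free (\<lambda>x. \<integral>s. A s x \<partial>M)"
  unfolding div_free_def
proof (intro allI impI)
  fix \<eta> assume \<eta>: "test_function \<eta>"
  interpret M: sigma_finite_measure M by fact
  interpret P: pair_sigma_finite M "lborel :: (real^3) measure" ..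
  have [measurable]: "gradient \<eta> \<in> borel_measurable borel" by (rule measurable_gradient[OF \<eta>])
  have int: "integrable (M \<Otimes>\<^sub>M lborel) (\<lambda>(s, x). A s x \<bullet> gradient \<eta> x)"
  proof (rule integrableI_bounded)
    have "(\<integral>\<^sup>+z. ennreal (norm (case z of (s, x) \<Rightarrow> A s x \<bullet> gradient \<eta> x)) \<partial>(M \<Otimes>\<^sub>M lborel)) \<le>
        (\<integral>\<^sup>+z. (case z of (s, x) \<Rightarrow> ennreal (norm (A s x)) * ennreal (norm (gradient \<eta> x))) \<partial>(M \<Otimes>\<^sub>M lborel))"
      by (intro nn_integral_mono) (auto simp: Cauchy_Schwarz_ineq2 ennreal_leI simp flip: ennreal_mult split: prod.split)
    also have "\<dots> = (\<integral>\<^sup>+x. (\<integral>\<^sup>+s. ennreal (norm (A s x)) * ennreal (norm (gradient \<eta> x)) \<partial>M) \<partial>lborel)"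
      by (subst P.nn_integral_snd[symmetric]) auto
    also have "\<dots> = (\<integral>\<^sup>+x. (\<integral>\<^sup>+s. ennreal (norm (A s x)) \<partial>M) * ennreal (norm (gradient \<eta> x)) \<partial>lborel)"
      by (intro nn_integral_cong nn_integral_multc) measurable
    also have "\<dots> < top"
      using q \<eta> fin by (intro nn_integral_pairing_finite) auto
    finally show "(\<integral>\<^sup>+z. ennreal (norm (case z of (s, x) \<Rightarrow> A s x \<bullet> gradient \<eta> x)) \<partial>(M \<Otimes>\<^sub>M lborel)) < \<infinity>" by simp
  qed measurable
  \<comment> \<open>Pulling the inner product into the s-integral needs integrability in s, which
    holds for almost every x.\<close>
  have "AE x in lborel. (\<integral>\<^sup>+s. ennreal (norm (A s x)) \<partial>M) < top"
    using q fin by (intro Lnorm_finite_AE[of q]) auto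
  then have "AE x in lborel. (\<integral>s. A s x \<partial>M) \<bullet> gradient \<eta> x = (\<integral>s. A s x \<bullet> gradient \<eta> x \<partial>M)"
  proof eventually_elim
    case (elim x)
    then have "integrable M (\<lambda>s. A s x)"
      by (intro integrableI_bounded) auto
    then show ?case by simp
  qed
  then have "(\<integral>x. (\<integral>s. A s x \<partial>M) \<bullet> gradient \<eta> x \<partial>lborel) = (\<integral>x. (\<integral>s. A s x \<bullet> gradient \<eta> x \<partial>M) \<partial>lborel)"
    by (intro integral_cong_AE) measurable
  also have "\<dots> = (\<integral>s. (\<integral>x. A s x \<bullet> gradient \<eta> x \<partial>lborel) \<partial>M)"
    by (rule P.Fubini_integral[OF int])
  also have "\<dots> = (\<integral>s. 0 \<partial>M)"
    using df \<eta> by (intro integral_cong_AE) (auto simp: div_free_def)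
  finally show "(\<integral>x. (\<integral>s. A s x \<partial>M) \<bullet> gradient \<eta> x \<partial>lborel) = 0" by simp
qed

section \<open>A divergence theorem for compactly supported functions\<close>

lemma integrable_continuous_compact_support:
  fixes g :: "real^3 \<Rightarrow> real"
  assumes "continuous_on UNIV g" "compact S" "\<And>x. x \<notin> S \<Longrightarrow> g x = 0"
  shows "integrable lborel g"
proof -
  have "integrable lborel (\<lambda>x. indicator S x *\<^sub>R g x)"
    using assms by (intro borel_integrable_compact continuous_on_subset[OF assms(1)]) auto
  moreover have "(\<lambda>x. indicator S x *\<^sub>R g x) = g" using assms(3) by (intro ext) (auto split: split_indicator)
  ultimately show ?thesis by simp
qed

text \<open>The integral of the derivative equals its average over the translates by \<open>r e\<close>, \<open>0 \<le> r \<le> 1\<close>,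
  which by Fubini is the integral of \<open>G (e + x) - G x\<close>.\<close>

lemma integral_directional_derivative_eq_0:
  fixes G :: "real^3 \<Rightarrow> real"
  assumes G: "\<And>x. (G has_derivative G' x) (at x)"
    and cont: "continuous_on UNIV (\<lambda>x. G' x e)"
    and S: "compact S" "\<And>x. x \<notin> S \<Longrightarrow> G x = 0" "\<And>x. x \<notin> S \<Longrightarrow> G' x e = 0"
  shows "(\<integral>x. G' x e \<partial>lborel) = 0"
proof -
  let ?g = "\<lambda>x. G' x e"
  have g: "integrable lborel ?g" by (rule integrable_continuous_compact_support[OF cont S(1,3)])
  have "continuous_on UNIV G"
    using G has_derivative_continuous continuous_at_imp_continuous_on by blast
  then have iG: "integrable lborel G" by (rule integrable_continuous_compact_support[OF _ S(1,2)])
  have [measurable]: "?g \<in> borel_measurable borel" using cont by (rule borel_measurable_continuous_onI)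
  have [measurable]: "G \<in> borel_measurable borel" using iG by simp
  have ftc: "(\<integral>r. indicator {0..1} r * ?g (r *\<^sub>R e + x) \<partial>lborel) = G (e + x) - G x" for x
  proof -
    have d: "((\<lambda>r. G (r *\<^sub>R e + x)) has_real_derivative ?g (r *\<^sub>R e + x)) (at r)" for r
    proof -
      have "((\<lambda>r. r *\<^sub>R e + x) has_derivative (\<lambda>h. h *\<^sub>R e)) (at r)"
        by (auto intro!: derivative_eq_intros)
      from has_derivative_compose[OF this G]
      have "((\<lambda>r. G (r *\<^sub>R e + x)) has_derivative (\<lambda>h. G' (r *\<^sub>R e + x) (h *\<^sub>R e))) (at r)" .
      moreover have "G' y (h *\<^sub>R e) = h * G' y e" for h y
        using linear_scale[OF has_derivative_linear[OF G[of y]]] by simp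
      ultimately show ?thesis unfolding has_field_derivative_def
        by (elim has_derivative_eq_rhs) (simp add: fun_eq_iff)
    qed
    have "(\<integral>r. indicator {0..1} r *\<^sub>R ?g (r *\<^sub>R e + x) \<partial>lborel) = G (1 *\<^sub>R e + x) - G (0 *\<^sub>R e + x)"
    proof (rule integral_FTC_Icc)
      show "((\<lambda>r. G (r *\<^sub>R e + x)) has_vector_derivative ?g (r *\<^sub>R e + x)) (at r within {0..1})" for r
        unfolding has_real_derivative_iff_has_vector_derivative[symmetric]
        by (rule has_field_derivative_at_within[OF d])
      show "continuous_on {0..1} (\<lambda>r. ?g (r *\<^sub>R e + x))"
        by (rule continuous_on_compose2[OF cont]) (auto intro!: continuous_intros)
    qed auto
    then show ?thesis by simp
  qed
  have shift: "(\<integral>x. ?g (v + x) \<partial>lborel) = (\<integral>x. ?g x \<partial>lborel)" for v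
    by (rule lborel_integral_shift) simp
  have int: "integrable (lborel \<Otimes>\<^sub>M lborel) (\<lambda>(r, x). indicator {0..1} r * ?g (r *\<^sub>R e + x))"
  proof (rule integrableI_bounded)
    have "(\<integral>\<^sup>+z. ennreal (norm (case z of (r, x) \<Rightarrow> indicator {0..1} r * ?g (r *\<^sub>R e + x))) \<partial>(lborel \<Otimes>\<^sub>M lborel)) =
        (\<integral>\<^sup>+r. (\<integral>\<^sup>+x. indicator {0..1} r * ennreal (norm (?g (r *\<^sub>R e + x))) \<partial>lborel) \<partial>(lborel::real measure))"
      by (subst lborel.nn_integral_fst[symmetric]) (auto simp: abs_mult ennreal_mult' ennreal_indicator intro!: nn_integral_cong)
    also have "\<dots> = (\<integral>\<^sup>+r. indicator {0..1} r * (\<integral>\<^sup>+x. ennreal (norm (?g x)) \<partial>lborel) \<partial>(lborel::real measure))"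
    proof (intro nn_integral_cong)
      fix r :: real
      have "(\<integral>\<^sup>+x. ennreal (norm (?g (r *\<^sub>R e + x))) \<partial>lborel) = (\<integral>\<^sup>+x. ennreal (norm (?g x)) \<partial>lborel)"
        by (rule nn_integral_lborel_shift) measurable
      then show "(\<integral>\<^sup>+x. indicator {0..1} r * ennreal (norm (?g (r *\<^sub>R e + x))) \<partial>lborel) =
          indicator {0..1} r * (\<integral>\<^sup>+x. ennreal (norm (?g x)) \<partial>lborel)"
        by (subst nn_integral_cmult) simp_all
    qed
    also have "\<dots> = (\<integral>\<^sup>+x. ennreal (norm (?g x)) \<partial>lborel)"
      by (subst nn_integral_multc) simp_all
    also have "\<dots> < \<infinity>" using g by (simp add: integrable_iff_bounded)
    finally show "(\<integral>\<^sup>+z. ennreal (norm (case z of (r, x) \<Rightarrow> indicator {0..1} r * ?g (r *\<^sub>R e + x))) \<partial>(lborel \<Otimes>\<^sub>M lborel)) < \<infinity>" .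
  qed measurable
  have "(\<integral>x. ?g x \<partial>lborel) = (\<integral>r. indicator {0..1::real} r * (\<integral>x. ?g x \<partial>lborel) \<partial>lborel)"
    by simp
  also have "\<dots> = (\<integral>r. (\<integral>x. indicator {0..1} r * ?g (r *\<^sub>R e + x) \<partial>lborel) \<partial>lborel)"
    by (simp add: shift)
  also have "\<dots> = (\<integral>x. (\<integral>r. indicator {0..1} r * ?g (r *\<^sub>R e + x) \<partial>lborel) \<partial>lborel)"
    by (rule lborel_pair.Fubini_integral[OF int, symmetric])
  also have "\<dots> = (\<integral>x. G (e + x) \<partial>lborel) - (\<integral>x. G x \<partial>lborel)"
  proof -
    have "integrable lborel (\<lambda>x. G (e + x))"
      using iG by (subst (asm) lborel_distr_plus[of e, symmetric]) (simp add: integrable_distr_eq)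
    then show ?thesis unfolding ftc using iG by simp
  qed
  also have "\<dots> = 0" using lborel_integral_shift[of G e] by simp
  finally show ?thesis .
qed

text \<open>Product rule: the field \<eta> V has divergence V . grad \<eta> + \<eta> div V, whose
  last term vanishes, and each of its diagonal derivatives integrates to 0.\<close>

lemma div_free_classical:
  fixes V :: "real^3 \<Rightarrow> real^3"
  assumes V: "\<And>i x. ((\<lambda>x. V x $ i) has_derivative D i x) (at x)"
    and cont: "\<And>i. continuous_on UNIV (\<lambda>x. D i x (axis i 1))"
    and zero: "\<And>x. (\<Sum>i\<in>UNIV. D i x (axis i 1)) = 0"
  shows "div_free V"
  unfolding div_free_def
proof (intro allI impI)
  fix \<eta> assume \<eta>: "test_function \<eta>"
  let ?S = "closure {x. \<eta> x \<noteq> 0}"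
  have S: "compact ?S" using \<eta> by (simp add: test_function_def)
  define W where "W i x h = V x $ i * frechet_derivative \<eta> (at x) h + D i x h * \<eta> x" for i x h
  have W: "((\<lambda>x. V x $ i * \<eta> x) has_derivative W i x) (at x)" for i x
    unfolding W_def by (intro has_derivative_mult V test_function_has_derivative \<eta>)
  have We: "W i x (axis i 1) = V x $ i * gradient \<eta> x $ i + D i x (axis i 1) * \<eta> x" for i x
    by (simp add: W_def gradient_def partial_def)
  have cV: "continuous_on UNIV (\<lambda>x. V x $ i)" for i
    by (intro continuous_at_imp_continuous_on ballI has_derivative_continuous[OF V])
  have cW: "continuous_on UNIV (\<lambda>x. W i x (axis i 1))" for i
    unfolding We
    by (intro continuous_intros cV cont test_function_continuous[OF \<eta>] continuous_on_gradient[OF \<eta>])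
  have W0: "W i x (axis i 1) = 0" if "x \<notin> ?S" for i x
    unfolding We using test_function_outside[OF \<eta> that] by simp
  have "(\<integral>x. V x \<bullet> gradient \<eta> x \<partial>lborel) = (\<integral>x. (\<Sum>i\<in>UNIV. W i x (axis i 1)) \<partial>lborel)"
    unfolding We sum.distrib sum_distrib_right[symmetric] zero by (simp add: inner_vec_def)
  also have "\<dots> = (\<Sum>i\<in>UNIV. \<integral>x. W i x (axis i 1) \<partial>lborel)"
    by (intro Bochner_Integration.integral_sum integrable_continuous_compact_support[OF cW S W0])
  also have "\<dots> = 0"
  proof (intro sum.neutral ballI)
    fix i :: 3
    show "(\<integral>x. W i x (axis i 1) \<partial>lborel) = 0"
    proof (rule integral_directional_derivative_eq_0[of "\<lambda>x. V x $ i * \<eta> x" "W i"])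
      show "V x $ i * \<eta> x = 0" if "x \<notin> ?S" for x
        unfolding test_function_outside(1)[OF \<eta> that] by simp
    qed (fact W cW S W0)+
  qed
  finally show "(\<integral>x. V x \<bullet> gradient \<eta> x \<partial>lborel) = 0" .
qed

section \<open>The bilinear term\<close>

lemma continuous_on_gauss_mom [continuous_intros]:
  assumes "continuous_on S f"
  shows "continuous_on S (\<lambda>x. gauss_mom n (f x))"
proof -
  have "continuous_on UNIV (gauss_mom n)"
    by (intro continuous_at_imp_continuous_on ballI DERIV_isCont[OF DERIV_gauss_mom])
  from continuous_on_compose2[OF this assms] show ?thesis by simp
qed

lemma measurable_gauss_mom [measurable]: "gauss_mom n \<in> borel_measurable borel"
  by (intro borel_measurable_continuous_onI continuous_on_gauss_mom continuous_on_id)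

lemma measurable_nse_kernel [measurable (raw)]:
  assumes [measurable]: "f \<in> borel_measurable M" "g \<in> borel_measurable M"
  shows "(\<lambda>x. nse_kernel i j k (f x) (g x)) \<in> borel_measurable M"
  unfolding nse_kernel_def Let_def
  by (intro borel_measurable_times borel_measurable_add borel_measurable_diff borel_measurable_divide
    borel_measurable_uminus borel_measurable_const borel_measurable_inner powr_real_measurable
    measurable_vec_nth' measurable_compose[OF _ measurable_gauss_mom] measurable_compose[OF _ borel_measurable_exp] assms)

text \<open>The minus sign is the one in \<open>div_tensor\<close>; with it, \<open>bilin\<close> is
  precisely the term that the integral equation subtracts.\<close>

definition nse_apply :: "real \<Rightarrow> real^3 \<Rightarrow> real^3 \<Rightarrow> real^3 \<Rightarrow> real^3" where
  "nse_apply \<tau> z a b = (\<chi> i. - (\<Sum>j\<in>UNIV. \<Sum>k\<in>UNIV. nse_kernel i j k \<tau> z * a $ j * b $ k))"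

lemma measurable_vec_lambda:
  fixes f :: "'a \<Rightarrow> 'n::finite \<Rightarrow> real"
  assumes "\<And>i. (\<lambda>x. f x i) \<in> borel_measurable M"
  shows "(\<lambda>x. \<chi> i. f x i) \<in> borel_measurable M"
proof -
  have "(\<chi> i. f x i) = (\<Sum>i\<in>UNIV. f x i *\<^sub>R axis i 1)" for x
    by (simp add: vec_eq_iff axis_def of_bool_def if_distrib cong: if_cong)
  then show ?thesis using assms by simp
qed

lemma measurable_nse_apply [measurable (raw)]:
  assumes [measurable]: "f \<in> borel_measurable M" "g \<in> borel_measurable M" "h \<in> borel_measurable M" "h' \<in> borel_measurable M"
  shows "(\<lambda>x. nse_apply (f x) (g x) (h x) (h' x)) \<in> borel_measurable M"
  unfolding nse_apply_def by (rule measurable_vec_lambda) measurable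

lemma nse_apply_bound:
  "\<exists>C>0. \<forall>\<tau>>0. \<forall>z a b. norm (nse_apply \<tau> z a b) \<le> C * (decay_kernel \<tau> z * norm a * norm b)"
proof -
  obtain C where C: "C > 0" "\<And>\<tau> i j k a. \<tau> > 0 \<Longrightarrow> \<bar>nse_kernel i j k \<tau> a\<bar> \<le> C * decay_kernel \<tau> a"
    using nse_kernel_bound by (elim exE conjE) metis
  have "norm (nse_apply \<tau> z a b) \<le> 27 * C * (decay_kernel \<tau> z * norm a * norm b)" if \<tau>: "\<tau> > 0" for \<tau> z a b
  proof -
    let ?B = "C * (decay_kernel \<tau> z * norm a * norm b)"
    have 1: "\<bar>nse_kernel i j k \<tau> z * a $ j * b $ k\<bar> \<le> ?B" for i j k
    proof -
      have "\<bar>nse_kernel i j k \<tau> z\<bar> * \<bar>a $ j\<bar> * \<bar>b $ k\<bar> \<le> (C * decay_kernel \<tau> z) * norm a * norm b"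
        using C \<tau> component_le_norm_cart[of a j] component_le_norm_cart[of b k]
        by (intro mult_mono) auto
      then show ?thesis by (simp add: abs_mult ac_simps)
    qed
    have 2: "\<bar>\<Sum>j\<in>UNIV. \<Sum>k\<in>UNIV. nse_kernel i j k \<tau> z * a $ j * b $ k\<bar> \<le> 9 * ?B" for i
    proof -
      have "\<bar>\<Sum>j\<in>UNIV. \<Sum>k\<in>UNIV. nse_kernel i j k \<tau> z * a $ j * b $ k\<bar> \<le> (\<Sum>j\<in>(UNIV::3 set). \<Sum>k\<in>(UNIV::3 set). ?B)"
        by (intro order_trans[OF sum_abs] sum_mono 1)
      then show ?thesis by simp
    qed
    have "norm (nse_apply \<tau> z a b) \<le> (\<Sum>i\<in>UNIV. \<bar>nse_apply \<tau> z a b $ i\<bar>)"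
      by (rule norm_le_l1_cart)
    also have "\<dots> \<le> (\<Sum>i\<in>(UNIV::3 set). 9 * ?B)"
      using 2 by (intro sum_mono) (simp add: nse_apply_def)
    finally show ?thesis by simp
  qed
  then show ?thesis using C(1) by (intro exI[of _ "27 * C"]) auto
qed

lemma nse_apply_diff:
  "nse_apply \<tau> z a a - nse_apply \<tau> z b b = nse_apply \<tau> z (a - b) a + nse_apply \<tau> z b (a - b)"
proof (subst vec_eq_iff, rule allI)
  fix i
  have "K * a $ j * a $ k - K * b $ j * b $ k = K * (a - b) $ j * a $ k + K * b $ j * (a - b) $ k" for K j k
    by (simp add: algebra_simps)
  then show "(nse_apply \<tau> z a a - nse_apply \<tau> z b b) $ i = (nse_apply \<tau> z (a - b) a + nse_apply \<tau> z b (a - b)) $ i"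
    unfolding nse_apply_def vector_minus_component[of "vec_lambda _"] vector_add_component vec_lambda_beta
      minus_add_distrib[symmetric] minus_diff_minus sum_subtractf[symmetric] sum.distrib[symmetric]
    by (simp only:)
qed

text \<open>The kernel is smooth for \<tau> > 0, so its classical divergence decides; shifting by y
  keeps the property.\<close>

lemma nse_apply_div_free:
  assumes \<tau>: "\<tau> > 0"
  shows "div_free (\<lambda>x. nse_apply \<tau> (x - y) a b)"
proof -
  let ?D = "\<lambda>i x h. - (\<Sum>j\<in>UNIV. \<Sum>k\<in>UNIV. nse_kernel_deriv i j k \<tau> x h * a $ j * b $ k)"
  have "div_free (\<lambda>x. nse_apply \<tau> x a b)"
  proof (rule div_free_classical[where D="?D"])
    show "((\<lambda>x. nse_apply \<tau> x a b $ i) has_derivative ?D i x) (at x)" for i x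
      unfolding nse_apply_def vec_lambda_beta
      by (intro has_derivative_minus has_derivative_sum has_derivative_mult_left nse_kernel_has_derivative \<tau>)
    have "continuous_on UNIV (\<lambda>x. nse_kernel_deriv i j k \<tau> x h)" for i j k h
      unfolding nse_kernel_deriv_def Let_def using \<tau> by (intro continuous_intros) auto
    then show "continuous_on UNIV (\<lambda>x. ?D i x (axis i 1))" for i
      by (intro continuous_intros)
    show "(\<Sum>i\<in>UNIV. ?D i x (axis i 1)) = 0" for x
    proof -
      have "(\<Sum>i\<in>UNIV. ?D i x (axis i 1)) = - (\<Sum>j\<in>UNIV. \<Sum>k\<in>UNIV. (\<Sum>i\<in>UNIV. nse_kernel_deriv i j k \<tau> x (axis i 1)) * a $ j * b $ k)"
        unfolding sum_negf sum_distrib_right neg_equal_iff_equal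
        by (subst sum.swap, rule sum.cong, rule refl, rule sum.swap)
      then show ?thesis by (simp add: nse_kernel_div_free[OF \<tau>])
    qed
  qed
  moreover have "(\<lambda>x. nse_apply \<tau> x a b) \<in> borel_measurable borel" by measurable
  ultimately show ?thesis by (intro div_free_shift)
qed

text \<open>A divergent Bochner integral has the value 0, so the bound needs no
  integrability.\<close>

lemma norm_integral_le_nn_integral:
  fixes f :: "'a \<Rightarrow> 'b::{banach, second_countable_topology}"
  shows "ennreal (norm (\<integral>x. f x \<partial>M)) \<le> (\<integral>\<^sup>+x. ennreal (norm (f x)) \<partial>M)"
proof (cases "integrable M f")
  case True
  then show ?thesis by (rule integral_norm_bound_ennreal)
next
  case False
  then show ?thesis by (simp add: not_integrable_integral_eq)
qed

text \<open>The right endpoint is excluded so that t - s > 0 wherever the indicator is nonzero, as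
  the kernel bounds require.\<close>

definition bilin_integrand ::
  "(real \<Rightarrow> real^3 \<Rightarrow> real^3) \<Rightarrow> (real \<Rightarrow> real^3 \<Rightarrow> real^3) \<Rightarrow> real \<Rightarrow> real^3 \<Rightarrow> real \<Rightarrow> real^3 \<Rightarrow> real^3" where
  "bilin_integrand u v t x s y = indicator {0..<t} s *\<^sub>R nse_apply (t - s) (x - y) (u s y) (v s y)"

text \<open>One integral over space-time instead of an iterated one, so that (s, y) is a single
  parameter with one integrability condition.\<close>

definition bilin :: "(real \<Rightarrow> real^3 \<Rightarrow> real^3) \<Rightarrow> (real \<Rightarrow> real^3 \<Rightarrow> real^3) \<Rightarrow> real \<Rightarrow> real^3 \<Rightarrow> real^3" where
  "bilin u v t x = (\<integral>(s, y). bilin_integrand u v t x s y \<partial>(lborel \<Otimes>\<^sub>M lborel))"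

text \<open>The two arguments need not be norms of the same field: differences are estimated with |u
  - v| in one slot and |u| + |v| in the other.\<close>

definition bilin_maj :: "(real \<Rightarrow> real^3 \<Rightarrow> ennreal) \<Rightarrow> (real \<Rightarrow> real^3 \<Rightarrow> ennreal) \<Rightarrow> real \<Rightarrow> real^3 \<Rightarrow> ennreal" where
  "bilin_maj a b t x =
     (\<integral>\<^sup>+s. indicator {0..<t} s * (\<integral>\<^sup>+y. ennreal (decay_kernel (t - s) (x - y)) * a s y * b s y \<partial>lborel) \<partial>lborel)"

abbreviation nrm :: "(real \<Rightarrow> real^3 \<Rightarrow> real^3) \<Rightarrow> real \<Rightarrow> real^3 \<Rightarrow> ennreal" where
  "nrm u s y \<equiv> ennreal (norm (u s y))"

lemma measurable_bilin_integrand [measurable (raw)]: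
  assumes [measurable]: "joint_borel u" "joint_borel v"
    "T \<in> borel_measurable M" "X \<in> borel_measurable M" "S \<in> borel_measurable M" "Y \<in> borel_measurable M"
  shows "(\<lambda>w. bilin_integrand u v (T w) (X w) (S w) (Y w)) \<in> borel_measurable M"
proof -
  have "(\<lambda>w. bilin_integrand u v (T w) (X w) (S w) (Y w)) =
     (\<lambda>w. if 0 \<le> S w \<and> S w < T w then nse_apply (T w - S w) (X w - Y w) (u (S w) (Y w)) (v (S w) (Y w)) else 0)"
    by (auto simp: bilin_integrand_def fun_eq_iff)
  also have "\<dots> \<in> borel_measurable M" by measurable
  finally show ?thesis .
qed

lemma measurable_bilin [measurable]:
  assumes [measurable]: "joint_borel u" "joint_borel v"
  shows "joint_borel (bilin u v)"
  unfolding bilin_def[abs_def] by measurable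

lemma measurable_bilin_maj [measurable]:
  assumes [measurable]: "joint_borel a" "joint_borel b"
  shows "joint_borel (bilin_maj a b)"
proof -
  have "bilin_maj a b t x = (\<integral>\<^sup>+s. (if 0 \<le> s \<and> s < t then (\<integral>\<^sup>+y. ennreal (decay_kernel (t - s) (x - y)) * a s y * b s y \<partial>lborel) else 0) \<partial>lborel)" for t x
    unfolding bilin_maj_def by (intro nn_integral_cong) auto
  then have "case_prod (bilin_maj a b) = (\<lambda>(t, x). (\<integral>\<^sup>+s. (if 0 \<le> s \<and> s < t then (\<integral>\<^sup>+y. ennreal (decay_kernel (t - s) (x - y)) * a s y * b s y \<partial>lborel) else 0) \<partial>lborel))"
    by auto
  then show ?thesis by simp
qed

text \<open>Selected once, so that all bilinear estimates and the final choice of \<open>T\<close>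
  share the same constant.\<close>

definition nse_bd :: real where
  "nse_bd = (SOME C. C > 0 \<and> (\<forall>\<tau>>0. \<forall>z a b. norm (nse_apply \<tau> z a b) \<le> C * (decay_kernel \<tau> z * norm a * norm b)))"

lemma nse_bd: "nse_bd > 0" "\<tau> > 0 \<Longrightarrow> norm (nse_apply \<tau> z a b) \<le> nse_bd * (decay_kernel \<tau> z * norm a * norm b)"
  using someI_ex[OF nse_apply_bound] unfolding nse_bd_def[symmetric] by auto

lemma nn_integral_bilin_maj:
  fixes w :: "real \<Rightarrow> real^3 \<Rightarrow> real^3"
  assumes [measurable]: "joint_borel a" "joint_borel b"
    "joint_borel w"
    and w: "\<And>s y. ennreal (norm (w s y)) \<le> ennreal nse_bd * (indicator {0..<t} s * (ennreal (decay_kernel (t - s) (x - y)) * a s y * b s y))"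
  shows "(\<integral>\<^sup>+(s, y). ennreal (norm (w s y)) \<partial>(lborel \<Otimes>\<^sub>M lborel)) \<le> ennreal nse_bd * bilin_maj a b t x"
proof -
  have "(\<integral>\<^sup>+(s, y). ennreal (norm (w s y)) \<partial>(lborel \<Otimes>\<^sub>M lborel)) =
     (\<integral>\<^sup>+s. (\<integral>\<^sup>+y. ennreal (norm (w s y)) \<partial>lborel) \<partial>lborel)"
    by (subst lborel.nn_integral_fst[symmetric]) auto
  also have "\<dots> \<le> (\<integral>\<^sup>+s. (\<integral>\<^sup>+y. ennreal nse_bd * (indicator {0..<t} s * (ennreal (decay_kernel (t - s) (x - y)) * a s y * b s y)) \<partial>lborel) \<partial>lborel)"
    by (intro nn_integral_mono w)
  also have "\<dots> = ennreal nse_bd * bilin_maj a b t x"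
    unfolding bilin_maj_def by (simp add: nn_integral_cmult)
  finally show ?thesis .
qed

lemma bilin_integrand_le:
  "ennreal (norm (bilin_integrand u v t x s y)) \<le>
     ennreal nse_bd * (indicator {0..<t} s * (ennreal (decay_kernel (t - s) (x - y)) * nrm u s y * nrm v s y))"
proof (cases "s \<in> {0..<t}")
  case True
  then have "ennreal (norm (bilin_integrand u v t x s y)) \<le> ennreal (nse_bd * (decay_kernel (t - s) (x - y) * norm (u s y) * norm (v s y)))"
    using nse_bd(2)[of "t - s"] by (intro ennreal_leI) (simp add: bilin_integrand_def)
  also have "\<dots> = ennreal nse_bd * (ennreal (decay_kernel (t - s) (x - y)) * nrm u s y * nrm v s y)"
    using nse_bd(1) by (simp add: ennreal_mult)
  finally show ?thesis using True by simp
qed (simp add: bilin_integrand_def)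

lemma nn_integral_bilin_integrand:
  assumes [measurable]: "joint_borel u" "joint_borel v"
  shows "(\<integral>\<^sup>+(s, y). ennreal (norm (bilin_integrand u v t x s y)) \<partial>(lborel \<Otimes>\<^sub>M lborel))
    \<le> ennreal nse_bd * bilin_maj (nrm u) (nrm v) t x"
  by (rule nn_integral_bilin_maj) (measurable, rule bilin_integrand_le)

lemma bilin_norm_le:
  assumes [measurable]: "joint_borel u" "joint_borel v"
  shows "nrm (bilin u v) t x \<le> ennreal nse_bd * bilin_maj (nrm u) (nrm v) t x"
  unfolding bilin_def
  using norm_integral_le_nn_integral[of "lborel \<Otimes>\<^sub>M lborel" "\<lambda>(s, y). bilin_integrand u v t x s y"]
    nn_integral_bilin_integrand[OF assms, of t x]
  by (auto simp: split_beta' intro: order_trans)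

lemma integrable_bilin_integrand:
  assumes [measurable]: "joint_borel u" "joint_borel v"
    and fin: "bilin_maj (nrm u) (nrm v) t x < top"
  shows "integrable (lborel \<Otimes>\<^sub>M lborel) (\<lambda>(s, y). bilin_integrand u v t x s y)"
proof (rule integrableI_bounded)
  have "(\<integral>\<^sup>+z. ennreal (norm (case z of (s, y) \<Rightarrow> bilin_integrand u v t x s y)) \<partial>(lborel \<Otimes>\<^sub>M lborel)) \<le> ennreal nse_bd * bilin_maj (nrm u) (nrm v) t x"
    using nn_integral_bilin_integrand[of u v t x] assms by (simp add: split_beta')
  also have "\<dots> < top" using fin by (simp add: ennreal_mult_less_top)
  finally show "(\<integral>\<^sup>+z. ennreal (norm (case z of (s, y) \<Rightarrow> bilin_integrand u v t x s y)) \<partial>(lborel \<Otimes>\<^sub>M lborel)) < \<infinity>" by simp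
qed measurable

text \<open>Finite majorants allow the two integrals to be merged into one. The integrand then
  splits by \<open>nse_apply_diff\<close>, and each piece carries the factor |u - v|.\<close>

lemma bilin_diff_le:
  assumes [measurable]: "joint_borel u" "joint_borel v"
    and fin: "bilin_maj (nrm u) (nrm u) t x < top" "bilin_maj (nrm v) (nrm v) t x < top"
  shows "ennreal (norm (bilin u u t x - bilin v v t x)) \<le>
    ennreal nse_bd * bilin_maj (\<lambda>s y. ennreal (norm (u s y - v s y))) (\<lambda>s y. nrm u s y + nrm v s y) t x"
proof -
  let ?w = "\<lambda>s y. bilin_integrand u u t x s y - bilin_integrand v v t x s y"
  have le: "ennreal (norm (?w s y)) \<le> ennreal nse_bd * (indicator {0..<t} s *
      (ennreal (decay_kernel (t - s) (x - y)) * ennreal (norm (u s y - v s y)) * (nrm u s y + nrm v s y)))" for s y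
  proof (cases "s \<in> {0..<t}")
    case True
    let ?a = "u s y" and ?b = "v s y" and ?k = "decay_kernel (t - s) (x - y)"
    have "norm (?w s y) = norm (nse_apply (t - s) (x - y) (?a - ?b) ?a + nse_apply (t - s) (x - y) ?b (?a - ?b))"
      using True by (simp add: bilin_integrand_def nse_apply_diff)
    also have "\<dots> \<le> nse_bd * (?k * norm (?a - ?b) * norm ?a) + nse_bd * (?k * norm ?b * norm (?a - ?b))"
      using True by (intro norm_triangle_mono nse_bd(2)) auto
    also have "\<dots> = nse_bd * (?k * norm (?a - ?b) * (norm ?a + norm ?b))" by (simp add: algebra_simps)
    finally have "ennreal (norm (?w s y)) \<le> ennreal (nse_bd * (?k * norm (?a - ?b) * (norm ?a + norm ?b)))"
      by (rule ennreal_leI)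
    also have "\<dots> = ennreal nse_bd * (ennreal ?k * ennreal (norm (?a - ?b)) * (nrm u s y + nrm v s y))"
      using nse_bd(1) by (simp add: ennreal_mult)
    finally show ?thesis using True by simp
  qed (simp add: bilin_integrand_def)
  have "bilin u u t x - bilin v v t x = (\<integral>(s, y). ?w s y \<partial>(lborel \<Otimes>\<^sub>M lborel))"
    unfolding bilin_def split_beta'
    using integrable_bilin_integrand[OF assms(1,1) fin(1)] integrable_bilin_integrand[OF assms(2,2) fin(2)]
    by (subst Bochner_Integration.integral_diff) (simp_all add: split_beta')
  then have "ennreal (norm (bilin u u t x - bilin v v t x)) \<le> (\<integral>\<^sup>+(s, y). ennreal (norm (?w s y)) \<partial>(lborel \<Otimes>\<^sub>M lborel))"
    using norm_integral_le_nn_integral[of "lborel \<Otimes>\<^sub>M lborel" "\<lambda>(s, y). ?w s y"] by (simp add: split_beta')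
  also have "\<dots> \<le> ennreal nse_bd * bilin_maj (\<lambda>s y. ennreal (norm (u s y - v s y))) (\<lambda>s y. nrm u s y + nrm v s y) t x"
    by (rule nn_integral_bilin_maj) (measurable, rule le)
  finally show ?thesis .
qed

text \<open>For fixed (s, y) the integrand is a combination of columns of the kernel centred at y,
  which is divergence free; integrating over (s, y) keeps this.\<close>

lemma bilin_div_free:
  assumes q: "q > 1" and [measurable]: "joint_borel u" "joint_borel v"
    and fin: "Lnorm lborel q (bilin_maj (nrm u) (nrm v) t) < top"
  shows "div_free (bilin u v t)"
proof -
  have maj: "bilin_maj (nrm u) (nrm v) t \<in> borel_measurable borel"
  proof -
    have "(\<lambda>x. case_prod (bilin_maj (nrm u) (nrm v)) (t, x)) \<in> borel_measurable borel" by measurable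
    then show ?thesis by simp
  qed
  have "div_free (\<lambda>x. \<integral>z. (\<lambda>z x. bilin_integrand u v t x (fst z) (snd z)) z x \<partial>(lborel \<Otimes>\<^sub>M lborel))"
  proof (rule div_free_integral[OF sigma_finite_pair_measure[OF sigma_finite_lborel sigma_finite_lborel] q])
    show "(\<lambda>(z, x). bilin_integrand u v t x (fst z) (snd z)) \<in> borel_measurable ((lborel \<Otimes>\<^sub>M lborel) \<Otimes>\<^sub>M lborel)"
      by measurable
    show "AE z in lborel \<Otimes>\<^sub>M lborel. div_free (\<lambda>x. bilin_integrand u v t x (fst z) (snd z))"
    proof (rule AE_I2)
      fix z :: "real \<times> (real^3)"
      show "div_free (\<lambda>x. bilin_integrand u v t x (fst z) (snd z))"
        unfolding bilin_integrand_def
        by (cases "fst z \<in> {0..<t}") (auto intro!: nse_apply_div_free)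
    qed
    have "Lnorm lborel q (\<lambda>x. \<integral>\<^sup>+z. ennreal (norm (bilin_integrand u v t x (fst z) (snd z))) \<partial>(lborel \<Otimes>\<^sub>M lborel))
        \<le> Lnorm lborel q (\<lambda>x. ennreal nse_bd * bilin_maj (nrm u) (nrm v) t x)"
      using q nn_integral_bilin_integrand[of u v t] assms(2,3) by (intro Lnorm_mono) (auto simp: split_beta')
    also have "\<dots> = ennreal nse_bd * Lnorm lborel q (bilin_maj (nrm u) (nrm v) t)"
      using q maj by (intro Lnorm_cmult) auto
    also have "\<dots> < top" using fin by (simp add: ennreal_mult_less_top)
    finally show "Lnorm lborel q (\<lambda>x. \<integral>\<^sup>+z. ennreal (norm (bilin_integrand u v t x (fst z) (snd z))) \<partial>(lborel \<Otimes>\<^sub>M lborel)) < top" .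
  qed
  then show ?thesis by (simp add: bilin_def[abs_def] split_beta')
qed

text \<open>Minkowski moves the norm inside the s-integral, and at fixed s
  \<open>Lnorm_convolution_mult_le\<close> applies.\<close>

lemma Lnorm_bilin_maj:
  assumes q: "q > 3"
  shows "\<exists>C>0. \<forall>a b t. joint_borel a \<longrightarrow> joint_borel b \<longrightarrow>
     Lnorm lborel q (bilin_maj a b t) \<le>
       (\<integral>\<^sup>+s. indicator {0..<t} s * (ennreal (C * (t - s) powr (- (1/2 + 3 / (2 * q)))) * Lnorm lborel q (a s) * Lnorm lborel q (b s)) \<partial>lborel)"
proof -
  \<comment> \<open>The exponent conjugate to q; with it the power 3 / (2 r) - 2 of the kernel norm
    becomes - (1/2 + 3 / (2 q)).\<close>
  define r where "r = q / (q - 1)"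
  have r: "r \<ge> 1" "3 / (2 * r) - 2 = - (1/2 + 3 / (2 * q))" using q by (auto simp: r_def field_simps)
  from Lnorm_decay_kernel[OF r(1)] obtain C where C: "C > 0"
    "\<And>\<tau>. \<tau> > 0 \<Longrightarrow> Lnorm lborel r (\<lambda>z. ennreal (decay_kernel \<tau> z)) \<le> ennreal (C * \<tau> powr (- (1/2 + 3 / (2 * q))))"
    unfolding r(2) by (elim exE conjE) metis
  have "Lnorm lborel q (bilin_maj a b t) \<le>
       (\<integral>\<^sup>+s. indicator {0..<t} s * (ennreal (C * (t - s) powr (- (1/2 + 3 / (2 * q)))) * Lnorm lborel q (a s) * Lnorm lborel q (b s)) \<partial>lborel)"
    if [measurable]: "joint_borel a" "joint_borel b" for a b t
  proof -
    let ?A = "\<lambda>s x. \<integral>\<^sup>+y. ennreal (decay_kernel (t - s) (x - y)) * a s y * b s y \<partial>lborel"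
    have "Lnorm lborel q (\<lambda>x. \<integral>\<^sup>+s. indicator {0..<t} s * ?A s x \<partial>lborel) \<le> (\<integral>\<^sup>+s. Lnorm lborel q (\<lambda>x. indicator {0..<t} s * ?A s x) \<partial>lborel)"
      using q by (intro Lnorm_integral_le) (auto intro: sigma_finite_lborel)
    also have "\<dots> = (\<integral>\<^sup>+s. indicator {0..<t} s * Lnorm lborel q (?A s) \<partial>lborel)"
      using q by (intro nn_integral_cong Lnorm_cmult) auto
    also have "\<dots> \<le> (\<integral>\<^sup>+s. indicator {0..<t} s * (ennreal (C * (t - s) powr (- (1/2 + 3 / (2 * q)))) * Lnorm lborel q (a s) * Lnorm lborel q (b s)) \<partial>lborel)"
    proof (intro nn_integral_mono)
      fix s
      show "indicator {0..<t} s * Lnorm lborel q (?A s) \<le> indicator {0..<t} s * (ennreal (C * (t - s) powr (- (1/2 + 3 / (2 * q)))) * Lnorm lborel q (a s) * Lnorm lborel q (b s))"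
      proof (cases "s \<in> {0..<t}")
        case True
        have "Lnorm lborel q (?A s) \<le> Lnorm lborel r (\<lambda>z. ennreal (decay_kernel (t - s) z)) * Lnorm lborel q (a s) * Lnorm lborel q (b s)"
          unfolding r_def using q by (intro Lnorm_convolution_mult_le) auto
        also have "\<dots> \<le> ennreal (C * (t - s) powr (- (1/2 + 3 / (2 * q)))) * Lnorm lborel q (a s) * Lnorm lborel q (b s)"
          using True by (intro mult_right_mono C(2)) auto
        finally show ?thesis using True by simp
      qed simp
    qed
    finally show ?thesis by (simp only: bilin_maj_def[abs_def])
  qed
  then show ?thesis using C(1) by (intro exI[of _ C]) blast
qed

text \<open>Passage from the iterated integral of the definition, time outside and space inside, to
  \<open>bilin\<close>; finiteness of the majorant at (t, x) gives Fubini.\<close>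

lemma mild_bilinear_term:
  assumes [measurable]: "joint_borel u"
    and fin: "bilin_maj (nrm u) (nrm u) t x < top"
  shows "(LINT s:{0..t}|lborel. heat_convol_distr (t - s) (Leray_distr (div_tensor (tensor_prod (u s) (u s)))) x) = bilin u u t x"
proof -
  let ?h = "\<lambda>s. heat_convol_distr (t - s) (Leray_distr (div_tensor (tensor_prod (u s) (u s)))) x"
  let ?m = "\<lambda>s. \<chi> i. - (\<integral>y. (\<Sum>j\<in>UNIV. \<Sum>k\<in>UNIV. nse_kernel i j k (t - s) (x - y) * u s y $ j * u s y $ k) \<partial>lborel)"
  have [measurable]: "?m \<in> borel_measurable lborel" by (rule measurable_vec_lambda) measurable
  have hm: "?h s = ?m s" if "s < t" for s
    using heat_convol_Leray_div_tensor[of "t - s"] that by (simp add: vec_eq_iff)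
  have int: "integrable (lborel \<Otimes>\<^sub>M lborel) (\<lambda>(s, y). bilin_integrand u u t x s y)"
    by (rule integrable_bilin_integrand[OF assms(1,1) fin])
  have 1: "AE s in lborel. integrable lborel (\<lambda>y. bilin_integrand u u t x s y)"
    using lborel_pair.AE_integrable_fst[OF int] .
  \<comment> \<open>The kernel formula holds for s < t only. At s = t the unknown value is split off
    as a constant, which keeps the integrand measurable and concerns a null set.\<close>
  have "(\<lambda>s. indicator {0..t} s *\<^sub>R ?h s) = (\<lambda>s. if s = t then indicator {0..t} t *\<^sub>R ?h t else indicator {0..t} s *\<^sub>R ?m s)"
  proof
    fix s show "indicator {0..t} s *\<^sub>R ?h s = (if s = t then indicator {0..t} t *\<^sub>R ?h t else indicator {0..t} s *\<^sub>R ?m s)"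
      using hm[of s] by (cases "s < t") auto
  qed
  moreover have "(\<lambda>s. if s = t then indicator {0..t} t *\<^sub>R ?h t else indicator {0..t} s *\<^sub>R ?m s) \<in> borel_measurable lborel"
    by measurable
  ultimately have m: "(\<lambda>s. indicator {0..t} s *\<^sub>R ?h s) \<in> borel_measurable lborel" by simp
  have "(LINT s:{0..t}|lborel. ?h s) = (\<integral>s. (\<integral>y. bilin_integrand u u t x s y \<partial>lborel) \<partial>lborel)"
    unfolding set_lebesgue_integral_def
  proof (rule integral_cong_AE[OF m])
    show "AE s in lborel. indicator {0..t} s *\<^sub>R ?h s = (\<integral>y. bilin_integrand u u t x s y \<partial>lborel)"
      using 1 AE_lborel_singleton[of t]
    proof eventually_elim
      case (elim s)
      show ?case
      proof (cases "s \<in> {0..<t}")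
        case True
        have i: "integrable lborel (\<lambda>y. nse_apply (t - s) (x - y) (u s y) (u s y))"
          using elim(1) True by (simp add: bilin_integrand_def)
        have "(\<integral>y. nse_apply (t - s) (x - y) (u s y) (u s y) \<partial>lborel) $ i = ?m s $ i" for i
        proof -
          have "(\<integral>y. nse_apply (t - s) (x - y) (u s y) (u s y) \<partial>lborel) $ i = (\<integral>y. nse_apply (t - s) (x - y) (u s y) (u s y) $ i \<partial>lborel)"
            by (rule integral_bounded_linear[OF bounded_linear_vec_nth i, symmetric])
          then show ?thesis by (simp add: nse_apply_def)
        qed
        then have "(\<integral>y. nse_apply (t - s) (x - y) (u s y) (u s y) \<partial>lborel) = ?m s" by (simp only: vec_eq_iff) simp
        then show ?thesis using True hm[of s] by (simp add: bilin_integrand_def)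
      next
        case False
        then have "s \<notin> {0..t}" using elim(2) by auto
        then show ?thesis using False by (simp add: bilin_integrand_def)
      qed
    qed
  qed measurable
  also have "\<dots> = bilin u u t x"
    unfolding bilin_def by (rule lborel_pair.integral_fst[OF int])
  finally show ?thesis .
qed

section \<open>The linear part and Volterra inequalities\<close>

lemma measurable_convol_heat [measurable (raw)]:
  assumes [measurable]: "T \<in> borel_measurable M" "X \<in> borel_measurable M" "S \<in> borel_measurable M"
    "joint_borel f"
  shows "(\<lambda>w. convol (heat_kernel (T w)) (f (S w) :: real^3 \<Rightarrow> real^3) (X w)) \<in> borel_measurable M"
  unfolding convol_def by measurable

lemma norm_convol_heat_le:
  fixes \<phi> :: "real^3 \<Rightarrow> real^3"
  shows "ennreal (norm (convol (heat_kernel t) \<phi> x)) \<le> (\<integral>\<^sup>+y. ennreal (heat_kernel t (x - y)) * ennreal (norm (\<phi> y)) \<partial>lborel)"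
  using norm_integral_le_nn_integral[of lborel "\<lambda>y. heat_kernel t (x - y) *\<^sub>R \<phi> y"]
  by (simp add: convol_def ennreal_mult)

lemma Lnorm_heat_maj:
  fixes \<phi> :: "real^3 \<Rightarrow> real^3"
  assumes "t \<ge> 0" "q \<ge> 1" and [measurable]: "\<phi> \<in> borel_measurable borel"
  shows "Lnorm lborel q (\<lambda>x. \<integral>\<^sup>+y. ennreal (heat_kernel t (x - y)) * ennreal (norm (\<phi> y)) \<partial>lborel) \<le>
    Lnorm lborel q (\<lambda>x. ennreal (norm (\<phi> x)))"
proof -
  have "Lnorm lborel q (\<lambda>x. \<integral>\<^sup>+y. ennreal (heat_kernel t (x - y)) * ennreal (norm (\<phi> y)) \<partial>lborel) \<le>
    (\<integral>\<^sup>+y. ennreal (heat_kernel t y) \<partial>lborel) * Lnorm lborel q (\<lambda>x. ennreal (norm (\<phi> x)))"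
    using assms(2) by (intro Lnorm_convolution_le) auto
  also have "\<dots> \<le> 1 * Lnorm lborel q (\<lambda>x. ennreal (norm (\<phi> x)))"
    by (intro mult_right_mono nn_integral_heat_kernel_le assms) auto
  finally show ?thesis by simp
qed

lemma Lnorm_convol_heat:
  fixes \<phi> :: "real^3 \<Rightarrow> real^3"
  assumes "t \<ge> 0" "q \<ge> 1" "\<phi> \<in> borel_measurable borel"
  shows "Lnorm lborel q (\<lambda>x. ennreal (norm (convol (heat_kernel t) \<phi> x))) \<le> Lnorm lborel q (\<lambda>x. ennreal (norm (\<phi> x)))"
  using assms by (intro order_trans[OF Lnorm_mono[OF _ norm_convol_heat_le] Lnorm_heat_maj]) auto

text \<open>Written as an average of translates of \<phi> with weight
  \<open>heat_kernel t h\<close>, the flow inherits the property from \<phi>.\<close>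

lemma div_free_convol_heat:
  fixes \<phi> :: "real^3 \<Rightarrow> real^3"
  assumes t: "t \<ge> 0" and q: "q > 1" and [measurable]: "\<phi> \<in> borel_measurable borel"
    and fin: "Lnorm lborel q (\<lambda>x. ennreal (norm (\<phi> x))) < top" and df: "div_free \<phi>"
  shows "div_free (convol (heat_kernel t) \<phi>)"
proof -
  have "div_free (\<lambda>x. \<integral>h. heat_kernel t h *\<^sub>R \<phi> (x - h) \<partial>lborel)"
  proof (rule div_free_integral[OF sigma_finite_lborel q])
    show "AE h in lborel. div_free (\<lambda>x. heat_kernel t h *\<^sub>R \<phi> (x - h))"
      using df by (intro AE_I2 div_free_scaleR div_free_shift) auto
    have "(\<integral>\<^sup>+h. ennreal (norm (heat_kernel t h *\<^sub>R \<phi> (x - h))) \<partial>lborel) =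
        (\<integral>\<^sup>+y. ennreal (heat_kernel t (x - y)) * ennreal (norm (\<phi> y)) \<partial>lborel)" for x
      using nn_integral_lborel_reflect[of "\<lambda>h. ennreal (norm (heat_kernel t h *\<^sub>R \<phi> (x - h)))" x]
      by (simp add: ennreal_mult)
    then show "Lnorm lborel q (\<lambda>x. \<integral>\<^sup>+h. ennreal (norm (heat_kernel t h *\<^sub>R \<phi> (x - h))) \<partial>lborel) < top"
      using Lnorm_heat_maj[of t q \<phi>] t q fin by (simp add: le_less_trans)
  qed measurable
  moreover have "convol (heat_kernel t) \<phi> x = (\<integral>h. heat_kernel t h *\<^sub>R \<phi> (x - h) \<partial>lborel)" for x
    using lborel_integral_reflect[of "\<lambda>h. heat_kernel t h *\<^sub>R \<phi> (x - h)" x] by (simp add: convol_def)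
  ultimately show ?thesis by presburger
qed

definition duhamel :: "(real \<Rightarrow> real^3 \<Rightarrow> real^3) \<Rightarrow> real \<Rightarrow> real^3 \<Rightarrow> real^3" where
  "duhamel f t x = (LINT s:{0..t}|lborel. convol (heat_kernel (t - s)) (f s) x)"

lemma measurable_duhamel [measurable]:
  assumes [measurable]: "joint_borel f"
  shows "joint_borel (duhamel f)"
proof -
  have "case_prod (duhamel f) = (\<lambda>(t, x). \<integral>s. (if 0 \<le> s \<and> s \<le> t then convol (heat_kernel (t - s)) (f s) x else 0) \<partial>lborel)"
    unfolding duhamel_def set_lebesgue_integral_def
    by (auto simp: fun_eq_iff intro!: Bochner_Integration.integral_cong)
  also have "\<dots> \<in> borel_measurable (borel \<Otimes>\<^sub>M borel)" by measurable
  finally show ?thesis .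
qed

text \<open>Kept apart from the bound for \<open>duhamel\<close> itself, because
  \<open>div_free_integral\<close> asks for the norm with the modulus inside the integral.\<close>

lemma Lnorm_duhamel_maj:
  assumes q: "q > 1" and [measurable]: "joint_borel f"
  shows "Lnorm lborel q (\<lambda>x. \<integral>\<^sup>+s. ennreal (norm (indicator {0..t} s *\<^sub>R convol (heat_kernel (t - s)) (f s) x)) \<partial>lborel)
    \<le> (\<integral>\<^sup>+s. indicator {0..t} s * Lnorm lborel q (nrm f s) \<partial>lborel)"
proof -
  have "Lnorm lborel q (\<lambda>x. \<integral>\<^sup>+s. ennreal (norm (indicator {0..t} s *\<^sub>R convol (heat_kernel (t - s)) (f s) x)) \<partial>lborel)
    \<le> (\<integral>\<^sup>+s. Lnorm lborel q (\<lambda>x. ennreal (norm (indicator {0..t} s *\<^sub>R convol (heat_kernel (t - s)) (f s) x))) \<partial>lborel)"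
    by (intro Lnorm_integral_le sigma_finite_lborel q) measurable
  also have "\<dots> \<le> (\<integral>\<^sup>+s. indicator {0..t} s * Lnorm lborel q (nrm f s) \<partial>lborel)"
  proof (intro nn_integral_mono)
    fix s
    show "Lnorm lborel q (\<lambda>x. ennreal (norm (indicator {0..t} s *\<^sub>R convol (heat_kernel (t - s)) (f s) x))) \<le> indicator {0..t} s * Lnorm lborel q (nrm f s)"
      using Lnorm_convol_heat[of "t - s" q "f s"] q by (cases "s \<in> {0..t}") auto
  qed
  finally show ?thesis .
qed

lemma Lnorm_duhamel:
  assumes q: "q > 1" and f: "joint_borel f"
  shows "Lnorm lborel q (nrm (duhamel f) t) \<le> (\<integral>\<^sup>+s. indicator {0..t} s * Lnorm lborel q (nrm f s) \<partial>lborel)"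
proof -
  have "Lnorm lborel q (nrm (duhamel f) t) \<le> Lnorm lborel q (\<lambda>x. \<integral>\<^sup>+s. ennreal (norm (indicator {0..t} s *\<^sub>R convol (heat_kernel (t - s)) (f s) x)) \<partial>lborel)"
    unfolding duhamel_def set_lebesgue_integral_def
    using q by (intro Lnorm_mono norm_integral_le_nn_integral) auto
  also note Lnorm_duhamel_maj[OF q f]
  finally show ?thesis .
qed

lemma duhamel_div_free:
  assumes q: "q > 1" and [measurable]: "joint_borel f"
    and fin: "(\<integral>\<^sup>+s. indicator {0..t} s * Lnorm lborel q (nrm f s) \<partial>lborel) < top"
    and df: "AE s in lborel. s \<in> {0..t} \<longrightarrow> div_free (f s)"
  shows "div_free (duhamel f t)"
proof -
  have [measurable]: "(\<lambda>s. Lnorm lborel q (nrm f s)) \<in> borel_measurable borel"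
    unfolding Lnorm_def by measurable
  have "AE s in lborel. indicator {0..t} s * Lnorm lborel q (nrm f s) \<noteq> \<infinity>"
    using fin by (intro nn_integral_PInf_AE) auto
  then have "AE s in lborel. div_free (\<lambda>x. indicator {0..t} s *\<^sub>R convol (heat_kernel (t - s)) (f s) x)"
    using df
  proof eventually_elim
    case (elim s)
    then show ?case
      using q by (cases "s \<in> {0..t}") (auto intro!: div_free_convol_heat[of _ q] simp: less_top)
  qed
  then show ?thesis
    unfolding duhamel_def[abs_def] set_lebesgue_integral_def
    using le_less_trans[OF Lnorm_duhamel_maj[OF q assms(2)] fin]
    by (intro div_free_integral[OF sigma_finite_lborel q]) measurable
qed

section \<open>Weakly singular Volterra inequalities\<close>

lemma nn_integral_powr_from_0:
  assumes "\<beta> < 1" "T \<ge> 0"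
  shows "(\<integral>\<^sup>+\<tau>. indicator {0<..T} \<tau> * ennreal (\<tau> powr (- \<beta>)) \<partial>lborel) = ennreal (T powr (1 - \<beta>) / (1 - \<beta>))"
proof -
  have "((\<lambda>\<tau>. \<tau> powr (- \<beta>)) has_integral (T powr (- \<beta> + 1) / (- \<beta> + 1))) {0..T}"
    using assms by (intro has_integral_powr_from_0) auto
  then have "((\<lambda>\<tau>. indicator {0..T} \<tau> * \<tau> powr (- \<beta>)) has_integral (T powr (- \<beta> + 1) / (- \<beta> + 1))) UNIV"
    by (subst (asm) has_integral_restrict_UNIV[symmetric])
      (rule has_integral_cong[THEN iffD1, rotated], assumption, auto)
  from nn_integral_has_integral_lborel[OF _ _ this]
  have "(\<integral>\<^sup>+\<tau>. ennreal (indicator {0..T} \<tau> * \<tau> powr (- \<beta>)) \<partial>lborel) = ennreal (T powr (1 - \<beta>) / (1 - \<beta>))"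
    by simp
  also have "(\<integral>\<^sup>+\<tau>. ennreal (indicator {0..T} \<tau> * \<tau> powr (- \<beta>)) \<partial>lborel) =
      (\<integral>\<^sup>+\<tau>. indicator {0<..T} \<tau> * ennreal (\<tau> powr (- \<beta>)) \<partial>lborel)"
    by (intro nn_integral_cong) (auto split: split_indicator)
  finally show ?thesis .
qed

text \<open>Multiplied by \<open>exp (- \<mu> t)\<close> and integrated, the hypothesis becomes a contraction for large \<open>\<mu>\<close>.\<close>

lemma volterra_zero:
  fixes \<psi> :: "real \<Rightarrow> ennreal"
  assumes \<beta>: "0 \<le> \<beta>" "\<beta> < 1" and A: "A \<ge> 0" and T: "T > 0"
    and [measurable]: "\<psi> \<in> borel_measurable borel"
    and fin: "(\<integral>\<^sup>+t. indicator {0..T} t * \<psi> t \<partial>lborel) < top"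
    and le: "AE t in lborel. t \<in> {0..T} \<longrightarrow>
      \<psi> t \<le> ennreal A * (\<integral>\<^sup>+s. indicator {0..<t} s * (ennreal ((t - s) powr (- \<beta>)) * \<psi> s) \<partial>lborel)"
  shows "AE t in lborel. t \<in> {0..T} \<longrightarrow> \<psi> t = 0"
proof -
  \<comment> \<open>Half of the room below 1: the power \<epsilon> is traded for decay in \<mu>
    while the power \<beta> + \<epsilon> stays integrable at 0.\<close>
  define \<epsilon> where "\<epsilon> = (1 - \<beta>) / 2"
  have \<epsilon>: "0 < \<epsilon>" "\<epsilon> < 1" "\<beta> + \<epsilon> < 1" using \<beta> by (auto simp: \<epsilon>_def field_simps)
  define c where "c = T powr (1 - (\<beta> + \<epsilon>)) / (1 - (\<beta> + \<epsilon>))"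
  have c: "c > 0" using \<epsilon> T by (simp add: c_def)
  \<comment> \<open>Chosen so that \<mu>^(-\<epsilon>) = 1 / (2 A c + 1), hence A c
    \<mu>^(-\<epsilon>) is at most 1/2.\<close>
  define \<mu> where "\<mu> = (2 * A * c + 1) powr (1 / \<epsilon>)"
  have Ac: "2 * A * c + 1 > 0" using A c by (simp add: add_nonneg_pos)
  then have \<mu>: "\<mu> > 0" by (simp add: \<mu>_def)
  have \<mu>\<epsilon>: "\<mu> powr (- \<epsilon>) = 1 / (2 * A * c + 1)"
    using \<epsilon> Ac by (simp add: \<mu>_def powr_powr powr_minus_divide)
  have small: "A * (\<mu> powr (- \<epsilon>) * c) \<le> 1 / 2"
    unfolding \<mu>\<epsilon> using Ac by (simp add: field_simps)
  have J: "(\<integral>\<^sup>+\<tau>. indicator {0<..T} \<tau> * ennreal (exp (- \<mu> * \<tau>) * \<tau> powr (- \<beta>)) \<partial>lborel) \<le> ennreal (\<mu> powr (- \<epsilon>) * c)"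
  proof -
    have "(\<integral>\<^sup>+\<tau>. indicator {0<..T} \<tau> * ennreal (exp (- \<mu> * \<tau>) * \<tau> powr (- \<beta>)) \<partial>lborel) \<le>
        (\<integral>\<^sup>+\<tau>. ennreal (\<mu> powr (- \<epsilon>)) * (indicator {0<..T} \<tau> * ennreal (\<tau> powr (- (\<beta> + \<epsilon>)))) \<partial>lborel)"
    proof (intro nn_integral_mono)
      fix \<tau> :: real
      show "indicator {0<..T} \<tau> * ennreal (exp (- \<mu> * \<tau>) * \<tau> powr (- \<beta>)) \<le> ennreal (\<mu> powr (- \<epsilon>)) * (indicator {0<..T} \<tau> * ennreal (\<tau> powr (- (\<beta> + \<epsilon>))))"
      proof (cases "\<tau> \<in> {0<..T}")
        case True
        define x where "x = \<mu> * \<tau>"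
        have x: "x > 0" using True \<mu> by (simp add: x_def)
        \<comment> \<open>Equivalent to exp (- \<mu> \<tau>) <= (\<mu> \<tau>)^(-\<epsilon>), which
          extracts the factor \<mu>^(-\<epsilon>).\<close>
        have "x powr \<epsilon> \<le> exp x"
        proof (cases "x \<le> 1")
          case True
          then have "x powr \<epsilon> \<le> 1 powr \<epsilon>" using x \<epsilon> by (intro powr_mono2) auto
          then show ?thesis using x by (simp add: order_trans[of _ 1])
        next
          case False
          then have "x powr \<epsilon> \<le> x powr 1" using \<epsilon> by (intro powr_mono) auto
          also have "x powr 1 = x" using x by simp
          also have "x \<le> exp x" using exp_ge_add_one_self[of x] by linarith
          finally show ?thesis .
        qed
        then have "exp (- x) \<le> x powr (- \<epsilon>)"
          using x by (simp add: exp_minus powr_minus inverse_le_iff_le)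
        also have "\<dots> = \<mu> powr (- \<epsilon>) * \<tau> powr (- \<epsilon>)" using True \<mu> by (simp add: x_def powr_mult)
        finally have "exp (- \<mu> * \<tau>) * \<tau> powr (- \<beta>) \<le> \<mu> powr (- \<epsilon>) * \<tau> powr (- \<epsilon>) * \<tau> powr (- \<beta>)"
          by (intro mult_right_mono) (auto simp: x_def)
        also have "\<dots> = \<mu> powr (- \<epsilon>) * \<tau> powr (- (\<beta> + \<epsilon>))"
          using True powr_add[of \<tau> "- \<epsilon>" "- \<beta>"] by (simp add: add.commute)
        finally have "ennreal (exp (- \<mu> * \<tau>) * \<tau> powr (- \<beta>)) \<le> ennreal (\<mu> powr (- \<epsilon>) * \<tau> powr (- (\<beta> + \<epsilon>)))"
          by (rule ennreal_leI)
        then show ?thesis using True by (simp add: ennreal_mult)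
      qed simp
    qed
    also have "\<dots> = ennreal (\<mu> powr (- \<epsilon>)) * ennreal c"
      unfolding c_def nn_integral_powr_from_0[OF \<epsilon>(3) less_imp_le[OF T], symmetric]
      by (rule nn_integral_cmult) measurable
    finally show ?thesis using c by (simp add: ennreal_mult)
  qed
  define E where "E = (\<integral>\<^sup>+t. indicator {0..T} t * (ennreal (exp (- \<mu> * t)) * \<psi> t) \<partial>lborel)"
  have "E \<le> (\<integral>\<^sup>+t. indicator {0..T} t * \<psi> t \<partial>lborel)"
    unfolding E_def
  proof (intro nn_integral_mono)
    fix t
    have "ennreal (exp (- \<mu> * t)) \<le> 1" if "t \<ge> 0"
      using that \<mu> by (simp add: ennreal_le_1)
    from mult_right_mono[OF this, of "\<psi> t"]
    show "indicator {0..T} t * (ennreal (exp (- \<mu> * t)) * \<psi> t) \<le> indicator {0..T} t * \<psi> t"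
      by (auto split: split_indicator)
  qed
  then have Efin: "E < top" using fin by (rule le_less_trans)
  have "E \<le> (\<integral>\<^sup>+t. indicator {0..T} t * (ennreal (exp (- \<mu> * t)) * (ennreal A * (\<integral>\<^sup>+s. indicator {0..<t} s * (ennreal ((t - s) powr (- \<beta>)) * \<psi> s) \<partial>lborel))) \<partial>lborel)"
    unfolding E_def using le
    by (intro nn_integral_mono_AE) (auto elim!: eventually_mono intro!: mult_left_mono split: split_indicator)
  \<comment> \<open>The weight exp (- \<mu> t) is divided between \<psi> s and the kernel, so that
    after exchanging the integrals the t-integral is controlled by a function of t - s.\<close>
  also have "\<dots> = (\<integral>\<^sup>+t. (\<integral>\<^sup>+s. (if 0 \<le> s \<and> s < t \<and> t \<le> T then ennreal A * (ennreal (exp (- \<mu> * s)) * \<psi> s) * ennreal (exp (- \<mu> * (t - s)) * (t - s) powr (- \<beta>)) else 0) \<partial>lborel) \<partial>lborel)"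
  proof (intro nn_integral_cong)
    fix t
    have e: "ennreal (exp (- \<mu> * t)) = ennreal (exp (- \<mu> * s)) * ennreal (exp (- \<mu> * (t - s)))" for s
      by (simp add: algebra_simps flip: ennreal_mult exp_add)
    have "indicator {0..T} t * (ennreal (exp (- \<mu> * t)) * (ennreal A * (\<integral>\<^sup>+s. indicator {0..<t} s * (ennreal ((t - s) powr (- \<beta>)) * \<psi> s) \<partial>lborel)))
      = (\<integral>\<^sup>+s. indicator {0..T} t * (ennreal (exp (- \<mu> * t)) * (ennreal A * (indicator {0..<t} s * (ennreal ((t - s) powr (- \<beta>)) * \<psi> s)))) \<partial>lborel)"
      by (simp add: nn_integral_cmult)
    also have "\<dots> = (\<integral>\<^sup>+s. (if 0 \<le> s \<and> s < t \<and> t \<le> T then ennreal A * (ennreal (exp (- \<mu> * s)) * \<psi> s) * ennreal (exp (- \<mu> * (t - s)) * (t - s) powr (- \<beta>)) else 0) \<partial>lborel)"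
    proof (intro nn_integral_cong)
      fix s
      show "indicator {0..T} t * (ennreal (exp (- \<mu> * t)) * (ennreal A * (indicator {0..<t} s * (ennreal ((t - s) powr (- \<beta>)) * \<psi> s)))) =
        (if 0 \<le> s \<and> s < t \<and> t \<le> T then ennreal A * (ennreal (exp (- \<mu> * s)) * \<psi> s) * ennreal (exp (- \<mu> * (t - s)) * (t - s) powr (- \<beta>)) else 0)"
        unfolding e[of s] by (auto simp: ennreal_mult ac_simps split: split_indicator)
    qed
    finally show "indicator {0..T} t * (ennreal (exp (- \<mu> * t)) * (ennreal A * (\<integral>\<^sup>+s. indicator {0..<t} s * (ennreal ((t - s) powr (- \<beta>)) * \<psi> s) \<partial>lborel)))
      = (\<integral>\<^sup>+s. (if 0 \<le> s \<and> s < t \<and> t \<le> T then ennreal A * (ennreal (exp (- \<mu> * s)) * \<psi> s) * ennreal (exp (- \<mu> * (t - s)) * (t - s) powr (- \<beta>)) else 0) \<partial>lborel)" .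
  qed
  also have "\<dots> = (\<integral>\<^sup>+s. (\<integral>\<^sup>+t. (if 0 \<le> s \<and> s < t \<and> t \<le> T then ennreal A * (ennreal (exp (- \<mu> * s)) * \<psi> s) * ennreal (exp (- \<mu> * (t - s)) * (t - s) powr (- \<beta>)) else 0) \<partial>lborel) \<partial>lborel)"
    by (rule lborel_pair.Fubini') measurable
  also have "\<dots> \<le> (\<integral>\<^sup>+s. ennreal A * (indicator {0..T} s * (ennreal (exp (- \<mu> * s)) * \<psi> s)) * ennreal (\<mu> powr (- \<epsilon>) * c) \<partial>lborel)"
  proof (intro nn_integral_mono)
    fix s
    let ?K = "ennreal A * (indicator {0..T} s * (ennreal (exp (- \<mu> * s)) * \<psi> s))"
    let ?k = "\<lambda>\<tau>. indicator {0<..T} \<tau> * ennreal (exp (- \<mu> * \<tau>) * \<tau> powr (- \<beta>))"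
    have "(\<integral>\<^sup>+t. (if 0 \<le> s \<and> s < t \<and> t \<le> T then ennreal A * (ennreal (exp (- \<mu> * s)) * \<psi> s) * ennreal (exp (- \<mu> * (t - s)) * (t - s) powr (- \<beta>)) else 0) \<partial>lborel)
      \<le> (\<integral>\<^sup>+t. ?K * ?k (- s + t) \<partial>lborel)"
      by (intro nn_integral_mono) (auto split: split_indicator)
    also have "\<dots> = ?K * (\<integral>\<^sup>+t. ?k (- s + t) \<partial>lborel)"
      by (rule nn_integral_cmult) measurable
    also have "(\<integral>\<^sup>+t. ?k (- s + t) \<partial>lborel) = (\<integral>\<^sup>+\<tau>. ?k \<tau> \<partial>lborel)"
      by (rule nn_integral_lborel_shift) measurable
    also have "?K * \<dots> \<le> ?K * ennreal (\<mu> powr (- \<epsilon>) * c)"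
      by (intro mult_left_mono J) auto
    finally show "(\<integral>\<^sup>+t. (if 0 \<le> s \<and> s < t \<and> t \<le> T then ennreal A * (ennreal (exp (- \<mu> * s)) * \<psi> s) * ennreal (exp (- \<mu> * (t - s)) * (t - s) powr (- \<beta>)) else 0) \<partial>lborel)
      \<le> ?K * ennreal (\<mu> powr (- \<epsilon>) * c)" .
  qed
  also have "\<dots> = ennreal A * E * ennreal (\<mu> powr (- \<epsilon>) * c)"
    unfolding E_def by (subst nn_integral_multc) (auto simp: nn_integral_cmult)
  also have "\<dots> = ennreal (A * (\<mu> powr (- \<epsilon>) * c)) * E"
    using A c by (simp add: ennreal_mult ac_simps)
  also have "\<dots> \<le> ennreal (1 / 2) * E"
    by (intro mult_right_mono ennreal_leI small) auto
  finally have "E \<le> ennreal (1 / 2) * E" .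
  \<comment> \<open>Finiteness of E is essential here: E <= E / 2 alone would allow the value
    \<open>top\<close>.\<close>
  then have "E = 0"
  proof (cases E)
    case (real x)
    then have "ennreal x \<le> ennreal (1 / 2 * x)"
      using \<open>E \<le> ennreal (1 / 2) * E\<close> by (subst ennreal_mult') auto
    then have "x \<le> 1 / 2 * x" using real by (subst (asm) ennreal_le_iff) auto
    then show ?thesis using real by simp
  qed (use Efin in auto)
  then have "AE t in lborel. indicator {0..T} t * (ennreal (exp (- \<mu> * t)) * \<psi> t) = 0"
    unfolding E_def by (subst (asm) nn_integral_0_iff_AE) auto
  then show ?thesis
    by eventually_elim (auto split: split_indicator_asm)
qed

section \<open>Existence by successive approximation\<close>

lemma suminf_geometric_ennreal:
  assumes "R \<ge> 0"
  shows "(\<Sum>m. ennreal (R / 2 ^ (m + n))) = ennreal (2 * R / 2 ^ n)"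
proof (rule suminf_ennreal_eq)
  have "(\<lambda>m. (1 / 2) ^ m :: real) sums 2" using geometric_sums[of "1/2 :: real"] by simp
  from sums_mult[OF this, of "R / 2 ^ n"]
  show "(\<lambda>m. R / 2 ^ (m + n)) sums (2 * R / 2 ^ n)"
    by (simp add: power_add power_one_over field_simps)
qed (use assms in simp)

text \<open>Riesz-Fischer for a geometrically convergent telescoping series: Minkowski bounds the
  norm of the sum of moduli, so that sum is finite almost everywhere. The limit is built by one
  formula in (t, x), hence jointly Borel, and the bound holds for every t and not just almost every
  one.\<close>

lemma mixed_complete:
  fixes U :: "nat \<Rightarrow> real \<Rightarrow> real^3 \<Rightarrow> real^3"
  assumes q: "q > 1" and R: "R \<ge> 0"
    and [measurable]: "\<And>n. joint_borel (U n)"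
    and U0: "U 0 = (\<lambda>_ _. 0)"
    and step: "\<And>n t. Lnorm lborel q (\<lambda>x. ennreal (norm (U (Suc n) t x - U n t x))) \<le> ennreal (R / 2 ^ n)"
  shows "\<exists>u. joint_borel u \<and>
    (\<forall>n t. Lnorm lborel q (\<lambda>x. ennreal (norm (u t x - U n t x))) \<le> ennreal (2 * R / 2 ^ n))"
proof -
  define d where "d n t x = U (Suc n) t x - U n t x" for n t x
  define D where "D t x = (\<Sum>n. ennreal (norm (d n t x)))" for t x
  \<comment> \<open>The value 0 at divergent points makes \<open>u\<close> total; for each t these x
    form a null set.\<close>
  define u where "u t x = (if D t x < top then (\<Sum>n. d n t x) else 0)" for t x
  have [measurable]: "joint_borel (d n)" for n
    unfolding d_def[abs_def] by measurable
  have [measurable]: "joint_borel D"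
    unfolding D_def[abs_def] by measurable
  have meas: "joint_borel u"
    unfolding u_def[abs_def] by measurable
  have tail: "Lnorm lborel q (\<lambda>x. \<Sum>m. ennreal (norm (d (m + n) t x))) \<le> ennreal (2 * R / 2 ^ n)" for n t
  proof -
    have "Lnorm lborel q (\<lambda>x. \<Sum>m. ennreal (norm (d (m + n) t x))) \<le> (\<Sum>m. Lnorm lborel q (\<lambda>x. ennreal (norm (d (m + n) t x))))"
      using q by (intro Lnorm_suminf_le sigma_finite_lborel) measurable
    also have "\<dots> \<le> (\<Sum>m. ennreal (R / 2 ^ (m + n)))"
      using step by (intro suminf_le) (auto simp: d_def)
    finally show ?thesis by (simp only: suminf_geometric_ennreal[OF R])
  qed
  have "Lnorm lborel q (\<lambda>x. ennreal (norm (u t x - U n t x))) \<le> ennreal (2 * R / 2 ^ n)" for n t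
  proof -
    have "Lnorm lborel q (D t) \<le> ennreal (2 * R / 2 ^ 0)"
      using tail[of 0 t] by (simp add: D_def[abs_def])
    then have "Lnorm lborel q (D t) < top" by (rule le_less_trans) simp
    then have "AE x in lborel. D t x < top"
      using q by (intro Lnorm_finite_AE[of q]) auto
    then have "AE x in lborel. ennreal (norm (u t x - U n t x)) \<le> (\<Sum>m. ennreal (norm (d (m + n) t x)))"
    proof eventually_elim
      case (elim x)
      have s: "summable (\<lambda>m. norm (d m t x))"
        using elim by (intro summable_suminf_not_top) (auto simp: D_def less_top)
      then have s': "summable (\<lambda>m. norm (d (m + n) t x))" by (subst summable_iff_shift)
      have "U n t x = (\<Sum>m<n. d m t x)"
        using sum_lessThan_telescope[of "\<lambda>m. U m t x" n] U0 by (simp add: d_def)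
      then have "u t x - U n t x = (\<Sum>m. d (m + n) t x)"
        using elim suminf_minus_initial_segment[OF summable_norm_cancel[OF s], of n] by (simp add: u_def)
      then have "norm (u t x - U n t x) \<le> (\<Sum>m. norm (d (m + n) t x))"
        using summable_norm[OF s'] by simp
      then have "ennreal (norm (u t x - U n t x)) \<le> ennreal (\<Sum>m. norm (d (m + n) t x))"
        by (rule ennreal_leI)
      also have "\<dots> = (\<Sum>m. ennreal (norm (d (m + n) t x)))"
        using s' by (subst suminf_ennreal2) auto
      finally show ?case .
    qed
    then have "Lnorm lborel q (\<lambda>x. ennreal (norm (u t x - U n t x))) \<le> Lnorm lborel q (\<lambda>x. \<Sum>m. ennreal (norm (d (m + n) t x)))"
      using q by (intro Lnorm_mono_AE) auto
    also note tail
    finally show ?thesis .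
  qed
  with meas show ?thesis by blast
qed

lemma Lnorm_triangle:
  fixes f g h :: "'a \<Rightarrow> 'b::{second_countable_topology, real_normed_vector}"
  assumes M: "sigma_finite_measure M" and q: "q > 1"
    and [measurable]: "f \<in> borel_measurable M" "g \<in> borel_measurable M" "h \<in> borel_measurable M"
  shows "Lnorm M q (\<lambda>x. ennreal (norm (f x - h x))) \<le>
    Lnorm M q (\<lambda>x. ennreal (norm (f x - g x))) + Lnorm M q (\<lambda>x. ennreal (norm (g x - h x)))"
proof -
  have "Lnorm M q (\<lambda>x. ennreal (norm (f x - h x))) \<le> Lnorm M q (\<lambda>x. ennreal (norm (f x - g x)) + ennreal (norm (g x - h x)))"
    using q norm_triangle_le[of "f _ - g _" "g _ - h _"]
    by (intro Lnorm_mono) (auto simp flip: ennreal_plus intro!: ennreal_leI norm_diff_triangle_le)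
  also have "\<dots> \<le> Lnorm M q (\<lambda>x. ennreal (norm (f x - g x))) + Lnorm M q (\<lambda>x. ennreal (norm (g x - h x)))"
    by (intro Lnorm_add_le M q) measurable
  finally show ?thesis .
qed

text \<open>Banach's fixed point argument in the ball of radius 2 R of L^\<infinity>(L^q), with the
  supremum taken over every t. Iterates stay in the ball: their distance to \<Phi> 0 is at most half
  of 2 R, and \<Phi> 0 has norm at most R.\<close>

lemma picard_iteration:
  fixes \<Phi> :: "(real \<Rightarrow> real^3 \<Rightarrow> real^3) \<Rightarrow> (real \<Rightarrow> real^3 \<Rightarrow> real^3)"
  assumes q: "q > 1" and R: "R \<ge> 0"
    and meas: "\<And>u. joint_borel u \<Longrightarrow> joint_borel (\<Phi> u)"
    and zero: "\<And>t. Lnorm lborel q (nrm (\<Phi> (\<lambda>_ _. 0)) t) \<le> ennreal R"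
    and contr: "\<And>u v d t. joint_borel u \<Longrightarrow> joint_borel v \<Longrightarrow>
      (\<And>t. Lnorm lborel q (nrm u t) \<le> ennreal (2 * R)) \<Longrightarrow> (\<And>t. Lnorm lborel q (nrm v t) \<le> ennreal (2 * R)) \<Longrightarrow>
      d \<ge> 0 \<Longrightarrow> (\<And>t. Lnorm lborel q (\<lambda>x. ennreal (norm (u t x - v t x))) \<le> ennreal d) \<Longrightarrow>
      Lnorm lborel q (\<lambda>x. ennreal (norm (\<Phi> u t x - \<Phi> v t x))) \<le> ennreal (d / 2)"
  shows "\<exists>u. joint_borel u \<and> (\<forall>t. Lnorm lborel q (nrm u t) \<le> ennreal (2 * R)) \<and>
    (\<forall>t. AE x in lborel. \<Phi> u t x = u t x)"
proof -
  define U where "U n = (\<Phi> ^^ n) (\<lambda>_ _. 0)" for n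
  have U0: "U 0 = (\<lambda>_ _. 0)" and US: "U (Suc n) = \<Phi> (U n)" for n by (simp_all add: U_def)
  have Um[measurable]: "joint_borel (U n)" for n
  proof (induction n)
    case 0
    then show ?case by (simp add: U0 split_beta')
  next
    case (Suc n)
    then show ?case unfolding US by (rule meas)
  qed
  have Ub: "Lnorm lborel q (nrm (U n) t) \<le> ennreal (2 * R)" for n t
  proof (induction n arbitrary: t)
    case 0
    then show ?case using q by (simp add: U0)
  next
    case (Suc n)
    have m0: "joint_borel (\<lambda>_ _. 0 :: real^3)" by (simp add: split_beta')
    have [measurable]: "joint_borel (\<Phi> (\<lambda>_ _. 0))" by (rule meas[OF m0])
    have [measurable]: "joint_borel (\<Phi> (U n))" by (rule meas[OF Um])
    have "Lnorm lborel q (nrm (U (Suc n)) t) \<le> Lnorm lborel q (\<lambda>x. ennreal (norm (\<Phi> (U n) t x - \<Phi> (\<lambda>_ _. 0) t x))) + Lnorm lborel q (nrm (\<Phi> (\<lambda>_ _. 0)) t)"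
      using Lnorm_triangle[OF sigma_finite_lborel q, of "\<Phi> (U n) t" "\<Phi> (\<lambda>_ _. 0) t" "\<lambda>_. 0"] by (simp add: US)
    also have "\<dots> \<le> ennreal (2 * R / 2) + ennreal R"
    proof (intro add_mono zero)
      show "Lnorm lborel q (\<lambda>x. ennreal (norm (\<Phi> (U n) t x - \<Phi> (\<lambda>_ _. 0) t x))) \<le> ennreal (2 * R / 2)"
        by (rule contr[OF Um m0 Suc.IH]) (use q R Suc.IH in auto)
    qed
    also have "\<dots> = ennreal (2 * R)" using R by (simp flip: ennreal_plus)
    finally show ?case .
  qed
  have step: "Lnorm lborel q (\<lambda>x. ennreal (norm (U (Suc n) t x - U n t x))) \<le> ennreal (R / 2 ^ n)" for n t
  proof (induction n arbitrary: t)
    case 0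
    then show ?case using zero by (simp add: US U0)
  next
    case (Suc n)
    have "Lnorm lborel q (\<lambda>x. ennreal (norm (\<Phi> (U (Suc n)) t x - \<Phi> (U n) t x))) \<le> ennreal (R / 2 ^ n / 2)"
      by (rule contr[OF Um Um Ub Ub _ Suc.IH]) (use R in auto)
    then show ?case by (simp add: US[of "Suc n"] US[of n] ac_simps)
  qed
  from mixed_complete[OF q R Um U0 step] obtain u where
    [measurable]: "joint_borel u" and
    u: "\<And>n t. Lnorm lborel q (\<lambda>x. ennreal (norm (u t x - U n t x))) \<le> ennreal (2 * R / 2 ^ n)" by blast
  have um: "joint_borel u" by measurable
  have [measurable]: "joint_borel (\<Phi> u)" by (rule meas[OF um])
  have ub: "Lnorm lborel q (nrm u t) \<le> ennreal (2 * R)" for t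
    using u[of t 0] by (simp add: U0)
  have "AE x in lborel. \<Phi> u t x = u t x" for t
  proof -
    have "Lnorm lborel q (\<lambda>x. ennreal (norm (\<Phi> u t x - u t x))) \<le> ennreal (2 * R / 2 ^ n)" for n
    proof -
      have "Lnorm lborel q (\<lambda>x. ennreal (norm (\<Phi> u t x - u t x))) \<le>
          Lnorm lborel q (\<lambda>x. ennreal (norm (\<Phi> u t x - U (Suc n) t x))) + Lnorm lborel q (\<lambda>x. ennreal (norm (U (Suc n) t x - u t x)))"
        by (rule Lnorm_triangle[OF sigma_finite_lborel q]) measurable
      also have "\<dots> \<le> ennreal (2 * R / 2 ^ n / 2) + ennreal (2 * R / 2 ^ Suc n)"
      proof (intro add_mono)
        show "Lnorm lborel q (\<lambda>x. ennreal (norm (\<Phi> u t x - U (Suc n) t x))) \<le> ennreal (2 * R / 2 ^ n / 2)"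
          unfolding US by (rule contr[OF um Um ub Ub _ u]) (use R in auto)
        show "Lnorm lborel q (\<lambda>x. ennreal (norm (U (Suc n) t x - u t x))) \<le> ennreal (2 * R / 2 ^ Suc n)"
          using u[of t "Suc n"] by (simp only: norm_minus_commute)
      qed
      also have "\<dots> = ennreal (2 * R / 2 ^ n)" using R by (simp flip: ennreal_plus)
      finally show ?thesis .
    qed
    moreover have "(\<lambda>n. ennreal (2 * R / 2 ^ n)) \<longlonglongrightarrow> ennreal 0"
      by (intro tendsto_ennrealI) real_asymp
    ultimately have "Lnorm lborel q (\<lambda>x. ennreal (norm (\<Phi> u t x - u t x))) \<le> ennreal 0"
      by (intro LIMSEQ_le_const) auto
    then have "Lnorm lborel q (\<lambda>x. ennreal (norm (\<Phi> u t x - u t x))) = 0" by simp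
    then have "AE x in lborel. ennreal (norm (\<Phi> u t x - u t x)) = 0"
      using q by (subst (asm) Lnorm_eq_0_iff) auto
    then show ?thesis by eventually_elim (simp add: ennreal_eq_0_iff)
  qed
  with um ub show ?thesis by blast
qed

lemma ennpowr_le_1_plus:
  assumes "0 \<le> s" "s \<le> r"
  shows "ennpowr a s \<le> 1 + ennpowr a r"
proof (cases a)
  case (real x)
  have "x powr s \<le> 1 + x powr r"
  proof (cases "x \<le> 1")
    case True
    then have "x powr s \<le> 1 powr s" using real assms by (intro powr_mono2) auto
    then show ?thesis by (simp add: add_increasing2)
  next
    case False
    then have "x powr s \<le> x powr r" using assms by (intro powr_mono) auto
    then show ?thesis by simp
  qed
  then have "ennreal (x powr s) \<le> ennreal (1 + x powr r)" by (rule ennreal_leI)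
  then show ?thesis using real by simp
qed simp

text \<open>Tonelli: the kernel is integrable on (0, T], so its convolution with an integrable g is
  integrable. As g is assumed no better than that, finiteness is claimed for almost every t
  only.\<close>

lemma volterra_finite:
  fixes g :: "real \<Rightarrow> ennreal"
  assumes \<beta>: "\<beta> < 1" and T: "T > 0" and [measurable]: "g \<in> borel_measurable borel"
    and fin: "(\<integral>\<^sup>+t. indicator {0..T} t * g t \<partial>lborel) < top"
  shows "AE t in lborel. t \<in> {0..T} \<longrightarrow> (\<integral>\<^sup>+s. indicator {0..<t} s * (ennreal ((t - s) powr (- \<beta>)) * g s) \<partial>lborel) < top"
proof -
  let ?V = "\<lambda>t. \<integral>\<^sup>+s. (if 0 \<le> s \<and> s < t then ennreal ((t - s) powr (- \<beta>)) * g s else 0) \<partial>lborel"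
  let ?k = "\<lambda>\<tau>. indicator {0<..T} \<tau> * ennreal (\<tau> powr (- \<beta>))"
  have V: "?V t = (\<integral>\<^sup>+s. indicator {0..<t} s * (ennreal ((t - s) powr (- \<beta>)) * g s) \<partial>lborel)" for t
    by (intro nn_integral_cong) auto
  have "(\<integral>\<^sup>+t. indicator {0..T} t * ?V t \<partial>lborel) =
      (\<integral>\<^sup>+t. (\<integral>\<^sup>+s. indicator {0..T} t * (if 0 \<le> s \<and> s < t then ennreal ((t - s) powr (- \<beta>)) * g s else 0) \<partial>lborel) \<partial>lborel)"
    by (simp add: nn_integral_cmult)
  also have "\<dots> = (\<integral>\<^sup>+s. (\<integral>\<^sup>+t. indicator {0..T} t * (if 0 \<le> s \<and> s < t then ennreal ((t - s) powr (- \<beta>)) * g s else 0) \<partial>lborel) \<partial>lborel)"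
    by (rule lborel_pair.Fubini') measurable
  also have "\<dots> \<le> (\<integral>\<^sup>+s. indicator {0..T} s * g s * ennreal (T powr (1 - \<beta>) / (1 - \<beta>)) \<partial>lborel)"
  proof (intro nn_integral_mono)
    fix s
    have "(\<integral>\<^sup>+t. indicator {0..T} t * (if 0 \<le> s \<and> s < t then ennreal ((t - s) powr (- \<beta>)) * g s else 0) \<partial>lborel)
      \<le> (\<integral>\<^sup>+t. indicator {0..T} s * g s * ?k (- s + t) \<partial>lborel)"
      by (intro nn_integral_mono) (auto split: split_indicator simp: mult.commute)
    also have "\<dots> = indicator {0..T} s * g s * (\<integral>\<^sup>+t. ?k (- s + t) \<partial>lborel)"
      by (rule nn_integral_cmult) measurable
    also have "(\<integral>\<^sup>+t. ?k (- s + t) \<partial>lborel) = (\<integral>\<^sup>+\<tau>. ?k \<tau> \<partial>lborel)"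
      by (rule nn_integral_lborel_shift) measurable
    finally show "(\<integral>\<^sup>+t. indicator {0..T} t * (if 0 \<le> s \<and> s < t then ennreal ((t - s) powr (- \<beta>)) * g s else 0) \<partial>lborel)
      \<le> indicator {0..T} s * g s * ennreal (T powr (1 - \<beta>) / (1 - \<beta>))"
      using \<beta> T by (simp add: nn_integral_powr_from_0)
  qed
  also have "\<dots> = (\<integral>\<^sup>+s. indicator {0..T} s * g s \<partial>lborel) * ennreal (T powr (1 - \<beta>) / (1 - \<beta>))"
    by (rule nn_integral_multc) measurable
  also have "\<dots> < top" using fin by (simp add: ennreal_mult_less_top)
  finally have "AE t in lborel. indicator {0..T} t * ?V t \<noteq> \<infinity>"
    by (intro nn_integral_PInf_AE) auto
  then show ?thesis
    unfolding V by eventually_elim (auto simp: less_top)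
qed

section \<open>Uniqueness\<close>

lemma measurable_bilin_maj_section:
  assumes [measurable]: "joint_borel a" "joint_borel b"
  shows "bilin_maj a b t \<in> borel_measurable borel"
proof -
  have "(\<lambda>x. case_prod (bilin_maj a b) (t, x)) \<in> borel_measurable borel" by measurable
  then show ?thesis by simp
qed

lemma measurable_Lnorm_section [measurable]:
  fixes a :: "real \<Rightarrow> real^3 \<Rightarrow> ennreal"
  assumes [measurable]: "joint_borel a"
  shows "(\<lambda>t. Lnorm lborel q (a t)) \<in> borel_measurable borel"
  unfolding Lnorm_def by measurable

text \<open>On a bounded interval r >= 2 makes the square of the norm integrable, and
  \<open>volterra_finite\<close> applies to it. This secures absolute convergence of the bilinear
  term for a competitor that is only L^r in time.\<close>

lemma bilin_maj_finite:
  assumes q: "q > 3" and r: "r \<ge> 2" and T: "T > 0"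
    and [measurable]: "joint_borel w"
    and fin: "(\<integral>\<^sup>+t. indicator {0..T} t * ennpowr (Lnorm lborel q (nrm w t)) r \<partial>lborel) < top"
  shows "AE t in lborel. t \<in> {0..T} \<longrightarrow> Lnorm lborel q (bilin_maj (nrm w) (nrm w) t) < top"
proof -
  let ?\<alpha> = "1/2 + 3 / (2 * q)"
  obtain C where C: "C > 0" "Lnorm lborel q (bilin_maj (nrm w) (nrm w) t) \<le>
       (\<integral>\<^sup>+s. indicator {0..<t} s * (ennreal (C * (t - s) powr (- ?\<alpha>)) * Lnorm lborel q (nrm w s) * Lnorm lborel q (nrm w s)) \<partial>lborel)" for t
  proof -
    have m: "joint_borel (nrm w)" by measurable
    from Lnorm_bilin_maj[OF q] m show ?thesis by (elim exE conjE) (rule that, auto)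
  qed
  define W where "W s = Lnorm lborel q (nrm w s)" for s
  have [measurable]: "W \<in> borel_measurable borel" unfolding W_def by measurable
  have "(\<integral>\<^sup>+t. indicator {0..T} t * (ennreal C * (W t * W t)) \<partial>lborel) \<le>
      (\<integral>\<^sup>+t. ennreal C * (indicator {0..T} t + indicator {0..T} t * ennpowr (W t) r) \<partial>lborel)"
  proof (intro nn_integral_mono)
    fix t
    have "W t * W t = ennpowr (W t) 2" using ennpowr_add[of "W t" 1 1] by simp
    also have "\<dots> \<le> 1 + ennpowr (W t) r" using r by (intro ennpowr_le_1_plus) auto
    finally have "ennreal C * (W t * W t) \<le> ennreal C * (1 + ennpowr (W t) r)" by (intro mult_left_mono) auto
    then show "indicator {0..T} t * (ennreal C * (W t * W t)) \<le> ennreal C * (indicator {0..T} t + indicator {0..T} t * ennpowr (W t) r)"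
      by (auto split: split_indicator)
  qed
  also have "\<dots> = ennreal C * (ennreal T + (\<integral>\<^sup>+t. indicator {0..T} t * ennpowr (W t) r \<partial>lborel))"
    using T by (simp add: nn_integral_cmult nn_integral_add)
  also have "\<dots> < top" using fin by (simp add: W_def ennreal_mult_less_top)
  finally have "AE t in lborel. t \<in> {0..T} \<longrightarrow> (\<integral>\<^sup>+s. indicator {0..<t} s * (ennreal ((t - s) powr (- ?\<alpha>)) * (ennreal C * (W s * W s))) \<partial>lborel) < top"
    using q T by (intro volterra_finite) (auto simp: field_simps)
  then show ?thesis
  proof eventually_elim
    case (elim t)
    have "Lnorm lborel q (bilin_maj (nrm w) (nrm w) t) \<le> (\<integral>\<^sup>+s. indicator {0..<t} s * (ennreal ((t - s) powr (- ?\<alpha>)) * (ennreal C * (W s * W s))) \<partial>lborel)"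
      using C(2)[of t] C(1) by (simp add: W_def ennreal_mult ac_simps)
    then show ?case using elim by (auto intro: le_less_trans)
  qed
qed

lemma bilin_maj_finite_AE:
  assumes "q > 0" "Lnorm lborel q (bilin_maj (nrm u) (nrm u) t) < top"
    and "joint_borel u"
  shows "AE x in lborel. bilin_maj (nrm u) (nrm u) t x < top"
proof -
  have m: "joint_borel (nrm u)" using assms(3) by measurable
  show ?thesis
    using measurable_bilin_maj_section[OF m m, of t] assms(1,2) by (intro Lnorm_finite_AE) auto
qed

lemma Lnorm_bilin_diff_le:
  assumes q: "q > 1"
    and u[measurable]: "joint_borel u" and v[measurable]: "joint_borel v"
    and fin: "Lnorm lborel q (bilin_maj (nrm u) (nrm u) t) < top" "Lnorm lborel q (bilin_maj (nrm v) (nrm v) t) < top"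
  shows "Lnorm lborel q (\<lambda>x. ennreal (norm (bilin u u t x - bilin v v t x))) \<le>
    ennreal nse_bd * Lnorm lborel q (bilin_maj (\<lambda>s y. ennreal (norm (u s y - v s y))) (\<lambda>s y. nrm u s y + nrm v s y) t)"
proof -
  let ?m = "bilin_maj (\<lambda>s y. ennreal (norm (u s y - v s y))) (\<lambda>s y. nrm u s y + nrm v s y) t"
  have [measurable]: "?m \<in> borel_measurable borel" by (rule measurable_bilin_maj_section) measurable
  have "AE x in lborel. bilin_maj (nrm u) (nrm u) t x < top" "AE x in lborel. bilin_maj (nrm v) (nrm v) t x < top"
    using q by (auto intro!: bilin_maj_finite_AE[OF _ fin(1) u] bilin_maj_finite_AE[OF _ fin(2) v])
  then have "AE x in lborel. ennreal (norm (bilin u u t x - bilin v v t x)) \<le> ennreal nse_bd * ?m x"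
    by eventually_elim (rule bilin_diff_le[OF u v])
  then have "Lnorm lborel q (\<lambda>x. ennreal (norm (bilin u u t x - bilin v v t x))) \<le> Lnorm lborel q (\<lambda>x. ennreal nse_bd * ?m x)"
    using q by (intro Lnorm_mono_AE) auto
  also have "\<dots> = ennreal nse_bd * Lnorm lborel q ?m" using q by (intro Lnorm_cmult) auto
  finally show ?thesis .
qed

text \<open>The sizes of \<open>u\<close> and \<open>v\<close> enter the inequality through their
  L^r norms in time, which are collected in the constant \<open>A\<close>. A large value is
  harmless, since \<open>volterra_zero\<close> accepts every \<open>A\<close>.\<close>

lemma bilin_unique:
  assumes q: "q > 3" and r: "r > 2" "2 / r + 3 / q < 1" and T: "T > 0"
    and u[measurable]: "joint_borel u" and v[measurable]: "joint_borel v"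
    and uf: "(\<integral>\<^sup>+t. indicator {0..T} t * ennpowr (Lnorm lborel q (nrm u t)) r \<partial>lborel) < top"
    and vf: "(\<integral>\<^sup>+t. indicator {0..T} t * ennpowr (Lnorm lborel q (nrm v t)) r \<partial>lborel) < top"
    and eq: "AE t in lborel. t \<in> {0..T} \<longrightarrow> (AE x in lborel. u t x - v t x = bilin v v t x - bilin u u t x)"
  shows "AE t in lborel. t \<in> {0..T} \<longrightarrow> (AE x in lborel. v t x = u t x)"
proof -
  define \<alpha> where "\<alpha> = 1/2 + 3 / (2 * q)"
  define p where "p = r / (r - 1)"
  have p: "p > 1" "p \<le> r" "1 / p + 1 / r = 1"
  proof -
    show "p > 1" using r by (simp add: p_def field_simps)
    have "r * 1 \<le> r * (r - 1)" using r by (intro mult_left_mono) auto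
    then show "p \<le> r" using r by (simp add: p_def field_simps)
    show "1 / p + 1 / r = 1" using r by (simp add: p_def field_simps)
  qed
  have \<alpha>: "\<alpha> \<ge> 0" using q by (simp add: \<alpha>_def)
  \<comment> \<open>Linear form of the condition: with R = 1/r and Q = 3/q it reads \<alpha> < 1 -
    1/r, that is \<alpha> p < 1, which makes the p-th power of the kernel integrable.\<close>
  have lin: "2 * R + Q < 1 \<Longrightarrow> 1 / 2 + Q / 2 < 1 - R" for Q R :: real by simp
  have "\<alpha> < 1 - 1 / r" using lin[of "1 / r" "3 / q"] r(2) by (simp add: \<alpha>_def mult.commute)
  then have "\<alpha> * p < (1 - 1 / r) * p" using p by (intro mult_strict_right_mono) auto
  also have "(1 - 1 / r) * p = 1" using r by (simp add: p_def field_simps)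
  finally have \<alpha>p: "\<alpha> * p < 1" .
  define w where "w s y = nrm u s y + nrm v s y" for s y
  define d where "d s y = ennreal (norm (u s y - v s y))" for s y
  have [measurable]: "joint_borel w" unfolding w_def[abs_def] by measurable
  have [measurable]: "joint_borel d" unfolding d_def[abs_def] by measurable
  obtain C where C: "C > 0" "Lnorm lborel q (bilin_maj d w t) \<le>
       (\<integral>\<^sup>+s. indicator {0..<t} s * (ennreal (C * (t - s) powr (- \<alpha>)) * Lnorm lborel q (d s) * Lnorm lborel q (w s)) \<partial>lborel)" for t
  proof -
    have m: "joint_borel d" "joint_borel w" by measurable
    from Lnorm_bilin_maj[OF q] m show ?thesis unfolding \<alpha>_def[symmetric] by (elim exE conjE) (rule that, auto)
  qed
  define U where "U t = Lnorm lborel q (nrm u t)" for t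
  define V where "V t = Lnorm lborel q (nrm v t)" for t
  define \<phi> where "\<phi> t = Lnorm lborel q (d t)" for t
  \<comment> \<open>Cut off to [0, T], so that its L^r norm over the line is finite and Hoelder can
    be used without restricting the measure.\<close>
  define H where "H t = indicator {0..T} t * U t + indicator {0..T} t * V t" for t
  have [measurable]: "U \<in> borel_measurable borel" "V \<in> borel_measurable borel" "\<phi> \<in> borel_measurable borel"
    unfolding U_def V_def \<phi>_def by measurable
  have [measurable]: "H \<in> borel_measurable borel" unfolding H_def by measurable
  have \<phi>le: "\<phi> t \<le> U t + V t" for t
    using Lnorm_triangle[OF sigma_finite_lborel, of q "u t" "\<lambda>_. 0" "v t"] q by (simp add: \<phi>_def d_def[abs_def] U_def V_def)
  have wle: "Lnorm lborel q (w t) \<le> U t + V t" for t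
    unfolding w_def[abs_def] U_def V_def using q by (intro Lnorm_add_le sigma_finite_lborel) auto
  have ind: "ennpowr (indicator S t * a) s = indicator S t * ennpowr a s" for S and t :: real and a s
    by (auto split: split_indicator)
  define h where "h = Lnorm lborel r H"
  have "h \<le> Lnorm lborel r (\<lambda>t. indicator {0..T} t * U t) + Lnorm lborel r (\<lambda>t. indicator {0..T} t * V t)"
    unfolding h_def H_def using r by (intro Lnorm_add_le sigma_finite_lborel) auto
  also have "\<dots> < top"
    using uf vf by (simp add: Lnorm_def[of lborel r] ind U_def[symmetric] V_def[symmetric] less_top[symmetric])
  finally have h: "h < top" .
  define A where "A = enn2real (ennpowr (ennreal (nse_bd * C) * h) p)"
  have A: "ennreal A = ennpowr (ennreal (nse_bd * C) * h) p" "A \<ge> 0"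
  proof -
    have "ennreal (nse_bd * C) * h < top" using h by (simp add: ennreal_mult_less_top)
    then have "ennpowr (ennreal (nse_bd * C) * h) p < top" by (simp add: less_top[symmetric])
    then show "ennreal A = ennpowr (ennreal (nse_bd * C) * h) p" by (simp add: A_def)
    show "A \<ge> 0" by (simp add: A_def)
  qed
  have fu: "AE t in lborel. t \<in> {0..T} \<longrightarrow> Lnorm lborel q (bilin_maj (nrm u) (nrm u) t) < top"
    using r by (intro bilin_maj_finite[OF q _ T u uf]) auto
  have fv: "AE t in lborel. t \<in> {0..T} \<longrightarrow> Lnorm lborel q (bilin_maj (nrm v) (nrm v) t) < top"
    using r by (intro bilin_maj_finite[OF q _ T v vf]) auto
  have "AE t in lborel. t \<in> {0..T} \<longrightarrow> ennpowr (\<phi> t) p \<le>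
      ennreal A * (\<integral>\<^sup>+s. indicator {0..<t} s * (ennreal ((t - s) powr (- (\<alpha> * p))) * ennpowr (\<phi> s) p) \<partial>lborel)"
    using fu fv eq
  proof eventually_elim
    case (elim t)
    show ?case
    proof
      assume t: "t \<in> {0..T}"
      define F where "F s = indicator {0..<t} s * (ennreal ((t - s) powr (- \<alpha>)) * \<phi> s)" for s
      have [measurable]: "F \<in> borel_measurable borel" unfolding F_def by measurable
      have "\<phi> t = Lnorm lborel q (\<lambda>x. ennreal (norm (bilin u u t x - bilin v v t x)))"
        unfolding \<phi>_def
      proof (rule Lnorm_cong_AE)
        show "AE x in lborel. d t x = ennreal (norm (bilin u u t x - bilin v v t x))"
          using elim(3)[rule_format, OF t] by eventually_elim (simp add: d_def norm_minus_commute)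
      qed (use q in simp)
      also have "\<dots> \<le> ennreal nse_bd * Lnorm lborel q (bilin_maj d w t)"
        unfolding d_def[abs_def] w_def[abs_def] using elim t q by (intro Lnorm_bilin_diff_le u v) auto
      also have "\<dots> \<le> ennreal nse_bd * (\<integral>\<^sup>+s. ennreal C * (F s * H s) \<partial>lborel)"
      proof (intro mult_left_mono order_trans[OF C(2)] nn_integral_mono)
        fix s
        show "indicator {0..<t} s * (ennreal (C * (t - s) powr (- \<alpha>)) * Lnorm lborel q (d s) * Lnorm lborel q (w s)) \<le> ennreal C * (F s * H s)"
        proof (cases "s \<in> {0..<t}")
          case True
          then have "s \<in> {0..T}" using t by auto
          then have "ennreal C * (F s * H s) = ennreal (C * (t - s) powr (- \<alpha>)) * \<phi> s * (U s + V s)"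
            using True C(1) by (simp add: F_def H_def ennreal_mult ac_simps)
          then show ?thesis using True wle[of s] by (simp add: \<phi>_def mult_left_mono)
        qed simp
      qed auto
      also have "\<dots> = ennreal (nse_bd * C) * (\<integral>\<^sup>+s. F s * H s \<partial>lborel)"
        using C(1) nse_bd(1) by (simp add: nn_integral_cmult ennreal_mult mult.assoc)
      also have "\<dots> \<le> ennreal (nse_bd * C) * (Lnorm lborel p F * h)"
        unfolding h_def using p r by (intro mult_left_mono nn_integral_Hoelder) auto
      finally have "\<phi> t \<le> (ennreal (nse_bd * C) * h) * Lnorm lborel p F" by (simp add: ac_simps)
      then have "ennpowr (\<phi> t) p \<le> ennpowr ((ennreal (nse_bd * C) * h) * Lnorm lborel p F) p"
        using p by (intro ennpowr_mono) auto
      also have "\<dots> = ennreal A * (\<integral>\<^sup>+s. ennpowr (F s) p \<partial>lborel)"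
        using p by (simp only: ennpowr_mult[of "_ * h"] A ennpowr_Lnorm less_trans[OF zero_less_one])
      also have "(\<lambda>s. ennpowr (F s) p) = (\<lambda>s. indicator {0..<t} s * (ennreal ((t - s) powr (- (\<alpha> * p))) * ennpowr (\<phi> s) p))"
        unfolding F_def ind by (simp add: ennpowr_mult powr_powr)
      finally show "ennpowr (\<phi> t) p \<le> ennreal A * (\<integral>\<^sup>+s. indicator {0..<t} s * (ennreal ((t - s) powr (- (\<alpha> * p))) * ennpowr (\<phi> s) p) \<partial>lborel)" .
    qed
  qed
  \<comment> \<open>Integrability of \<phi>^p follows from p <= r, which holds because r >=
    2.\<close>
  moreover have "(\<integral>\<^sup>+t. indicator {0..T} t * ennpowr (\<phi> t) p \<partial>lborel) < top"
  proof -
    have "(\<integral>\<^sup>+t. indicator {0..T} t * ennpowr (\<phi> t) p \<partial>lborel) \<le> (\<integral>\<^sup>+t. indicator {0..T} t + ennpowr (H t) r \<partial>lborel)"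
    proof (intro nn_integral_mono)
      fix t
      show "indicator {0..T} t * ennpowr (\<phi> t) p \<le> indicator {0..T} t + ennpowr (H t) r"
      proof (cases "t \<in> {0..T}")
        case True
        have "ennpowr (\<phi> t) p \<le> 1 + ennpowr (\<phi> t) r" using p by (intro ennpowr_le_1_plus) auto
        also have "\<dots> \<le> 1 + ennpowr (U t + V t) r" using \<phi>le r by (intro add_left_mono ennpowr_mono) auto
        finally show ?thesis using True by (simp add: H_def)
      qed simp
    qed
    also have "\<dots> = ennreal T + ennpowr h r"
      using T r by (simp add: nn_integral_add h_def ennpowr_Lnorm)
    also have "\<dots> < top" using h by (simp add: less_top[symmetric])
    finally show ?thesis .
  qed
  ultimately have "AE t in lborel. t \<in> {0..T} \<longrightarrow> ennpowr (\<phi> t) p = 0"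
    using \<alpha> p \<alpha>p T A(2) by (intro volterra_zero[of "\<alpha> * p" A T "\<lambda>t. ennpowr (\<phi> t) p"]) auto
  then show ?thesis
  proof eventually_elim
    case (elim t)
    show ?case
    proof
      assume "t \<in> {0..T}"
      then have "Lnorm lborel q (d t) = 0" using elim by (simp add: \<phi>_def)
      then have "AE x in lborel. d t x = 0" using q by (subst (asm) Lnorm_eq_0_iff) auto
      then show "AE x in lborel. v t x = u t x" by eventually_elim (simp add: d_def ennreal_eq_0_iff)
    qed
  qed
qed

section \<open>Variable exponents near the initial time\<close>

lemma Lq_norm_eq_Lnorm: "Lq_norm q \<phi> = Lnorm lborel q (\<lambda>x. ennreal (norm (\<phi> x)))"
  by (simp add: Lq_norm_def Lnorm_def)

text \<open>Membership in \<open>mixed_space\<close> constrains a field on \<open>I\<close> only,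
  and its values elsewhere may be arbitrary. The extension is Borel on the whole space, as the
  estimates require; closedness of \<open>I\<close> makes \<open>I \<times> UNIV\<close> a Borel
  set.\<close>

lemma measurable_extend_by_zero:
  fixes \<phi> :: "real \<Rightarrow> real^3 \<Rightarrow> real^3"
  assumes I: "closed I" and \<phi>: "(\<lambda>(t, x). \<phi> t x) \<in> borel_measurable (restrict_space lborel (I \<times> UNIV))"
  shows "joint_borel (\<lambda>t x. if t \<in> I then \<phi> t x else 0)"
proof -
  have "I \<times> (UNIV :: (real^3) set) \<in> sets borel" using I by (intro borel_closed closed_Times) auto
  then have "(\<lambda>z. indicator (I \<times> UNIV) z *\<^sub>R (case z of (t, x) \<Rightarrow> \<phi> t x)) \<in> borel_measurable (lborel :: (real \<times> (real^3)) measure)"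
    using \<phi> by (subst (asm) borel_measurable_restrict_space_iff) auto
  moreover have "(\<lambda>z. indicator (I \<times> UNIV) z *\<^sub>R (case z of (t, x) \<Rightarrow> \<phi> t x)) = case_prod (\<lambda>t x. if t \<in> I then \<phi> t x else 0)"
    by (auto simp: fun_eq_iff)
  ultimately show ?thesis by (simp add: borel_prod)
qed

text \<open>The local embedding of the variable exponent space into the one with constant exponent
  r. If the modular at level k is at most 1, it follows from N(t)^r <= k^r (1 + (N(t) / k)^p(t)),
  where N(t) is the spatial norm.\<close>

lemma mixed_space_power_finite:
  fixes \<phi> :: "real \<Rightarrow> real^3 \<Rightarrow> real^3"
  assumes p: "variable_exponent p" and I: "closed I" "{0..T} \<subseteq> I" "T > 0" and \<phi>: "\<phi> \<in> mixed_space p I q"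
    and r: "r > 0" "\<And>t. t \<in> {0..T} \<Longrightarrow> r \<le> p t"
  shows "(\<integral>\<^sup>+t. indicator {0..T} t * ennpowr (Lnorm lborel q (\<lambda>x. ennreal (norm (if t \<in> I then \<phi> t x else 0)))) r \<partial>lborel) < top"
proof -
  define L where "L t = Lnorm lborel q (\<lambda>x. ennreal (norm (if t \<in> I then \<phi> t x else 0)))" for t
  have [measurable]: "joint_borel (\<lambda>t x. if t \<in> I then \<phi> t x else 0)"
    using \<phi> by (intro measurable_extend_by_zero I(1)) (simp add: mixed_space_def)
  have "joint_borel (\<lambda>t x. ennreal (norm (if t \<in> I then \<phi> t x else 0)))"
    using measurable_compose[OF \<open>case_prod _ \<in> _\<close>, of "\<lambda>v. ennreal (norm v)" borel] by (simp add: split_beta')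
  then have [measurable]: "L \<in> borel_measurable borel"
    unfolding L_def by (rule measurable_Lnorm_section)
  \<comment> \<open>The exponent is known to be measurable on the half line only; extending it by 0
    gives a Borel function on the line.\<close>
  define p' where "p' t = indicator {0..} t *\<^sub>R p t" for t
  have [measurable]: "p' \<in> borel_measurable borel"
    using p unfolding p'_def variable_exponent_def
    by (auto simp: borel_measurable_restrict_space_iff)
  have "Luxemburg_norm p I q \<phi> < top" using \<phi> by (simp add: mixed_space_def)
  then obtain k where k: "k > 0" "(\<integral>\<^sup>+t\<in>I. ennpowr (Lq_norm q (\<phi> t) / ennreal k) (p t) \<partial>lborel) \<le> 1"
    unfolding Luxemburg_norm_def Inf_less_iff by blast
  have "(\<integral>\<^sup>+t. indicator {0..T} t * ennpowr (L t / ennreal k) (p' t) \<partial>lborel) \<le> (\<integral>\<^sup>+t\<in>I. ennpowr (Lq_norm q (\<phi> t) / ennreal k) (p t) \<partial>lborel)"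
    using I(2) by (intro nn_integral_mono) (auto simp: L_def Lq_norm_eq_Lnorm p'_def split: split_indicator)
  also note k(2)
  finally have le: "(\<integral>\<^sup>+t. indicator {0..T} t * ennpowr (L t / ennreal k) (p' t) \<partial>lborel) \<le> 1" .
  have "(\<integral>\<^sup>+t. indicator {0..T} t * ennpowr (L t) r \<partial>lborel) \<le>
      (\<integral>\<^sup>+t. ennreal (k powr r) * (indicator {0..T} t + indicator {0..T} t * ennpowr (L t / ennreal k) (p' t)) \<partial>lborel)"
  proof (intro nn_integral_mono)
    fix t
    show "indicator {0..T} t * ennpowr (L t) r \<le> ennreal (k powr r) * (indicator {0..T} t + indicator {0..T} t * ennpowr (L t / ennreal k) (p' t))"
    proof (cases "t \<in> {0..T}")
      case True
      have "L t = ennreal k * (L t / ennreal k)"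
        unfolding ennreal_times_divide mult.commute[of "ennreal k"]
        using k(1) by (intro mult_divide_eq_ennreal[symmetric]) auto
      then have "ennpowr (L t) r = ennpowr (ennreal k * (L t / ennreal k)) r" by simp
      also have "\<dots> = ennreal (k powr r) * ennpowr (L t / ennreal k) r"
        using k(1) by (simp only: ennpowr_mult) simp
      also have "\<dots> \<le> ennreal (k powr r) * (1 + ennpowr (L t / ennreal k) (p' t))"
        using r True by (intro mult_left_mono ennpowr_le_1_plus) (auto simp: p'_def)
      finally show ?thesis using True by simp
    qed simp
  qed
  also have "\<dots> = ennreal (k powr r) * (ennreal T + (\<integral>\<^sup>+t. indicator {0..T} t * ennpowr (L t / ennreal k) (p' t) \<partial>lborel))"
    using I(3) by (simp add: nn_integral_cmult nn_integral_add)
  also have "\<dots> < top"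
    using le_less_trans[OF le] by (simp add: ennreal_mult_less_top)
  finally show ?thesis by (simp add: L_def)
qed

text \<open>The modulus C / ln (e + 1/t) tends to 0, so 1/p is continuous at 0 from the
  right.\<close>

lemma log_Hoelder_near_0:
  assumes "log_Hoelder_exponent p" and "\<epsilon> > 0"
  shows "\<exists>T>0. \<forall>t\<in>{0..T}. 1 / p t \<le> 1 / p 0 + \<epsilon>"
proof -
  obtain C where C: "\<And>t s. t \<ge> 0 \<Longrightarrow> s \<ge> 0 \<Longrightarrow> t \<noteq> s \<Longrightarrow> \<bar>1 / p t - 1 / p s\<bar> \<le> C / ln (exp 1 + 1 / \<bar>t - s\<bar>)"
    using assms(1) unfolding log_Hoelder_exponent_def by auto
  have "((\<lambda>t. C / ln (exp 1 + 1 / t)) \<longlongrightarrow> 0) (at_right 0)" by real_asymp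
  then have "eventually (\<lambda>t. C / ln (exp 1 + 1 / t) < \<epsilon>) (at_right 0)"
    using assms(2) by (rule order_tendstoD)
  then obtain b where b: "b > 0" "\<And>t. 0 < t \<Longrightarrow> t < b \<Longrightarrow> C / ln (exp 1 + 1 / t) < \<epsilon>"
    by (auto simp: eventually_at_right_field)
  have "1 / p t \<le> 1 / p 0 + \<epsilon>" if "t \<in> {0..b / 2}" for t
  proof (cases "t = 0")
    case False
    then have "\<bar>1 / p t - 1 / p 0\<bar> \<le> C / ln (exp 1 + 1 / t)" using C[of t 0] that by simp
    also have "\<dots> < \<epsilon>" using that False b(1) by (intro b(2)) auto
    finally show ?thesis by linarith
  qed (use assms(2) in simp)
  then show ?thesis using b(1) by (intro exI[of _ "b / 2"]) auto
qed

lemma nn_integral_kernel: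
  assumes "\<beta> < 1" "t \<ge> 0"
  shows "(\<integral>\<^sup>+s. indicator {0..<t} s * ennreal ((t - s) powr (- \<beta>)) \<partial>lborel) = ennreal (t powr (1 - \<beta>) / (1 - \<beta>))"
proof -
  have "(\<integral>\<^sup>+s. indicator {0..<t} s * ennreal ((t - s) powr (- \<beta>)) \<partial>lborel) =
      (\<integral>\<^sup>+s. (\<lambda>\<tau>. indicator {0<..t} \<tau> * ennreal (\<tau> powr (- \<beta>))) (t - s) \<partial>lborel)"
    by (intro nn_integral_cong) (auto split: split_indicator)
  also have "\<dots> = (\<integral>\<^sup>+\<tau>. indicator {0<..t} \<tau> * ennreal (\<tau> powr (- \<beta>)) \<partial>lborel)"
    by (rule nn_integral_lborel_reflect) measurable
  finally show ?thesis using assms by (simp add: nn_integral_powr_from_0)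
qed

text \<open>Integrating (t - s)^(-\<alpha>) yields t^(1-\<alpha>), a positive power since q > 3;
  this is the source of smallness for short times.\<close>

lemma Lnorm_bilin_maj_bounded:
  assumes q: "q > 3"
  shows "\<exists>C>0. \<forall>a b t A B. joint_borel a \<longrightarrow> joint_borel b \<longrightarrow>
     (\<forall>s. Lnorm lborel q (a s) \<le> ennreal A) \<longrightarrow> (\<forall>s. Lnorm lborel q (b s) \<le> ennreal B) \<longrightarrow> A \<ge> 0 \<longrightarrow> B \<ge> 0 \<longrightarrow> t \<ge> 0 \<longrightarrow>
     Lnorm lborel q (bilin_maj a b t) \<le> ennreal (C * t powr (1/2 - 3 / (2 * q)) * A * B)"
proof -
  let ?\<alpha> = "1/2 + 3 / (2 * q)"
  have \<alpha>: "?\<alpha> < 1" "1 - ?\<alpha> = 1/2 - 3 / (2 * q)" using q by (auto simp: field_simps)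
  obtain C where C: "C > 0" "\<And>a b t. joint_borel a \<Longrightarrow> joint_borel b \<Longrightarrow>
     Lnorm lborel q (bilin_maj a b t) \<le>
       (\<integral>\<^sup>+s. indicator {0..<t} s * (ennreal (C * (t - s) powr (- ?\<alpha>)) * Lnorm lborel q (a s) * Lnorm lborel q (b s)) \<partial>lborel)"
  proof -
    from Lnorm_bilin_maj[OF q] show ?thesis by (elim exE conjE) (rule that, auto)
  qed
  have "Lnorm lborel q (bilin_maj a b t) \<le> ennreal (C / (1 - ?\<alpha>) * t powr (1/2 - 3 / (2 * q)) * A * B)"
    if m: "joint_borel a" "joint_borel b"
      and a: "\<forall>s. Lnorm lborel q (a s) \<le> ennreal A" and b: "\<forall>s. Lnorm lborel q (b s) \<le> ennreal B"
      and AB: "A \<ge> 0" "B \<ge> 0" "t \<ge> 0" for a b t A B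
  proof -
    note C(2)[OF m]
    also have "(\<integral>\<^sup>+s. indicator {0..<t} s * (ennreal (C * (t - s) powr (- ?\<alpha>)) * Lnorm lborel q (a s) * Lnorm lborel q (b s)) \<partial>lborel) \<le>
        (\<integral>\<^sup>+s. indicator {0..<t} s * (ennreal (C * (t - s) powr (- ?\<alpha>)) * ennreal A * ennreal B) \<partial>lborel)"
      using a b by (intro nn_integral_mono mult_left_mono mult_mono) auto
    also have "\<dots> = (\<integral>\<^sup>+s. ennreal (C * A * B) * (indicator {0..<t} s * ennreal ((t - s) powr (- ?\<alpha>))) \<partial>lborel)"
      using AB C(1) by (intro nn_integral_cong) (simp add: ennreal_mult ac_simps)
    also have "\<dots> = ennreal (C * A * B) * ennreal (t powr (1 - ?\<alpha>) / (1 - ?\<alpha>))"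
      unfolding nn_integral_kernel[OF \<alpha>(1) AB(3), symmetric] by (rule nn_integral_cmult) measurable
    also have "\<dots> = ennreal (C * A * B * (t powr (1 - ?\<alpha>) / (1 - ?\<alpha>)))"
      using AB C(1) \<alpha>(1) by (intro ennreal_mult[symmetric]) auto
    also have "C * A * B * (t powr (1 - ?\<alpha>) / (1 - ?\<alpha>)) = C / (1 - ?\<alpha>) * t powr (1/2 - 3 / (2 * q)) * A * B"
      unfolding \<alpha>(2) by simp
    finally show ?thesis .
  qed
  then show ?thesis using C(1) \<alpha>(1) by (intro exI[of _ "C / (1 - ?\<alpha>)"]) auto
qed

lemma bilin_zero: "bilin (\<lambda>_ _. 0) (\<lambda>_ _. 0) t x = 0"
proof -
  have "nse_apply \<tau> z 0 0 = 0" for \<tau> z by (simp add: nse_apply_def vec_eq_iff)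
  then show ?thesis by (simp add: bilin_def bilin_integrand_def split_beta')
qed

text \<open>Bridge between the definition and \<open>bilin\<close>: the integrals see
  \<open>f\<close> and \<open>v\<close> only at times in [0, t], where \<open>f'\<close> and
  \<open>v'\<close> agree with them.\<close>

lemma mild_solution_bilin:
  assumes q: "q > 0" and ext: "\<forall>s\<in>{0..T}. v' s = v s" "\<forall>s\<ge>0. f' s = f s"
    and t: "t \<in> {0..T}"
    and m: "joint_borel v'"
    and fin: "Lnorm lborel q (bilin_maj (nrm v') (nrm v') t) < top"
  shows "AE x in lborel.
      convol (heat_kernel t) u0 x + (LINT s:{0..t}|lborel. convol (heat_kernel (t - s)) (f s) x)
        - (LINT s:{0..t}|lborel. heat_convol_distr (t - s) (Leray_distr (div_tensor (tensor_prod (v s) (v s)))) x)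
      = convol (heat_kernel t) u0 x + duhamel f' t x - bilin v' v' t x"
  using bilin_maj_finite_AE[OF q fin m]
proof eventually_elim
  case (elim x)
  have "(LINT s:{0..t}|lborel. heat_convol_distr (t - s) (Leray_distr (div_tensor (tensor_prod (v s) (v s)))) x) =
      (LINT s:{0..t}|lborel. heat_convol_distr (t - s) (Leray_distr (div_tensor (tensor_prod (v' s) (v' s)))) x)"
    using ext(1) t unfolding set_lebesgue_integral_def
    by (intro Bochner_Integration.integral_cong) (auto split: split_indicator)
  also have "\<dots> = bilin v' v' t x" by (rule mild_bilinear_term[OF m elim])
  finally have 1: "(LINT s:{0..t}|lborel. heat_convol_distr (t - s) (Leray_distr (div_tensor (tensor_prod (v s) (v s)))) x) = bilin v' v' t x" .
  have "(LINT s:{0..t}|lborel. convol (heat_kernel (t - s)) (f s) x) = duhamel f' t x"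
    using ext(2) unfolding duhamel_def set_lebesgue_integral_def
    by (intro Bochner_Integration.integral_cong) (auto split: split_indicator)
  then show ?case by (simp add: 1)
qed

theorem theorem2:
  fixes p :: "real \<Rightarrow> real" and q :: real
    and f :: "real \<Rightarrow> real^3 \<Rightarrow> real^3" and u0 :: "real^3 \<Rightarrow> real^3"
  assumes "log_Hoelder_exponent p"
    and "2 < exponent_minus p" and "exponent_minus p \<le> exponent_plus p"
    and "exponent_plus p < \<infinity>"
    and "q > 3"
    and "\<forall>t\<ge>0. 2 / p t + 3 / q < 1"
    and "f \<in> mixed_space p {0..} q"
    and "AE t in lborel. t \<in> {0..} \<longrightarrow> div_free (f t)"
    and "u0 \<in> Lq_space q"
    and "div_free u0"
  shows "\<exists>T>0. \<exists>u.
           u \<in> mixed_space p {0..T} q \<and>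
           mild_solution T u0 f u \<and>
           (AE t in lborel. t \<in> {0..T} \<longrightarrow> div_free (u t)) \<and>
           (\<forall>v. v \<in> mixed_space p {0..T} q \<longrightarrow> mild_solution T u0 f v \<longrightarrow>
              (AE t in lborel. t \<in> {0..T} \<longrightarrow> (AE x in lborel. v t x = u t x)))"
proof -
  have ve: "variable_exponent p" using assms(1) by (simp add: log_Hoelder_exponent_def)
  then have p1: "1 \<le> p t" if "t \<ge> 0" for t using that by (simp add: variable_exponent_def)
  have q: "q > 3" "q > 1" "q > 0" using assms(5) by auto
  \<comment> \<open>On a short interval \<open>p\<close> is bounded below by a constant \<open>r\<close> that is still admissible.\<close>
  obtain T1 r where T1: "T1 > 0" and r: "r > 2" "2 / r + 3 / q < 1" "\<And>t. t \<in> {0..T1} \<Longrightarrow> r \<le> p t"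
  proof -
    define m where "m = 1 / p 0"
    have m: "m > 0" "2 * m + 3 / q < 1" using p1[of 0] assms(6)[rule_format, of 0] by (auto simp: m_def)
    \<comment> \<open>A quarter of the gap, because \<epsilon> enters with the factor 2: half of the
      gap is then left.\<close>
    have lin: "Q < 1 - 2 * m \<Longrightarrow> \<exists>\<epsilon>>0. 2 * (m + \<epsilon>) + Q < 1" for Q
      by (rule exI[of _ "(1 - 2 * m - Q) / 4"]) (auto simp: field_simps)
    obtain \<epsilon> where \<epsilon>: "\<epsilon> > 0" "2 * (m + \<epsilon>) + 3 / q < 1" using lin[of "3 / q"] m(2) by auto
    from log_Hoelder_near_0[OF assms(1) \<epsilon>(1)] obtain T where T: "T > 0" "\<And>t. t \<in> {0..T} \<Longrightarrow> 1 / p t \<le> m + \<epsilon>"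
      unfolding m_def by blast
    have me: "m + \<epsilon> > 0" using m \<epsilon> by simp
    have "3 / q > 0" using q by simp
    then have "2 * (m + \<epsilon>) < 1" using \<epsilon>(2) by linarith
    show ?thesis
    proof (rule that[of T "1 / (m + \<epsilon>)"])
      show "T > 0" by fact
      show "1 / (m + \<epsilon>) > 2" using \<open>2 * (m + \<epsilon>) < 1\<close> me by (simp add: field_simps)
      show "2 / (1 / (m + \<epsilon>)) + 3 / q < 1" using \<epsilon>(2) by simp
      show "1 / (m + \<epsilon>) \<le> p t" if "t \<in> {0..T}" for t
      proof -
        have "0 < p t" using p1[of t] that by simp
        then show ?thesis using T(2)[OF that] me by (simp add: field_simps)
      qed
    qed
  qed
  define f' where "f' t x = (if t \<in> {0..} then f t x else 0)" for t x
  have f'm[measurable]: "joint_borel f'"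
    unfolding f'_def[abs_def] using assms(7) by (intro measurable_extend_by_zero) (auto simp: mixed_space_def)
  have f'f: "f' t = f t" if "t \<ge> 0" for t using that by (simp add: f'_def fun_eq_iff)
  then have f'f': "\<forall>s\<ge>0. f' s = f s" by simp
  \<comment> \<open>The case r = 1 of the embedding on the fixed interval [0, 1]: it bounds the data
    before T <= 1 is chosen.\<close>
  have Ff: "(\<integral>\<^sup>+s. indicator {0..1} s * Lnorm lborel q (nrm f' s) \<partial>lborel) < top"
    using mixed_space_power_finite[OF ve _ _ _ assms(7), of 1 1] p1 by (auto simp: f'_def)
  have u0m[measurable]: "u0 \<in> borel_measurable borel" and u0f: "Lnorm lborel q (\<lambda>x. ennreal (norm (u0 x))) < top"
    using assms(9) by (auto simp: Lq_space_def Lq_norm_eq_Lnorm)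
  define A0 where "A0 = enn2real (Lnorm lborel q (\<lambda>x. ennreal (norm (u0 x))) + (\<integral>\<^sup>+s. indicator {0..1} s * Lnorm lborel q (nrm f' s) \<partial>lborel))"
  have A0: "Lnorm lborel q (\<lambda>x. ennreal (norm (u0 x))) + (\<integral>\<^sup>+s. indicator {0..1} s * Lnorm lborel q (nrm f' s) \<partial>lborel) = ennreal A0" "A0 \<ge> 0"
    using Ff u0f by (auto simp: A0_def)
  \<comment> \<open>The added 1 keeps the radius positive for zero data; \<open>R\<close> is about
    to be divided by.\<close>
  define R where "R = A0 + 1"
  have R: "R > 0" "A0 \<le> R" using A0 by (auto simp: R_def)
  define \<gamma> where "\<gamma> = 1/2 - 3 / (2 * q)"
  have \<gamma>: "\<gamma> > 0" using q by (simp add: \<gamma>_def field_simps)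
  obtain C where C: "C > 0" "\<And>a b t A B. joint_borel a \<Longrightarrow> joint_borel b \<Longrightarrow>
     (\<forall>s. Lnorm lborel q (a s) \<le> ennreal A) \<Longrightarrow> (\<forall>s. Lnorm lborel q (b s) \<le> ennreal B) \<Longrightarrow> A \<ge> 0 \<Longrightarrow> B \<ge> 0 \<Longrightarrow> t \<ge> 0 \<Longrightarrow>
     Lnorm lborel q (bilin_maj a b t) \<le> ennreal (C * t powr \<gamma> * A * B)"
  proof -
    from Lnorm_bilin_maj_bounded[OF q(1)] show ?thesis unfolding \<gamma>_def[symmetric] by (elim exE conjE) (rule that, auto)
  qed
  \<comment> \<open>Chosen so that nse_bd * C * t^\<gamma> * 4 R <= 1/2 once t^\<gamma> <= c; the
    factor 4 R bounds the norm of |u| + |v| in the ball.\<close>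
  define c where "c = 1 / (8 * R * (nse_bd * C))"
  have c: "c > 0" using R C nse_bd(1) by (simp add: c_def)
  \<comment> \<open>The bound 1 serves the data estimate and makes the modular at most 1,
    \<open>T1\<close> gives r <= p, and the last bound gives the contraction.\<close>
  define T where "T = min (min 1 T1) (c powr (1 / \<gamma>))"
  have T: "T > 0" "T \<le> 1" "T \<le> T1" "T \<le> c powr (1 / \<gamma>)" using T1 c by (auto simp: T_def)
  have small: "nse_bd * C * t powr \<gamma> * (4 * R) \<le> 1 / 2" if "t \<in> {0..T}" for t
  proof -
    have "t powr \<gamma> \<le> (c powr (1 / \<gamma>)) powr \<gamma>" using that T \<gamma> by (intro powr_mono2) auto
    also have "\<dots> = c" using \<gamma> c by (simp add: powr_powr)
    finally have "nse_bd * C * t powr \<gamma> * (4 * R) \<le> nse_bd * C * c * (4 * R)"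
      using C nse_bd(1) R by (intro mult_right_mono mult_left_mono) auto
    also have "\<dots> = 1 / 2" using C nse_bd(1) R by (simp add: c_def)
    finally show ?thesis .
  qed
  define lin where "lin t x = convol (heat_kernel t) u0 x + duhamel f' t x" for t x
  have cm[measurable]: "joint_borel (\<lambda>t x. convol (heat_kernel t) u0 x)"
    using measurable_convol_heat[of fst "borel \<Otimes>\<^sub>M borel" snd fst "\<lambda>_. u0"] by (simp add: split_beta')
  have dm[measurable]: "joint_borel (duhamel f')" by measurable
  have lm[measurable]: "joint_borel lin" unfolding lin_def[abs_def] by measurable
  have duh: "(\<integral>\<^sup>+s. indicator {0..t} s * Lnorm lborel q (nrm f' s) \<partial>lborel) \<le> (\<integral>\<^sup>+s. indicator {0..1} s * Lnorm lborel q (nrm f' s) \<partial>lborel)"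
    if "t \<le> T" for t
    using that T by (intro nn_integral_mono) (auto split: split_indicator)
  have lb: "Lnorm lborel q (nrm lin t) \<le> ennreal R" if "t \<in> {0..T}" for t
  proof -
    have "Lnorm lborel q (nrm lin t) \<le> Lnorm lborel q (\<lambda>x. ennreal (norm (convol (heat_kernel t) u0 x)) + nrm (duhamel f') t x)"
      using q by (intro Lnorm_mono) (auto simp: lin_def norm_triangle_ineq intro!: ennreal_leI simp flip: ennreal_plus)
    also have "\<dots> \<le> Lnorm lborel q (\<lambda>x. ennreal (norm (convol (heat_kernel t) u0 x))) + Lnorm lborel q (nrm (duhamel f') t)"
      using q by (intro Lnorm_add_le sigma_finite_lborel) measurable
    also have "\<dots> \<le> ennreal A0"
      unfolding A0(1)[symmetric] using that q duh[of t]
      by (intro add_mono Lnorm_convol_heat order_trans[OF Lnorm_duhamel]) auto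
    also have "\<dots> \<le> ennreal R" using R by (intro ennreal_leI) auto
    finally show ?thesis .
  qed
  \<comment> \<open>Set to 0 off [0, T], since \<open>picard_iteration\<close> asks for its bounds
    at every t.\<close>
  define \<Phi> where "\<Phi> u t x = (if t \<in> {0..T} then lin t x - bilin u u t x else 0)" for u t x
  have \<Phi>m: "joint_borel (\<Phi> u)" if [measurable]: "joint_borel u" for u
    unfolding \<Phi>_def[abs_def] by measurable
  have bfin: "Lnorm lborel q (bilin_maj (nrm u) (nrm u) t) < top"
    if [measurable]: "joint_borel u" and b: "\<And>t. Lnorm lborel q (nrm u t) \<le> ennreal (2 * R)" and "t \<in> {0..T}" for u t
  proof -
    have "joint_borel (nrm u)" by measurable
    then have "Lnorm lborel q (bilin_maj (nrm u) (nrm u) t) \<le> ennreal (C * t powr \<gamma> * (2 * R) * (2 * R))"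
      using that R by (intro C(2)) auto
    also have "\<dots> < top" by simp
    finally show ?thesis .
  qed
  have "\<exists>u. joint_borel u \<and> (\<forall>t. Lnorm lborel q (nrm u t) \<le> ennreal (2 * R)) \<and>
    (\<forall>t. AE x in lborel. \<Phi> u t x = u t x)"
  proof (rule picard_iteration[OF q(2)])
    show "0 \<le> R" using R by simp
    show "Lnorm lborel q (nrm (\<Phi> (\<lambda>_ _. 0)) t) \<le> ennreal R" for t
      using lb[of t] q by (cases "t \<in> {0..T}") (auto simp: \<Phi>_def bilin_zero)
    fix u v :: "real \<Rightarrow> real^3 \<Rightarrow> real^3" and d t :: real
    assume u[measurable]: "joint_borel u" and v[measurable]: "joint_borel v"
      and ub: "\<And>t. Lnorm lborel q (nrm u t) \<le> ennreal (2 * R)" and vb: "\<And>t. Lnorm lborel q (nrm v t) \<le> ennreal (2 * R)"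
      and d: "0 \<le> d" "\<And>t. Lnorm lborel q (\<lambda>x. ennreal (norm (u t x - v t x))) \<le> ennreal d"
    show "Lnorm lborel q (\<lambda>x. ennreal (norm (\<Phi> u t x - \<Phi> v t x))) \<le> ennreal (d / 2)"
    proof (cases "t \<in> {0..T}")
      case True
      let ?d = "\<lambda>s y. ennreal (norm (u s y - v s y))" and ?w = "\<lambda>s y. nrm u s y + nrm v s y"
      have wb: "Lnorm lborel q (?w s) \<le> ennreal (4 * R)" for s
      proof -
        have "Lnorm lborel q (?w s) \<le> Lnorm lborel q (nrm u s) + Lnorm lborel q (nrm v s)"
          using q by (intro Lnorm_add_le sigma_finite_lborel) measurable
        also have "\<dots> \<le> ennreal (2 * R) + ennreal (2 * R)" by (intro add_mono ub vb)
        finally show ?thesis using R by (simp flip: ennreal_plus)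
      qed
      have md: "joint_borel ?d" "joint_borel ?w" by measurable
      have "Lnorm lborel q (\<lambda>x. ennreal (norm (\<Phi> u t x - \<Phi> v t x))) = Lnorm lborel q (\<lambda>x. ennreal (norm (bilin u u t x - bilin v v t x)))"
        using True by (simp add: \<Phi>_def norm_minus_commute)
      also have "\<dots> \<le> ennreal nse_bd * Lnorm lborel q (bilin_maj ?d ?w t)"
        by (intro Lnorm_bilin_diff_le q u v bfin ub vb True)
      also have "\<dots> \<le> ennreal nse_bd * ennreal (C * t powr \<gamma> * d * (4 * R))"
        using True d R wb by (intro mult_left_mono C(2) md) auto
      also have "\<dots> = ennreal (nse_bd * C * t powr \<gamma> * (4 * R) * d)"
        using nse_bd(1) C(1) d(1) R by (subst ennreal_mult[symmetric]) (auto simp: ac_simps)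
      also have "\<dots> \<le> ennreal (1 / 2 * d)"
        by (intro ennreal_leI mult_right_mono small True d(1))
      finally show ?thesis by simp
    qed (use q in \<open>auto simp: \<Phi>_def\<close>)
  qed (rule \<Phi>m)
  then obtain u where um[measurable]: "joint_borel u"
    and ub: "\<And>t. Lnorm lborel q (nrm u t) \<le> ennreal (2 * R)" and fx: "\<And>t. AE x in lborel. \<Phi> u t x = u t x" by blast
  have ueq: "AE x in lborel. u t x = lin t x - bilin u u t x" if "t \<in> {0..T}" for t
    using fx[of t] by eventually_elim (use that in \<open>simp add: \<Phi>_def\<close>)
  have fin: "Lnorm lborel q (bilin_maj (nrm u) (nrm u) t) < top" if "t \<in> {0..T}" for t
    by (rule bfin[OF um ub that])

  have space: "u \<in> mixed_space p {0..T} q"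
  proof -
    have "(\<lambda>(t, x). u t x) \<in> borel_measurable (lborel :: (real \<times> (real^3)) measure)"
      using um by (simp add: borel_prod)
    then have 1: "(\<lambda>(t, x). u t x) \<in> borel_measurable (restrict_space lborel ({0..T} \<times> UNIV))"
      by (rule measurable_restrict_space1)
    \<comment> \<open>At level 2 R the ratio is at most 1, hence so is its p(t)-th power whatever
      the exponent, and the modular is at most T <= 1.\<close>
    have "(\<integral>\<^sup>+t\<in>{0..T}. ennpowr (Lq_norm q (u t) / ennreal (2 * R)) (p t) \<partial>lborel) \<le> (\<integral>\<^sup>+t. indicator {0..T} t \<partial>lborel)"
    proof (intro nn_integral_mono)
      fix t
      show "ennpowr (Lq_norm q (u t) / ennreal (2 * R)) (p t) * indicator {0..T} t \<le> indicator {0..T} t"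
      proof (cases "t \<in> {0..T}")
        case True
        have "Lq_norm q (u t) / ennreal (2 * R) \<le> ennreal (2 * R) / ennreal (2 * R)"
          using ub[of t] by (intro divide_right_mono_ennreal) (simp add: Lq_norm_eq_Lnorm)
        also have "\<dots> = ennreal 1" using R by (subst divide_ennreal) auto
        finally have "ennpowr (Lq_norm q (u t) / ennreal (2 * R)) (p t) \<le> ennpowr (ennreal 1) (p t)"
          using p1[of t] True by (intro ennpowr_mono) auto
        also have "\<dots> = 1" by (subst ennpowr_ennreal) auto
        finally show ?thesis using True by simp
      qed simp
    qed
    also have "\<dots> \<le> 1" using T by (simp add: ennreal_le_1)
    finally have "Luxemburg_norm p {0..T} q u \<le> ennreal (2 * R)"
      unfolding Luxemburg_norm_def using R by (intro Inf_lower) auto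
    then have "Luxemburg_norm p {0..T} q u < top" by (rule le_less_trans) simp
    with 1 show ?thesis by (simp add: mixed_space_def)
  qed

  have mild: "mild_solution T u0 f u"
    unfolding mild_solution_def
  proof (rule AE_I2, rule impI)
    fix t assume t: "t \<in> {0..T}"
    have uu: "\<forall>s\<in>{0..T}. u s = u s" by simp
    show "AE x in lborel. u t x = convol (heat_kernel t) u0 x
            + (LINT s:{0..t}|lborel. convol (heat_kernel (t - s)) (f s) x)
            - (LINT s:{0..t}|lborel. heat_convol_distr (t - s) (Leray_distr (div_tensor (tensor_prod (u s) (u s)))) x)"
      using ueq[OF t] mild_solution_bilin[OF q(3) uu f'f' t um fin[OF t], of u0]
      by eventually_elim (simp add: lin_def)
  qed

  \<comment> \<open>The three terms of the fixed point equation are divergence free and in L^q; the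
    equation, valid for every t in [0, T], transfers this to \<open>u t\<close>.\<close>
  have df: "div_free (u t)" if t: "t \<in> {0..T}" for t
  proof -
    have m1: "convol (heat_kernel t) u0 \<in> borel_measurable borel"
      using measurable_compose[OF measurable_Pair1' cm, of t] by simp
    have m2: "duhamel f' t \<in> borel_measurable borel"
      using measurable_compose[OF measurable_Pair1' dm, of t] by simp
    have bm: "joint_borel (bilin u u)" by measurable
    have m3: "bilin u u t \<in> borel_measurable borel"
      using measurable_compose[OF measurable_Pair1' bm, of t] by simp
    have m4: "u t \<in> borel_measurable borel"
      using measurable_compose[OF measurable_Pair1' um, of t] by simp
    have l1: "Lnorm lborel q (\<lambda>x. ennreal (norm (convol (heat_kernel t) u0 x))) < top"
      using t q u0f by (intro le_less_trans[OF Lnorm_convol_heat]) auto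
    have dfin: "(\<integral>\<^sup>+s. indicator {0..t} s * Lnorm lborel q (nrm f' s) \<partial>lborel) < top"
      using t by (intro le_less_trans[OF duh Ff]) auto
    have l2: "Lnorm lborel q (nrm (duhamel f') t) < top"
      by (rule le_less_trans[OF Lnorm_duhamel[OF q(2) f'm] dfin])
    have l3: "Lnorm lborel q (nrm (bilin u u) t) < top"
    proof -
      have mm: "joint_borel (nrm u)" by measurable
      have [measurable]: "bilin_maj (nrm u) (nrm u) t \<in> borel_measurable borel"
        by (rule measurable_bilin_maj_section[OF mm mm])
      have "Lnorm lborel q (nrm (bilin u u) t) \<le> Lnorm lborel q (\<lambda>x. ennreal nse_bd * bilin_maj (nrm u) (nrm u) t x)"
        using q by (intro Lnorm_mono bilin_norm_le um) auto
      also have "\<dots> = ennreal nse_bd * Lnorm lborel q (bilin_maj (nrm u) (nrm u) t)"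
        using q by (intro Lnorm_cmult) auto
      also have "\<dots> < top" using fin[OF t] by (simp add: ennreal_mult_less_top)
      finally show ?thesis .
    qed
    have d1: "div_free (convol (heat_kernel t) u0)"
      using t q u0f by (intro div_free_convol_heat[of t q] assms(10)) auto
    have d2: "div_free (duhamel f' t)"
    proof (rule duhamel_div_free[OF q(2) f'm dfin])
      show "AE s in lborel. s \<in> {0..t} \<longrightarrow> div_free (f' s)"
        using assms(8) by eventually_elim (auto simp: f'f)
    qed
    have d3: "div_free (bilin u u t)" by (rule bilin_div_free[OF q(2) um um fin[OF t]])
    have ml: "(\<lambda>x. convol (heat_kernel t) u0 x + duhamel f' t x) \<in> borel_measurable borel" using m1 m2 by simp
    have ll: "Lnorm lborel q (\<lambda>x. ennreal (norm (convol (heat_kernel t) u0 x + duhamel f' t x))) < top"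
      using lb[OF t] by (auto simp: lin_def intro: le_less_trans)
    have "div_free (\<lambda>x. (convol (heat_kernel t) u0 x + duhamel f' t x) + (-1) *\<^sub>R bilin u u t x)"
      using m3 l3 by (intro div_free_add[of q] q ml ll div_free_add[of q _ _, OF q(2) m1 m2 l1 l2 d1 d2] div_free_scaleR d3) auto
    then show ?thesis
      by (rule div_free_cong_AE[rotated 3]) (use ueq[OF t] m1 m2 m3 m4 in \<open>auto simp: lin_def elim!: eventually_mono\<close>)
  qed

  have unique: "AE t in lborel. t \<in> {0..T} \<longrightarrow> (AE x in lborel. v t x = u t x)"
    if v: "v \<in> mixed_space p {0..T} q" and mv: "mild_solution T u0 f v" for v
  proof -
    \<comment> \<open>A competitor is given on [0, T] only; the extension by 0 supplies joint
      measurability.\<close>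
    define v' where "v' t x = (if t \<in> {0..T} then v t x else 0)" for t x
    have v'm[measurable]: "joint_borel v'"
      unfolding v'_def[abs_def] using v by (intro measurable_extend_by_zero) (auto simp: mixed_space_def)
    have v'v: "v' t = v t" if "t \<in> {0..T}" for t using that by (simp add: v'_def fun_eq_iff)
    then have v'v': "\<forall>s\<in>{0..T}. v' s = v s" by simp
    have rT: "r \<le> p t" if "t \<in> {0..T}" for t using r(3)[of t] that T by auto
    have vf: "(\<integral>\<^sup>+t. indicator {0..T} t * ennpowr (Lnorm lborel q (nrm v' t)) r \<partial>lborel) < top"
      using mixed_space_power_finite[OF ve _ _ T(1) v _ rT] r by (auto simp: v'_def)
    have uf: "(\<integral>\<^sup>+t. indicator {0..T} t * ennpowr (Lnorm lborel q (nrm u t)) r \<partial>lborel) < top"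
    proof -
      have "(\<integral>\<^sup>+t. indicator {0..T} t * ennpowr (Lnorm lborel q (nrm u t)) r \<partial>lborel) \<le> (\<integral>\<^sup>+t. indicator {0..T} t * ennpowr (ennreal (2 * R)) r \<partial>lborel)"
        using ub r by (intro nn_integral_mono mult_left_mono ennpowr_mono) auto
      also have "\<dots> < top" using R T by (simp add: nn_integral_multc ennreal_mult_less_top)
      finally show ?thesis .
    qed
    have fv: "AE t in lborel. t \<in> {0..T} \<longrightarrow> Lnorm lborel q (bilin_maj (nrm v') (nrm v') t) < top"
      using r by (intro bilin_maj_finite[OF q(1) _ T(1) v'm vf]) auto
    \<comment> \<open>Subtracting the two integral equations cancels the common linear part and
      leaves the hypothesis of \<open>bilin_unique\<close>.\<close>
    have "AE t in lborel. t \<in> {0..T} \<longrightarrow> (AE x in lborel. u t x - v' t x = bilin v' v' t x - bilin u u t x)"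
      using fv mv[unfolded mild_solution_def]
    proof eventually_elim
      case (elim t)
      show ?case
      proof
        assume t: "t \<in> {0..T}"
        show "AE x in lborel. u t x - v' t x = bilin v' v' t x - bilin u u t x"
          using ueq[OF t] elim(2)[rule_format, OF t]
            mild_solution_bilin[OF q(3) v'v' f'f' t v'm elim(1)[rule_format, OF t], of u0]
          by eventually_elim (simp add: lin_def v'v[OF t])
      qed
    qed
    from bilin_unique[OF q(1) r(1,2) T(1) um v'm uf vf this]
    show ?thesis
      by eventually_elim (simp add: v'v)
  qed
  show ?thesis
    using T(1) space mild df unique by (intro exI[of _ T] conjI exI[of _ u]) auto
qed

end
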